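(* Assume the standing setup in the context, and assume the random shift $\hat\sigma$ together with the potential $\varphi$ is fine. Then there exists a random conformal measure $\nu=(\nu_x)_{x\in X}\in\mathcal P_m(\Omega)$, i.e. there is a measurable function $X\ni x\mapsto\lambda_x\in(0,+\infty)$ such that $\mathcal L_x^*\nu_{\theta(x)}=\lambda_x\nu_x$ for $m$-a.e. $x\in X$. In addition, $\operatorname{ess\,sup}_{x\in X}|\log\lambda_x|<\infty$.
   Context: Standing setup. $(X,\mathcal F,m)$ is a complete probability space and $\theta:X\to X$ is an invertible measurable map preserving $m$. $E=\mathbb N=\{0,1,2,\dots\}$, and $X\ni x\mapsto A(x)=(A_{ij}(x))_{i,j\in E}$ is a measurable map into $\{0,1\}$-valued matrices. For $x\in X$ and $n\ge 0$, $E_x^n$ is the set of words $\omega_0\omega_1\cdots\omega_n\in E^{n+1}$ with $A_{\omega_i\omega_{i+1}}(\theta^i(x))=1$ for $0\le i\le n-1$; for $F\subset E$, $F_x^n$ is the set of words in $E_x^n$ all of whose letters lie in $F$; $E_x^\infty$ is the set of $\omega\in E^{\mathbb N}$ with $A_{\omega_i\omega_{i+1}}(\theta^i(x))=1$ for all $i\ge0$. For $\omega\in E_x^n$, $[\omega]_x=\{\tau\in E_x^\infty:\tau_0\cdots\tau_n=\omega\}$; for $F\subset E$, $[F]_x=\bigcup_{j\in F}[j]_x$, $[0,\dots,l]_x=[\{0,\dots,l\}]_x$, and complements $B^c$ are taken in $E_x^\infty$. $E^{\mathbb N}$ carries the metric $d(\omega,\tau)=e^{-\min\{n:\omega_n\neq\tau_n\}}$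 for $\omega\ne\tau$. $\sigma$ is the left shift, $\sigma_x=\sigma|_{E_x^\infty}:E_x^\infty\to E_{\theta(x)}^\infty$, $\sigma_x^n=\sigma_{\theta^{n-1}(x)}\circ\cdots\circ\sigma_x$. $\Omega=\bigcup_{x\in X}\{x\}\times E_x^\infty$ with the restriction of the product $\sigma$-algebra of $\mathcal F$ and the Borel sets of $E^{\mathbb N}$; $\hat\sigma:\Omega\to\Omega$, $\hat\sigma(x,\omega)=(\theta(x),\sigma_x(\omega))$; for $g:\Omega\to\mathbb R$, $g_x=g(x,\cdot)$ and $S_ng=\sum_{j=0}^{n-1}g\circ\hat\sigma^j$. $\hat\sigma$ is assumed topologically mixing: for all $a,b\in E$ there is $N$ such that for every $n\ge N$ and every $x\in X$ there is a word $\omega$ of length $n+1$ with $a\omega b\in E_x^{n+2}$. Finite range: for every $e\in E$ there is a finite $D_e\subset E$ with $\{j:A_{ej}(x)=1\}\subset D_e$ for $m$-a.e. $x$. Bounded access: for every $b\in E$ there is $b^*\in E$ such that for $m$-a.e. $x$ there is $a\le b^*$ with $A_{ab}(x)=1$. Fix $\alpha>0$. For $g:E_x^\infty\to\mathbb R$, $v_\alpha(g)=\sup\{|g(\tau)-g(\omega)|/d(\tau,\omega)^\alpha:\tau\ne\omega,\ \tau_0=\omega_0\}$; $\mathcal H_\alpha(E_x^\infty)$ is the space of bounded continuous $g$ with $v_\alpha(g)<\infty$, normed by $\|g\|_\alpha=\|g\|_\infty+v_\alpha(g)$. A summable potential is a measurable $\varphi:\Omega\to\mathbb R$ with each $\varphi_x$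 continuous, $V_\alpha(\varphi):=\operatorname{ess\,sup}_x v_\alpha(\varphi_x)<\infty$, such that for every $e\in E$ there are $0<c_e<C_e<\infty$ with $c_e\le e^{\varphi_x}\le C_e$ on $[e]_x$ for $m$-a.e. $x$, and $\lim_{l\to\infty}\operatorname{ess\,sup}_x\sup\mathcal L_x(1_{[0,\dots,l]_x^c})=0$. Here the transfer operator $\mathcal L_x$ maps bounded continuous $g$ on $E_x^\infty$ to functions on $E_{\theta(x)}^\infty$ by $\mathcal L_xg(\omega)=\sum_{e\in E:\,A_{e\omega_0}(x)=1}g(e\omega)e^{\varphi_x(e\omega)}$, and $\mathcal L_x^n=\mathcal L_{\theta^{n-1}(x)}\circ\cdots\circ\mathcal L_x$. Conditions: (A) for every $e\in E$ there is $M_e\in(0,\infty)$ with $M_e^{-1}\le\mathcal L_x1$ on $[e]_{\theta(x)}$ for $m$-a.e. $x$; (B) $\lim_{e\to\infty}\operatorname{ess\,sup}_x\sup_{[e]_{\theta(x)}}\mathcal L_x1=0$; (C) there are $0<\kappa<1/4$ and a finite $F\subset E$ with $\sup\mathcal L_x(1_{E_x^\infty\setminus[F]_x})\le\kappa\inf_{[F]_{\theta(x)}}\mathcal L_x1$ for $m$-a.e. $x$. The pair $(\hat\sigma,\varphi)$ is fine if $\varphi$ is summable and (A), (B), (C) hold. A random measure is a probability measure $\nu$ on $\Omega$ with marginal $m$ on $X$; its disintegrations $\nu_x$ are Borel probability measures on $E_x^\infty$. $\mathcal P_m(\Omega)$ denotes the set of random measures. $\mathcal L_x^*\nu_{\theta(x)}$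 is the measure $B\mapsto\int\mathcal L_x1_B\,d\nu_{\theta(x)}$ on $E_x^\infty$. A random conformal measure is $\nu\in\mathcal P_m(\Omega)$ for which there is measurable $\lambda:X\to(0,\infty)$ with $\mathcal L_x^*\nu_{\theta(x)}=\lambda_x\nu_x$ for $m$-a.e. $x$. *)

theory Defs
  imports "HOL-Analysis.Analysis" "HOL-Probability.Probability"
begin

text \<open>Conventions. The base space is a measure M on a type 'a; theta is the base map.
 The random matrix is A :: 'a => nat => nat => bool, A x i j meaning A_ij(x) = 1.
 Sequences in E^N are functions nat => nat, carrying the product topology of the
 discrete space nat (which is the topology of the metric d), hence its Borel sets.\<close>

definition seq_dist :: "(nat \<Rightarrow> nat) \<Rightarrow> (nat \<Rightarrow> nat) \<Rightarrow> real" where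
  "seq_dist \<tau> \<omega> = (if \<tau> = \<omega> then 0 else exp (- real (LEAST n. \<tau> n \<noteq> \<omega> n)))"

definition Einf :: "('a \<Rightarrow> 'a) \<Rightarrow> ('a \<Rightarrow> nat \<Rightarrow> nat \<Rightarrow> bool) \<Rightarrow> 'a \<Rightarrow> (nat \<Rightarrow> nat) set" where
  "Einf \<theta> A x = {\<omega>. \<forall>i. A ((\<theta> ^^ i) x) (\<omega> i) (\<omega> (Suc i))}"

definition Omega :: "('a \<Rightarrow> 'a) \<Rightarrow> ('a \<Rightarrow> nat \<Rightarrow> nat \<Rightarrow> bool) \<Rightarrow> ('a \<times> (nat \<Rightarrow> nat)) set" where
  "Omega \<theta> A = {(x, \<omega>). \<omega> \<in> Einf \<theta> A x}"

definition OmegaM :: "'a measure \<Rightarrow> ('a \<Rightarrow> 'a) \<Rightarrow> ('a \<Rightarrow> nat \<Rightarrow> nat \<Rightarrow> bool)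
    \<Rightarrow> ('a \<times> (nat \<Rightarrow> nat)) measure" where
  "OmegaM M \<theta> A = restrict_space (M \<Otimes>\<^sub>M (borel :: (nat \<Rightarrow> nat) measure)) (Omega \<theta> A)"

text \<open>Transfer operator L_x, applied to nonnegative (ennreal-valued) functions g on E_x^infinity;
 the result is a function on E_{theta x}^infinity. e # omega is written case_nat e omega.\<close>
definition transfer :: "('a \<Rightarrow> nat \<Rightarrow> nat \<Rightarrow> bool) \<Rightarrow> ('a \<Rightarrow> (nat \<Rightarrow> nat) \<Rightarrow> real) \<Rightarrow> 'a
    \<Rightarrow> ((nat \<Rightarrow> nat) \<Rightarrow> ennreal) \<Rightarrow> (nat \<Rightarrow> nat) \<Rightarrow> ennreal" where
  "transfer A \<phi> x g \<omega> =
     (\<Sum>e. if A x e (\<omega> 0) then g (case_nat e \<omega>) * ennreal (exp (\<phi> x (case_nat e \<omega>))) else 0)"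

definition holder_var :: "('a \<Rightarrow> 'a) \<Rightarrow> ('a \<Rightarrow> nat \<Rightarrow> nat \<Rightarrow> bool) \<Rightarrow> real \<Rightarrow> 'a
    \<Rightarrow> ((nat \<Rightarrow> nat) \<Rightarrow> real) \<Rightarrow> ereal" where
  "holder_var \<theta> A \<alpha> x g =
     (SUP p \<in> {(\<tau>, \<omega>). \<tau> \<in> Einf \<theta> A x \<and> \<omega> \<in> Einf \<theta> A x \<and> \<tau> \<noteq> \<omega> \<and> \<tau> 0 = \<omega> 0}.
        ereal (\<bar>g (fst p) - g (snd p)\<bar> / (seq_dist (fst p) (snd p) powr \<alpha>)))"

definition standing_setup :: "'a measure \<Rightarrow> ('a \<Rightarrow> 'a) \<Rightarrow> ('a \<Rightarrow> nat \<Rightarrow> nat \<Rightarrow> bool) \<Rightarrow> bool" where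
  "standing_setup M \<theta> A \<longleftrightarrow>
     prob_space M \<and> complete_measure M \<and>
     \<theta> \<in> M \<rightarrow>\<^sub>M M \<and> bij_betw \<theta> (space M) (space M) \<and>
     the_inv_into (space M) \<theta> \<in> M \<rightarrow>\<^sub>M M \<and> distr M M \<theta> = M \<and>
     (\<forall>i j. (\<lambda>x. A x i j) \<in> M \<rightarrow>\<^sub>M count_space UNIV) \<and>
     \<comment> \<open>topological mixing\<close>
     (\<forall>a b. \<exists>N. \<forall>n\<ge>N. \<forall>x \<in> space M. \<exists>w::nat \<Rightarrow> nat.
        w 0 = a \<and> w (n + 2) = b \<and> (\<forall>i < n + 2. A ((\<theta> ^^ i) x) (w i) (w (Suc i)))) \<and>
     \<comment> \<open>finite range\<close>
     (\<forall>e. \<exists>D. finite D \<and> (AE x in M. \<forall>j. A x e j \<longrightarrow> j \<in> D)) \<and>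
     \<comment> \<open>bounded access\<close>
     (\<forall>b. \<exists>b'. AE x in M. \<exists>a \<le> b'. A x a b)"

definition summable_potential :: "'a measure \<Rightarrow> ('a \<Rightarrow> 'a) \<Rightarrow> ('a \<Rightarrow> nat \<Rightarrow> nat \<Rightarrow> bool)
    \<Rightarrow> real \<Rightarrow> ('a \<Rightarrow> (nat \<Rightarrow> nat) \<Rightarrow> real) \<Rightarrow> bool" where
  "summable_potential M \<theta> A \<alpha> \<phi> \<longleftrightarrow>
     (\<lambda>p. \<phi> (fst p) (snd p)) \<in> borel_measurable (OmegaM M \<theta> A) \<and>
     (\<forall>x \<in> space M. continuous_on (Einf \<theta> A x) (\<phi> x)) \<and>
     esssup M (\<lambda>x. holder_var \<theta> A \<alpha> x (\<phi> x)) < \<infinity> \<and>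
     (\<forall>e. \<exists>c C. 0 < c \<and> c < C \<and>
        (AE x in M. \<forall>\<omega> \<in> Einf \<theta> A x. \<omega> 0 = e \<longrightarrow> c \<le> exp (\<phi> x \<omega>) \<and> exp (\<phi> x \<omega>) \<le> C)) \<and>
     (\<lambda>l. esssup M (\<lambda>x. SUP \<omega> \<in> Einf \<theta> A (\<theta> x).
        transfer A \<phi> x (indicator (Einf \<theta> A x - {\<tau>. \<tau> 0 \<le> l})) \<omega>)) \<longlonglongrightarrow> 0"

definition is_fine :: "'a measure \<Rightarrow> ('a \<Rightarrow> 'a) \<Rightarrow> ('a \<Rightarrow> nat \<Rightarrow> nat \<Rightarrow> bool)
    \<Rightarrow> real \<Rightarrow> ('a \<Rightarrow> (nat \<Rightarrow> nat) \<Rightarrow> real) \<Rightarrow> bool" where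
  "is_fine M \<theta> A \<alpha> \<phi> \<longleftrightarrow>
     summable_potential M \<theta> A \<alpha> \<phi> \<and>
     \<comment> \<open>(A)\<close>
     (\<forall>e. \<exists>Me::real. 0 < Me \<and>
        (AE x in M. \<forall>\<omega> \<in> Einf \<theta> A (\<theta> x). \<omega> 0 = e \<longrightarrow>
            ennreal (1 / Me) \<le> transfer A \<phi> x (\<lambda>_. 1) \<omega>)) \<and>
     \<comment> \<open>(B)\<close>
     ((\<lambda>e. esssup M (\<lambda>x. SUP \<omega> \<in> {\<omega> \<in> Einf \<theta> A (\<theta> x). \<omega> 0 = e}.
        transfer A \<phi> x (\<lambda>_. 1) \<omega>)) \<longlonglongrightarrow> 0) \<and>
     \<comment> \<open>(C)\<close>
     (\<exists>\<kappa>::real. \<exists>F::nat set. 0 < \<kappa> \<and> \<kappa> < 1/4 \<and> finite F \<and>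
        (AE x in M. (SUP \<omega> \<in> Einf \<theta> A (\<theta> x).
              transfer A \<phi> x (indicator (Einf \<theta> A x - {\<tau> \<in> Einf \<theta> A x. \<tau> 0 \<in> F})) \<omega>)
           \<le> ennreal \<kappa> * (INF \<omega> \<in> {\<omega> \<in> Einf \<theta> A (\<theta> x). \<omega> 0 \<in> F}. transfer A \<phi> x (\<lambda>_. 1) \<omega>)))"

definition random_measure :: "'a measure \<Rightarrow> ('a \<Rightarrow> 'a) \<Rightarrow> ('a \<Rightarrow> nat \<Rightarrow> nat \<Rightarrow> bool)
    \<Rightarrow> ('a \<times> (nat \<Rightarrow> nat)) measure \<Rightarrow> bool" where
  "random_measure M \<theta> A \<nu> \<longleftrightarrow>
     sets \<nu> = sets (OmegaM M \<theta> A) \<and> prob_space \<nu> \<and> distr \<nu> M fst = M"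

definition disintegration :: "'a measure \<Rightarrow> ('a \<Rightarrow> 'a) \<Rightarrow> ('a \<Rightarrow> nat \<Rightarrow> nat \<Rightarrow> bool)
    \<Rightarrow> ('a \<times> (nat \<Rightarrow> nat)) measure \<Rightarrow> ('a \<Rightarrow> (nat \<Rightarrow> nat) measure) \<Rightarrow> bool" where
  "disintegration M \<theta> A \<nu> \<nu>x \<longleftrightarrow>
     (\<forall>x \<in> space M. prob_space (\<nu>x x) \<and>
        sets (\<nu>x x) = sets (restrict_space (borel :: (nat \<Rightarrow> nat) measure) (Einf \<theta> A x))) \<and>
     (\<forall>B \<in> sets \<nu>. (\<lambda>x. emeasure (\<nu>x x) (Pair x -` B)) \<in> borel_measurable M \<and>
        emeasure \<nu> B = (\<integral>\<^sup>+ x. emeasure (\<nu>x x) (Pair x -` B) \<partial>M))"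

definition conformal_eq :: "'a measure \<Rightarrow> ('a \<Rightarrow> 'a) \<Rightarrow> ('a \<Rightarrow> nat \<Rightarrow> nat \<Rightarrow> bool)
    \<Rightarrow> ('a \<Rightarrow> (nat \<Rightarrow> nat) \<Rightarrow> real) \<Rightarrow> ('a \<Rightarrow> (nat \<Rightarrow> nat) measure) \<Rightarrow> ('a \<Rightarrow> real) \<Rightarrow> bool" where
  "conformal_eq M \<theta> A \<phi> \<nu>x lam \<longleftrightarrow>
     (AE x in M. \<forall>B \<in> sets (\<nu>x x).
        (\<integral>\<^sup>+ \<omega>. transfer A \<phi> x (indicator B) \<omega> \<partial>(\<nu>x (\<theta> x))) = ennreal (lam x) * emeasure (\<nu>x x) B)"

end

theory Submission
  imports Defs
begin

text \<open>Fix a typical \<^term>\<open>x\<close> and look at its forward orbit only. A conformal measure gives finite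
  measures \<^term>\<open>\<mu> k\<close> on the sequence spaces over the points of the orbit that are mapped to each
  other by the dual transfer operators (after absorbing the scalars). Up to the normalization of
  \<^term>\<open>\<mu> 0\<close> and a lower bound for the mass of a finite set F of first letters, such a family is
  unique: if t is maximal with \<open>t \<mu> \<le> \<mu>'\<close>, then \<open>\<mu>' - t \<mu>\<close> is again a family of this kind, it
  charges F infinitely often, and a Harnack inequality for iterated transfer operators bounds it
  below by a multiple of \<open>\<mu>\<close>, so it vanishes. Existence follows by compactness from the
  functionals \<open>g \<mapsto> L^n g(p_n) / L^n 1(p_n)\<close>. By uniqueness these converge without
  passing to subsequences, and hence the limit depends measurably on \<^term>\<open>x\<close>.

  The set F comes from the summability of the potential, finite range and mixing: the loops at the
  letter 0 give a growth rate c, and F is taken so large that the transfer operator restricted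
  to letters outside F has norm at most c/4.\<close>


section \<open>Cylinder sets and measures on sequences\<close>

text \<open>The alphabet is infinite, so a family could lose mass to large letters or carry it along
  the orbit without returning to F. Against this stand two bounds that are uniform along the orbit:
  after the normalization by c, a step with a letter outside F costs a factor 1/4, while over at
  least \<open>N\<close> steps each letter of F is joined to F with weight at least
  \<open>w\<close>. The gap between 1/4 and 1 makes the error terms geometric and is the source of
  the factor 4/3 in the constants. The lower bound on F singles out the right families: it turns
  mass 1 at index 0 into a bound for the masses at all indices.

  The scalars come back at the end. If \<open>\<mu> 0\<close> is a probability and
  \<open>\<mu> 1\<close> has mass z, then the measure at \<theta> x is \<open>\<mu> 1\<close>
  divided by z, and the scalar at x is c / z. The measure at \<theta> x is built from the orbit of
  \<theta> x, so this has to be proved: the base point p_n is a function of \<theta>^n x alone, and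
  therefore the functionals of x and of \<theta> x agree up to a shift of the index and a common
  factor.\<close>

definition cyl :: "nat list \<Rightarrow> (nat \<Rightarrow> nat) set" where
  "cyl v = {\<omega>. \<forall>i<length v. \<omega> i = v ! i}"

lemma mem_cyl_iff_map: "\<omega> \<in> cyl v \<longleftrightarrow> map \<omega> [0..<length v] = v"
  unfolding cyl_def mem_Collect_eq by (subst list_eq_iff_nth_eq) simp

lemma cyl_Nil [simp]: "cyl [] = UNIV"
  by (simp add: cyl_def)

lemma cyl_Int: "length v \<le> length u \<Longrightarrow> cyl v \<inter> cyl u = (if take (length v) u = v then cyl u else {})"
  by (auto simp: cyl_def list_eq_iff_nth_eq)

lemma cyl_snoc: "cyl (v @ [e]) = {\<omega> \<in> cyl v. \<omega> (length v) = e}"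
  by (auto simp: cyl_def nth_append less_Suc_eq)

lemma cyl_Cons: "cyl (e # v) = {\<omega>. \<omega> 0 = e \<and> (\<lambda>i. \<omega> (Suc i)) \<in> cyl v}"
  by (auto simp: cyl_def nth_Cons split: nat.splits)

lemma sets_borel_seq:
  "sets (borel :: (nat \<Rightarrow> nat) measure) = sets (PiM UNIV (\<lambda>_. count_space UNIV))"
proof -
  have "sets (borel :: nat measure) = sets (count_space UNIV)"
    by (simp add: sets_borel_eq_count_space)
  then have "sets (PiM UNIV (\<lambda>_::nat. borel :: nat measure)) = sets (PiM UNIV (\<lambda>_. count_space UNIV))"
    by (intro sets_PiM_cong) auto
  then show ?thesis
    using sets_PiM_equal_borel[where 'a=nat and 'b=nat] by simp
qed

lemma measurable_coord [measurable]: "(\<lambda>\<omega> :: nat \<Rightarrow> nat. \<omega> i) \<in> borel \<rightarrow>\<^sub>M count_space UNIV"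
  using measurable_component_singleton[of i UNIV "\<lambda>_. count_space (UNIV::nat set)"]
  unfolding measurable_cong_sets[OF sets_borel_seq refl] by simp

lemma cyl_sets [measurable]: "cyl v \<in> sets borel"
proof (induction v rule: rev_induct)
  case (snoc e v)
  have "cyl (v @ [e]) = cyl v \<inter> ((\<lambda>\<omega>. \<omega> (length v)) -` {e} \<inter> space borel)"
    by (auto simp: cyl_snoc)
  then show ?case
    using snoc measurable_sets[OF measurable_coord[of "length v"], of "{e}"] by simp
qed simp

lemma borel_seq_eq_sigma_cyl: "sets (borel :: (nat \<Rightarrow> nat) measure) = sigma_sets UNIV (range cyl)"
proof
  show "sigma_sets UNIV (range cyl) \<subseteq> sets (borel :: (nat \<Rightarrow> nat) measure)"
    using sets.sigma_sets_subset[of "range cyl" "borel :: (nat \<Rightarrow> nat) measure"]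
    by (metis cyl_sets image_subsetI space_borel)
next
  have *: "{\<omega>. \<omega> i = e} \<in> sigma_sets UNIV (range cyl)" for i e
  proof -
    have "{\<omega>. \<omega> i = e} = (\<Union>v\<in>{v. length v = i}. cyl (v @ [e]))"
      by (auto simp: cyl_snoc mem_cyl_iff_map)
    also have "\<dots> \<in> sigma_sets UNIV (range cyl)"
      by (rule sigma_sets_UNION) (auto intro: sigma_sets.Basic)
    finally show ?thesis .
  qed
  have **: "{\<omega>. \<omega> i \<in> S} \<in> sigma_sets UNIV (range cyl)" for i S
  proof -
    have "{\<omega>. \<omega> i \<in> S} = (\<Union>e\<in>S. {\<omega> :: nat \<Rightarrow> nat. \<omega> i = e})" by auto
    also have "\<dots> \<in> sigma_sets UNIV (range cyl)"
      by (rule sigma_sets_UNION) (auto intro: *)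
    finally show ?thesis .
  qed
  have "sets (PiM UNIV (\<lambda>_. count_space UNIV)) \<subseteq> sigma_sets UNIV (range cyl)"
    unfolding sets_PiM_single by (simp, rule sigma_sets_mono) (auto simp: **)
  then show "sets (borel :: (nat \<Rightarrow> nat) measure) \<subseteq> sigma_sets UNIV (range cyl)"
    by (simp add: sets_borel_seq)
qed

text \<open>Two cylinders are nested or disjoint; the empty set is adjoined to account for the
  second case.\<close>

lemma Int_stable_cyl: "Int_stable (insert {} (range cyl))"
proof (rule Int_stableI, goal_cases)
  case (1 a b)
  have "cyl v \<inter> cyl u \<in> insert {} (range cyl)" for v u
    using cyl_Int[of v u] cyl_Int[of u v] by (cases "length v \<le> length u") (auto simp: Int_commute)
  with 1 show ?case by auto
qed

lemma sigma_cyl_insert: "sets (borel :: (nat \<Rightarrow> nat) measure) = sigma_sets UNIV (insert {} (range cyl))"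
proof
  show "sets (borel :: (nat \<Rightarrow> nat) measure) \<subseteq> sigma_sets UNIV (insert {} (range cyl))"
    unfolding borel_seq_eq_sigma_cyl by (rule sigma_sets_mono) (auto intro: sigma_sets.Basic)
  show "sigma_sets UNIV (insert {} (range cyl)) \<subseteq> sets (borel :: (nat \<Rightarrow> nat) measure)"
    using sets.sigma_sets_subset[of "insert {} (range cyl)" "borel :: (nat \<Rightarrow> nat) measure"]
    by (metis cyl_sets image_subsetI insert_subset sets.empty_sets space_borel)
qed

text \<open>Cylinders form a generating system stable under intersection that contains the whole
  space as \<open>cyl []\<close>, so one finite total mass is enough for uniqueness.\<close>

lemma measure_eqI_cyl:
  assumes "sets M = sets borel" "sets N = sets borel" "emeasure M UNIV \<noteq> \<infinity>"
    and "\<And>v. emeasure M (cyl v) = emeasure N (cyl v)"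
  shows "M = N"
  by (rule measure_eqI_generator_eq[OF Int_stable_cyl, where \<Omega>=UNIV and A="\<lambda>_. UNIV"])
    (use assms assms(4)[of "[]"] range_eqI[of UNIV cyl "[]"] in \<open>auto simp: sigma_cyl_insert\<close>)

lemma emeasure_cyl_snoc:
  assumes [measurable_cong]: "sets M = sets borel"
  shows "emeasure M (cyl v) = (\<Sum>e. emeasure M (cyl (v @ [e])))"
proof -
  have "cyl v = (\<Union>e. cyl (v @ [e]))" by (auto simp: cyl_snoc)
  moreover have "(\<Sum>e. emeasure M (cyl (v @ [e]))) = emeasure M (\<Union>e. cyl (v @ [e]))"
    by (rule suminf_emeasure) (auto simp: cyl_snoc disjoint_family_on_def assms)
  ultimately show ?thesis by simp
qed

lemma sums_nonneg_le:
  fixes f :: "nat \<Rightarrow> real"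
  assumes "\<And>i. 0 \<le> f i" "f sums s"
  shows "f i \<le> s"
  using sum_le_suminf[of f "{i}"] assms by (auto simp: sums_iff)

text \<open>The Ionescu-Tulcea theorem realizes the weights: letters are drawn one after the other,
  the letter after the word v being e with probability m (v @ [e]) / m v. The summation condition
  says that these probabilities add up to 1.\<close>

lemma cylinder_extension_prob:
  fixes m :: "nat list \<Rightarrow> real"
  assumes nn: "\<And>v. 0 \<le> m v" and add: "\<And>v. (\<lambda>e. m (v @ [e])) sums m v" and one: "m [] = 1"
  obtains \<mu> where "sets \<mu> = sets borel" "\<And>v. emeasure \<mu> (cyl v) = ennreal (m v)"
proof -
  define Mc where "Mc = (\<lambda>_::nat. count_space (UNIV::nat set))"
  \<comment> \<open>After a word of weight 0 the quotient is meaningless. A point mass at the letter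
    0 keeps the kernel a probability; all extensions of such a word have weight 0 too, so the choice
    has no effect.\<close>
  define K :: "nat list \<Rightarrow> nat measure" where
    "K v = (if m v = 0 then return (count_space UNIV) 0
            else density (count_space UNIV) (\<lambda>e. ennreal (m (v @ [e]) / m v)))" for v
  define P where "P i \<omega> = K (map \<omega> [0..<i])" for i and \<omega> :: "nat \<Rightarrow> nat"
  have sK [simp]: "sets (K v) = sets (count_space UNIV)" "space (K v) = UNIV" for v
    by (auto simp: K_def)
  have pK: "prob_space (K v)" for v
  proof (cases "m v = 0")
    case True then show ?thesis by (simp add: K_def prob_space_return)
  next
    case False
    have "(\<Sum>e. ennreal (m (v @ [e]) / m v)) = ennreal (m v / m v)"
      by (intro suminf_ennreal_eq sums_divide add) (auto simp: nn)
    then have "emeasure (K v) (space (K v)) = 1"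
      using False by (simp add: K_def emeasure_density nn_integral_count_space_nat)
    then show ?thesis by (rule prob_spaceI)
  qed
  have map_meas: "(\<lambda>\<omega>. map \<omega> [0..<i]) \<in> PiM {0..<i} Mc \<rightarrow>\<^sub>M count_space UNIV" for i
  proof (rule measurableI)
    fix S :: "nat list set"
    have "(\<lambda>\<omega>. map \<omega> [0..<i]) -` {v} \<inter> space (PiM {0..<i} Mc) \<in> sets (PiM {0..<i} Mc)" for v :: "nat list"
    proof (cases "length v = i")
      case True
      have "(\<lambda>\<omega>. map \<omega> [0..<i]) -` {v} \<inter> space (PiM {0..<i} Mc) = PiE {0..<i} (\<lambda>j. {v ! j})"
      proof -
        have "map \<omega> [0..<i] = v \<longleftrightarrow> (\<forall>j<i. \<omega> j = v ! j)" for \<omega>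
          using True by (subst list_eq_iff_nth_eq) simp
        then show ?thesis by (auto simp: space_PiM Mc_def PiE_iff)
      qed
      also have "\<dots> \<in> sets (PiM {0..<i} Mc)"
        by (rule sets_PiM_I_finite) (auto simp: Mc_def)
      finally show ?thesis .
    next
      case False
      then have "(\<lambda>\<omega>. map \<omega> [0..<i]) -` {v} \<inter> space (PiM {0..<i} Mc) = {}" by auto
      then show ?thesis by simp
    qed
    then have "(\<Union>v\<in>S. (\<lambda>\<omega>. map \<omega> [0..<i]) -` {v} \<inter> space (PiM {0..<i} Mc)) \<in> sets (PiM {0..<i} Mc)"
      by (intro sets.countable_UN'') auto
    also have "(\<Union>v\<in>S. (\<lambda>\<omega>. map \<omega> [0..<i]) -` {v} \<inter> space (PiM {0..<i} Mc))
       = (\<lambda>\<omega>. map \<omega> [0..<i]) -` S \<inter> space (PiM {0..<i} Mc)" by auto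
    finally show "(\<lambda>\<omega>. map \<omega> [0..<i]) -` S \<inter> space (PiM {0..<i} Mc) \<in> sets (PiM {0..<i} Mc)" .
  qed auto
  have mP: "P i \<in> PiM {0..<i} Mc \<rightarrow>\<^sub>M subprob_algebra (Mc i)" for i
  proof -
    have "K \<in> count_space UNIV \<rightarrow>\<^sub>M subprob_algebra (Mc i)"
      using pK by (auto simp: space_subprob_algebra Mc_def prob_space_imp_subprob_space)
    from measurable_compose[OF map_meas this] show ?thesis unfolding P_def .
  qed
  interpret IT: Ionescu_Tulcea P Mc
    by (rule Ionescu_Tulcea.intro[OF mP]) (simp add: P_def pK)
  \<comment> \<open>The state after n letters is a function on \<open>{0..<n}\<close>, equal to
    \<open>undefined\<close> elsewhere. There are countably many such states, so it is enough to
    follow single points.\<close>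
  have C_val: "emeasure (IT.C 0 n (\<lambda>_. undefined)) {y} = ennreal (m (map y [0..<n]))"
    if "y \<in> extensional {0..<n}" for y n
    using that
  proof (induction n arbitrary: y)
    case 0
    then show ?case
      by (simp add: one PiM_empty)
  next
    case (Suc n)
    define y0 where "y0 = restrict y {0..<n}"
    have y0: "y0 \<in> extensional {0..<n}" by (simp add: y0_def)
    have mapy: "map y0 [0..<n] = map y [0..<n]" by (simp add: y0_def)
    have y0s: "y0 \<in> space (PiM {0..<n} Mc)"
      using y0 by (simp add: space_PiM Mc_def PiE_iff)
    have singl: "{z} \<in> sets (PiM {0..<k} Mc)" if "z \<in> extensional {0..<k}" for z k
    proof -
      have "{z} = PiE {0..<k} (\<lambda>j. {z j})"
        using that by (auto intro!: PiE_I PiE_ext[of _ "{0..<k}" "\<lambda>j. {z j}"] simp: extensional_def)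
      also have "\<dots> \<in> sets (PiM {0..<k} Mc)" by (rule sets_PiM_I_finite) (auto simp: Mc_def)
      finally show ?thesis .
    qed
    have space0: "(\<lambda>_. undefined) \<in> space (PiM {0..<0} Mc)" by (simp add: space_PiM)
    have spC: "space (IT.C 0 n (\<lambda>_. undefined)) = space (PiM {0..<n} Mc)"
      using IT.space_C[OF space0] by simp
    have setC: "sets (IT.C 0 n (\<lambda>_. undefined)) = sets (PiM {0..<n} Mc)"
      using IT.sets_C[OF space0] by simp
    have ne: "space (IT.C 0 n (\<lambda>_. undefined)) \<noteq> {}" using spC y0s by auto
    have meP: "IT.eP n \<in> IT.C 0 n (\<lambda>_. undefined) \<rightarrow>\<^sub>M subprob_algebra (PiM {0..<Suc n} Mc)"
      using IT.measurable_eP[of n] by (simp cong: measurable_cong_sets add: setC)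
    have "emeasure (IT.C 0 (Suc n) (\<lambda>_. undefined)) {y}
        = (\<integral>\<^sup>+ \<omega>. emeasure (IT.eP n \<omega>) {y} \<partial>IT.C 0 n (\<lambda>_. undefined))"
      using emeasure_bind[OF ne meP singl[OF Suc.prems]] by simp
    also have "\<dots> = (\<integral>\<^sup>+ \<omega>. emeasure (K (map y [0..<n])) {y n} * indicator {y0} \<omega> \<partial>IT.C 0 n (\<lambda>_. undefined))"
    proof (rule nn_integral_cong)
      fix \<omega> assume "\<omega> \<in> space (IT.C 0 n (\<lambda>_. undefined))"
      then have w: "\<omega> \<in> space (PiM {0..<n} Mc)" by (simp add: spC)
      then have we: "\<omega> \<in> extensional {0..<n}" by (auto simp: space_PiM PiE_iff)
      have "emeasure (IT.eP n \<omega>) {y} = emeasure (P n \<omega>) ((\<lambda>x. fun_upd \<omega> n x) -` {y} \<inter> space (Mc n))"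
        by (rule IT.emeasure_eP[OF w singl[OF Suc.prems]])
      also have "(\<lambda>x. fun_upd \<omega> n x) -` {y} \<inter> space (Mc n) = (if \<omega> = y0 then {y n} else {})"
      proof -
        have "fun_upd \<omega> n x = y \<longleftrightarrow> \<omega> = y0 \<and> x = y n" for x
          using we Suc.prems unfolding y0_def by (auto simp: extensional_def fun_eq_iff less_Suc_eq) metis
        then show ?thesis by (auto simp: Mc_def)
      qed
      finally show "emeasure (IT.eP n \<omega>) {y} = emeasure (K (map y [0..<n])) {y n} * indicator {y0} \<omega>"
        by (cases "\<omega> = y0") (simp_all add: P_def[of n] mapy)
    qed
    also have "\<dots> = emeasure (K (map y [0..<n])) {y n} * ennreal (m (map y [0..<n]))"
      using singl[OF y0] Suc.IH[OF y0] by (simp add: nn_integral_cmult_indicator setC mapy)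
    also have "\<dots> = ennreal (m (map y [0..<Suc n]))"
    proof (cases "m (map y [0..<n]) = 0")
      case True
      have "m (map y [0..<n] @ [y n]) = 0"
        using sums_nonneg_le[OF nn add] nn True by (metis antisym)
      then show ?thesis using True by simp
    next
      case False
      have "emeasure (K (map y [0..<n])) {y n} = ennreal (m (map y [0..<n] @ [y n]) / m (map y [0..<n]))"
        using False by (simp add: K_def emeasure_density nn_integral_count_space_indicator[symmetric] nn_integral_indicator_singleton)
      then show ?thesis using False nn by (simp flip: ennreal_mult)
    qed
    finally show ?case .
  qed
  show thesis
  proof (rule that[of IT.PF.lim])
    show "sets IT.PF.lim = sets borel"
      using IT.PF.sets_lim by (simp add: sets_borel_seq flip: Mc_def)
    fix v :: "nat list"
    define n where "n = length v"
    define y where "y = restrict (\<lambda>i. v ! i) {0..<n}"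
    have y: "y \<in> extensional {0..<n}" by (simp add: y_def)
    have my: "map y [0..<n] = v" unfolding y_def n_def by (subst list_eq_iff_nth_eq) simp
    have ys: "{y} \<in> sets (PiM {0..<n} Mc)"
    proof -
      have "{y} = PiE {0..<n} (\<lambda>j. {y j})"
        using y by (auto intro!: PiE_I PiE_ext[of _ "{0..<n}" "\<lambda>j. {y j}"] simp: extensional_def)
      also have "\<dots> \<in> sets (PiM {0..<n} Mc)" by (rule sets_PiM_I_finite) (auto simp: Mc_def)
      finally show ?thesis .
    qed
    have "cyl v = IT.PF.emb UNIV {0..<n} {y}"
    proof -
      have "restrict x {0..<n} = y \<longleftrightarrow> x \<in> cyl v" for x
        unfolding cyl_def y_def n_def fun_eq_iff by (auto simp: restrict_def split: if_splits)
      then show ?thesis by (auto simp: prod_emb_def Mc_def)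
    qed
    then have "emeasure IT.PF.lim (cyl v) = emeasure (IT.CI {0..<n}) {y}"
      using IT.lim[OF _ ys] by simp
    also have "\<dots> = emeasure (IT.C 0 n (\<lambda>_. undefined)) (IT.PF.emb {0..<n} {0..<n} {y})"
      by (rule IT.emeasure_CI[OF order_refl ys])
    also have "IT.PF.emb {0..<n} {0..<n} {y} = {y}"
      by (intro prod_emb_id) (auto simp: y_def Mc_def)
    finally show "emeasure IT.PF.lim (cyl v) = ennreal (m v)"
      using C_val[OF y] my by simp
  qed
qed

text \<open>Divide by the total weight; if that is 0, all weights vanish by the summation condition
  and the null measure serves.\<close>

lemma cylinder_extension:
  fixes m :: "nat list \<Rightarrow> real"
  assumes nn: "\<And>v. 0 \<le> m v" and add: "\<And>v. (\<lambda>e. m (v @ [e])) sums m v"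
  obtains \<mu> where "sets \<mu> = sets borel" "\<And>v. emeasure \<mu> (cyl v) = ennreal (m v)"
proof (cases "m [] = 0")
  case True
  have z: "m v = 0" for v
  proof (induction v rule: rev_induct)
    case (snoc e v)
    show ?case
      using sums_nonneg_le[OF nn add] nn snoc by (metis antisym)
  qed (use True in simp)
  show thesis by (rule that[of "null_measure borel"]) (auto simp: z)
next
  case False
  obtain \<mu> where \<mu>: "sets \<mu> = sets borel" "\<And>v. emeasure \<mu> (cyl v) = ennreal (m v / m [])"
    by (rule cylinder_extension_prob[of "\<lambda>v. m v / m []"]) (use nn False in \<open>auto intro!: sums_divide add\<close>)
  show thesis
    by (rule that[of "scale_measure (ennreal (m [])) \<mu>"])
      (use \<mu> nn False in \<open>auto simp flip: ennreal_mult\<close>)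
qed

section \<open>The transfer operator\<close>

lemma transfer_eq_nn_integral:
  "transfer A \<phi> x g \<omega> = (\<integral>\<^sup>+ e. (if A x e (\<omega> 0) then g (case_nat e \<omega>) * ennreal (exp (\<phi> x (case_nat e \<omega>))) else 0)
     \<partial>count_space UNIV)"
  by (simp add: transfer_def nn_integral_count_space_nat)

lemma transfer_add: "transfer A \<phi> x (\<lambda>\<tau>. g \<tau> + h \<tau>) \<omega> = transfer A \<phi> x g \<omega> + transfer A \<phi> x h \<omega>"
  unfolding transfer_eq_nn_integral
  by (subst nn_integral_add[symmetric]) (auto intro!: nn_integral_cong simp: distrib_right)

lemma transfer_cmult: "transfer A \<phi> x (\<lambda>\<tau>. c * g \<tau>) \<omega> = c * transfer A \<phi> x g \<omega>"
  unfolding transfer_eq_nn_integral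
  by (subst nn_integral_cmult[symmetric]) (auto intro!: nn_integral_cong simp: mult.assoc)

lemma transfer_suminf: "transfer A \<phi> x (\<lambda>\<tau>. \<Sum>i. g i \<tau>) \<omega> = (\<Sum>i. transfer A \<phi> x (g i) \<omega>)"
proof -
  have "(if A x e (\<omega> 0) then (\<Sum>i. g i (case_nat e \<omega>)) * ennreal (exp (\<phi> x (case_nat e \<omega>))) else 0)
     = (\<Sum>i. if A x e (\<omega> 0) then g i (case_nat e \<omega>) * ennreal (exp (\<phi> x (case_nat e \<omega>))) else 0)" for e
    by simp
  then show ?thesis
    unfolding transfer_eq_nn_integral by (subst nn_integral_suminf[symmetric]) (auto intro!: nn_integral_cong)
qed

lemma transfer_mono:
  assumes "\<And>e. A x e (\<omega> 0) \<Longrightarrow> g (case_nat e \<omega>) \<le> h (case_nat e \<omega>)"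
  shows "transfer A \<phi> x g \<omega> \<le> transfer A \<phi> x h \<omega>"
  unfolding transfer_eq_nn_integral
  by (rule nn_integral_mono) (auto intro!: mult_right_mono assms)

lemma transfer_SUP:
  assumes "incseq g"
  shows "transfer A \<phi> x (\<lambda>\<tau>. SUP i::nat. g i \<tau>) \<omega> = (SUP i. transfer A \<phi> x (g i) \<omega>)"
  unfolding transfer_eq_nn_integral
  by (subst nn_integral_monotone_convergence_SUP[symmetric])
    (use assms in \<open>auto intro!: nn_integral_cong mult_right_mono simp: incseq_def le_fun_def SUP_mult_right_ennreal\<close>)

text \<open>Of all preimages \<open>case_nat a \<omega>\<close> only the one with a = e can lie in
  the cylinder.\<close>

lemma transfer_indicator_cyl_Cons:
  "transfer A \<phi> x (indicator (cyl (e # v))) \<omega> =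
     (if A x e (\<omega> 0) then indicator (cyl v) \<omega> * ennreal (exp (\<phi> x (case_nat e \<omega>))) else 0)"
proof -
  have "indicator (cyl (e # v)) (case_nat a \<omega>) = (if a = e then indicator (cyl v) \<omega> else (0::ennreal))" for a
    by (auto simp: cyl_Cons indicator_def)
  then have "transfer A \<phi> x (indicator (cyl (e # v))) \<omega> =
     (\<Sum>a. if a = e then (if A x e (\<omega> 0) then indicator (cyl v) \<omega> * ennreal (exp (\<phi> x (case_nat e \<omega>))) else 0) else 0)"
    unfolding transfer_def by (intro arg_cong[where f=suminf]) (auto simp: fun_eq_iff)
  also have "\<dots> = (if A x e (\<omega> 0) then indicator (cyl v) \<omega> * ennreal (exp (\<phi> x (case_nat e \<omega>))) else 0)"
    by (rule sums_unique[symmetric], rule sums_single)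
  finally show ?thesis .
qed

text \<open>The cocycle product of the transfer operators at x, \<theta> x, ..., with the one at x
  applied first: functions over x become functions over \<theta>^n x. The newest operator stands
  outside, which suits inductions in which the end point moves along the orbit.\<close>

primrec tpow :: "('a \<Rightarrow> 'a) \<Rightarrow> ('a \<Rightarrow> nat \<Rightarrow> nat \<Rightarrow> bool) \<Rightarrow> ('a \<Rightarrow> (nat \<Rightarrow> nat) \<Rightarrow> real) \<Rightarrow> 'a
    \<Rightarrow> nat \<Rightarrow> ((nat \<Rightarrow> nat) \<Rightarrow> ennreal) \<Rightarrow> (nat \<Rightarrow> nat) \<Rightarrow> ennreal" where
  "tpow \<theta> A \<phi> x 0 u = u"
| "tpow \<theta> A \<phi> x (Suc n) u = transfer A \<phi> ((\<theta> ^^ n) x) (tpow \<theta> A \<phi> x n u)"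

lemma tpow_add: "tpow \<theta> A \<phi> x (m + n) u = tpow \<theta> A \<phi> ((\<theta> ^^ m) x) n (tpow \<theta> A \<phi> x m u)"
  by (induction n) (auto simp: funpow_add add.commute)

lemma tpow_plus: "tpow \<theta> A \<phi> x n (\<lambda>\<tau>. g \<tau> + h \<tau>) = (\<lambda>\<omega>. tpow \<theta> A \<phi> x n g \<omega> + tpow \<theta> A \<phi> x n h \<omega>)"
  by (induction n) (auto simp: transfer_add)

lemma tpow_cmult: "tpow \<theta> A \<phi> x n (\<lambda>\<tau>. c * g \<tau>) = (\<lambda>\<omega>. c * tpow \<theta> A \<phi> x n g \<omega>)"
  by (induction n) (auto simp: transfer_cmult)

lemma mem_Einf_iff: "\<omega> \<in> Einf \<theta> A x \<longleftrightarrow> (\<forall>i. A ((\<theta> ^^ i) x) (\<omega> i) (\<omega> (Suc i)))"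
  by (simp add: Einf_def)

lemma case_nat_in_Einf:
  assumes "\<omega> \<in> Einf \<theta> A (\<theta> x)" "A x e (\<omega> 0)"
  shows "case_nat e \<omega> \<in> Einf \<theta> A x"
  unfolding mem_Einf_iff
proof
  fix i show "A ((\<theta> ^^ i) x) (case_nat e \<omega> i) (case_nat e \<omega> (Suc i))"
    using assms by (cases i) (auto simp: mem_Einf_iff funpow_swap1)
qed

text \<open>Prepending an admissible letter to an admissible sequence gives an admissible sequence,
  so the two functions need to be compared only there.\<close>

lemma transfer_mono_Einf:
  assumes "\<omega> \<in> Einf \<theta> A (\<theta> x)" "\<And>\<tau>. \<tau> \<in> Einf \<theta> A x \<Longrightarrow> g \<tau> \<le> h \<tau>"
  shows "transfer A \<phi> x g \<omega> \<le> transfer A \<phi> x h \<omega>"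
  by (rule transfer_mono, rule assms(2), rule case_nat_in_Einf[OF assms(1)])

lemma tpow_mono_Einf:
  assumes "\<omega> \<in> Einf \<theta> A ((\<theta> ^^ n) x)" "\<And>\<tau>. \<tau> \<in> Einf \<theta> A x \<Longrightarrow> g \<tau> \<le> h \<tau>"
  shows "tpow \<theta> A \<phi> x n g \<omega> \<le> tpow \<theta> A \<phi> x n h \<omega>"
  using assms(1)
proof (induction n arbitrary: \<omega>)
  case (Suc n)
  then have "\<omega> \<in> Einf \<theta> A (\<theta> ((\<theta> ^^ n) x))" by simp
  then show ?case unfolding tpow.simps by (rule transfer_mono_Einf) (rule Suc.IH)
qed (use assms(2) in auto)

lemma measurable_case_nat_seq [measurable]: "(\<lambda>\<omega>. case_nat e \<omega>) \<in> (borel :: (nat \<Rightarrow> nat) measure) \<rightarrow>\<^sub>M borel"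
proof -
  have "(\<lambda>\<omega> n. case_nat e \<omega> n) \<in> borel \<rightarrow>\<^sub>M PiM UNIV (\<lambda>_. count_space (UNIV :: nat set))"
  proof (rule measurable_PiM_single')
    fix i :: nat
    show "(\<lambda>\<omega>. case_nat e \<omega> i) \<in> borel \<rightarrow>\<^sub>M count_space UNIV"
      by (cases i) auto
  qed auto
  then show ?thesis
    unfolding measurable_cong_sets[OF refl sets_borel_seq] by simp
qed

lemma transfer_measurable:
  assumes [measurable]: "u \<in> borel_measurable borel" "\<phi> x \<in> borel_measurable borel"
  shows "transfer A \<phi> x u \<in> borel_measurable borel"
proof -
  have [measurable]: "Measurable.pred borel (\<lambda>\<omega> :: nat \<Rightarrow> nat. A x e (\<omega> 0))" for e
    using measurable_compose[OF measurable_coord[of 0], of "A x e" "count_space UNIV"] by simp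
  show ?thesis unfolding transfer_def[abs_def] by measurable
qed

lemma tpow_measurable:
  assumes "u \<in> borel_measurable borel" "\<And>x. \<phi> x \<in> borel_measurable borel"
  shows "tpow \<theta> A \<phi> x n u \<in> borel_measurable borel"
  by (induction n) (auto intro!: transfer_measurable assms)

lemma Einf_sets [measurable]: "Einf \<theta> A x \<in> sets borel"
proof -
  have [measurable]: "Measurable.pred borel (\<lambda>\<omega> :: nat \<Rightarrow> nat. A y (\<omega> i) (\<omega> j))" for i j :: nat and y
  proof -
    have "(\<lambda>\<omega>. (\<omega> i, \<omega> j)) \<in> (borel :: (nat \<Rightarrow> nat) measure) \<rightarrow>\<^sub>M count_space UNIV \<Otimes>\<^sub>M count_space UNIV"
      by measurable
    then have "(\<lambda>\<omega>. (\<omega> i, \<omega> j)) \<in> (borel :: (nat \<Rightarrow> nat) measure) \<rightarrow>\<^sub>M count_space UNIV"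
      by (simp add: pair_measure_countable)
    from measurable_compose[OF this, of "\<lambda>(a, b). A y a b" "count_space UNIV"] show ?thesis by simp
  qed
  have "{\<omega> \<in> space borel. \<forall>i. A ((\<theta> ^^ i) x) (\<omega> i) (\<omega> (Suc i))} \<in> sets borel"
    by measurable
  then show ?thesis by (simp add: Einf_def)
qed

text \<open>A forbidden transition at place i is visible in the first i + 2 letters. As there are
  only countably many words, a measure known on cylinders can thus be shown to live on the
  admissible sequences.\<close>

lemma compl_Einf_eq_cyl: "- Einf \<theta> A x = (\<Union>v\<in>{v. cyl v \<inter> Einf \<theta> A x = {}}. cyl v)"
proof (rule set_eqI, rule iffI)
  fix \<omega> assume "\<omega> \<in> - Einf \<theta> A x"
  then obtain i where i: "\<not> A ((\<theta> ^^ i) x) (\<omega> i) (\<omega> (Suc i))" by (auto simp: mem_Einf_iff)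
  define v where "v = map \<omega> [0..<Suc (Suc i)]"
  have "\<tau> i = \<omega> i \<and> \<tau> (Suc i) = \<omega> (Suc i)" if "\<tau> \<in> cyl v" for \<tau>
  proof -
    have "\<forall>j < Suc (Suc i). \<tau> j = \<omega> j"
      using that unfolding v_def cyl_def by (auto simp del: upt_Suc)
    then show ?thesis by auto
  qed
  then have "cyl v \<inter> Einf \<theta> A x = {}" using i by (force simp: mem_Einf_iff)
  moreover have "\<omega> \<in> cyl v" by (simp add: mem_cyl_iff_map v_def del: upt_Suc)
  ultimately show "\<omega> \<in> (\<Union>v\<in>{v. cyl v \<inter> Einf \<theta> A x = {}}. cyl v)" by blast
qed auto

text \<open>\<open>M'\<close> is the sum of \<open>N\<close> and t times \<open>M\<close>. Writing a
  difference of measures in this additive form keeps subtraction out of the extended nonnegative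
  reals.\<close>

lemma nn_integral_lincomb_measure:
  assumes sets: "sets N = sets M'" "sets M = sets M'"
    and eq: "\<And>B. B \<in> sets M' \<Longrightarrow> emeasure M' B = emeasure N B + t * emeasure M B"
    and u: "u \<in> borel_measurable M'"
  shows "(\<integral>\<^sup>+ x. u x \<partial>M') = (\<integral>\<^sup>+ x. u x \<partial>N) + t * (\<integral>\<^sup>+ x. u x \<partial>M)"
  using u
proof (induction rule: borel_measurable_induct)
  case (cong f g)
  then have "(\<integral>\<^sup>+ x. f x \<partial>K) = (\<integral>\<^sup>+ x. g x \<partial>K)" if "sets K = sets M'" for K
    using sets_eq_imp_space_eq[OF that] by (auto intro!: nn_integral_cong)
  with cong sets show ?case by metis
next
  case (set B) then show ?case using eq sets by simp
next
  case (mult u c)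
  then have "u \<in> borel_measurable N" "u \<in> borel_measurable M"
    using sets by (simp_all cong: measurable_cong_sets)
  with mult show ?case by (simp add: nn_integral_cmult distrib_left ac_simps)
next
  case (add u v)
  then have "u \<in> borel_measurable N" "u \<in> borel_measurable M" "v \<in> borel_measurable N" "v \<in> borel_measurable M"
    using sets by (simp_all cong: measurable_cong_sets)
  with add show ?case by (simp add: nn_integral_add distrib_left ac_simps)
next
  case (seq U)
  then have m: "\<And>i. U i \<in> borel_measurable N" "\<And>i. U i \<in> borel_measurable M"
    using sets by (simp_all cong: measurable_cong_sets)
  have inc: "incseq (\<lambda>i. \<integral>\<^sup>+ x. U i x \<partial>K)" for K
    using seq by (auto intro!: incseq_SucI nn_integral_mono simp: incseq_Suc_iff le_fun_def)
  have *: "(\<integral>\<^sup>+ x. (SUP i. U i) x \<partial>K) = (SUP i. \<integral>\<^sup>+ x. U i x \<partial>K)" if "\<And>i. U i \<in> borel_measurable K" for K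
    unfolding SUP_apply by (rule nn_integral_monotone_convergence_SUP) (use seq that in auto)
  have "(SUP i. \<integral>\<^sup>+ x. U i x \<partial>M') = (SUP i. (\<integral>\<^sup>+ x. U i x \<partial>N) + t * (\<integral>\<^sup>+ x. U i x \<partial>M))"
    using seq by simp
  also have "\<dots> = (SUP i. \<integral>\<^sup>+ x. U i x \<partial>N) + (SUP i. t * (\<integral>\<^sup>+ x. U i x \<partial>M))"
    by (rule ennreal_SUP_add) (use inc in \<open>auto simp: incseq_def intro!: mult_left_mono\<close>)
  finally show ?case using *[OF m(1)] *[OF m(2)] * seq(1) by (simp add: SUP_mult_left_ennreal)
qed

section \<open>Deterministic weighted shifts\<close>

text \<open>The index k stands for the k-th point of one orbit. The weights are normalized so that the growth
  rate of the iterated transfer operators is bounded below by 1.\<close>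

locale weighted_shift =
  fixes A :: "nat \<Rightarrow> nat \<Rightarrow> nat \<Rightarrow> bool" and \<phi> :: "nat \<Rightarrow> (nat \<Rightarrow> nat) \<Rightarrow> real"
    and D \<eta> :: "nat \<Rightarrow> real" and C w :: real and N :: nat and F :: "nat set"
    and p :: "nat \<Rightarrow> nat \<Rightarrow> nat"
  assumes phi_measurable [measurable]: "\<And>k. \<phi> k \<in> borel_measurable borel"
    and finite_range: "\<And>k e. \<exists>S. finite S \<and> (\<forall>j. A k e j \<longrightarrow> j \<in> S)"
    and distortion: "\<And>k r \<tau> \<omega>. \<lbrakk>\<tau> \<in> Einf Suc A k; \<omega> \<in> Einf Suc A k; \<forall>i\<le>r. \<tau> i = \<omega> i\<rbrakk>
        \<Longrightarrow> \<phi> k \<tau> \<le> \<phi> k \<omega> + D r"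
    and D_nonneg: "\<And>r. 0 \<le> D r" and D_summable: "summable D"
    and transfer_one_le: "\<And>k \<omega>. \<omega> \<in> Einf Suc A (Suc k) \<Longrightarrow> transfer A \<phi> k (\<lambda>_. 1) \<omega> \<le> ennreal C"
    and transfer_outside_le: "\<And>k \<omega>. \<omega> \<in> Einf Suc A (Suc k) \<Longrightarrow>
        transfer A \<phi> k (indicator {\<tau>. \<tau> 0 \<notin> F}) \<omega> \<le> ennreal (1/4)"
    and transfer_tail_le: "\<And>k l \<omega>. \<omega> \<in> Einf Suc A (Suc k) \<Longrightarrow>
        transfer A \<phi> k (indicator {\<tau>. l < \<tau> 0}) \<omega> \<le> ennreal (\<eta> l)"
    and eta_nonneg: "\<And>l. 0 \<le> \<eta> l" and eta_tendsto: "\<eta> \<longlonglongrightarrow> 0"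
    and access: "\<And>k m f \<omega>. \<lbrakk>N \<le> m; f \<in> F; \<omega> \<in> Einf Suc A (m + k); \<omega> 0 \<in> F\<rbrakk>
        \<Longrightarrow> ennreal w \<le> tpow Suc A \<phi> k m (indicator {\<tau>. \<tau> 0 = f}) \<omega>"
    and F_finite: "finite F"
    and base: "\<And>k. p k \<in> Einf Suc A k" "\<And>k. p k 0 \<in> F"
    and C_ge_1: "1 \<le> C" and w_pos: "0 < w"
begin

text \<open>The index set carries the successor map as its dynamics, so the definitions made for
  \<theta> apply verbatim to a single orbit.\<close>

abbreviation "E \<equiv> Einf Suc A"
abbreviation "L \<equiv> transfer A \<phi>"
abbreviation "Lpow \<equiv> tpow Suc A \<phi>"
abbreviation "inF \<equiv> {\<tau> :: nat \<Rightarrow> nat. \<tau> 0 \<in> F}"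

section \<open>Bounded distortion and a Harnack inequality\<close>

definition "dist_const = exp (\<Sum>i. D i)"
text \<open>This is the solution h of h = C * \<open>dist_const\<close> / w + h / 4, the recursion
  that appears in the proof of \<open>harnack\<close>.\<close>

definition "harnack_const = 4 / 3 * C * dist_const / w"

lemma dist_const_pos: "0 < dist_const" and harnack_const_pos: "0 < harnack_const"
  using C_ge_1 w_pos by (auto simp: dist_const_def harnack_const_def)

lemma Lpow_add: "Lpow k (m + n) u = Lpow (m + k) n (Lpow k m u)"
  by (simp add: tpow_add Suc_funpow)

lemma Lpow_Suc: "Lpow k (Suc m) u = L (m + k) (Lpow k m u)"
  by (simp add: Suc_funpow)

lemma Lpow_mono: "\<omega> \<in> E (m + k) \<Longrightarrow> (\<And>\<tau>. \<tau> \<in> E k \<Longrightarrow> g \<tau> \<le> h \<tau>) \<Longrightarrow> Lpow k m g \<omega> \<le> Lpow k m h \<omega>"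
  by (rule tpow_mono_Einf) (auto simp: Suc_funpow)

lemma Lpow_one_le: "\<omega> \<in> E (m + k) \<Longrightarrow> Lpow k m (\<lambda>_. 1) \<omega> \<le> ennreal (C ^ m)"
proof (induction m arbitrary: \<omega>)
  case (Suc m)
  have "Lpow k (Suc m) (\<lambda>_. 1) \<omega> \<le> L (m + k) (\<lambda>_. ennreal (C ^ m) * 1) \<omega>"
    unfolding Lpow_Suc using Suc by (intro transfer_mono_Einf[where \<theta>=Suc]) auto
  also have "\<dots> = ennreal (C ^ m) * L (m + k) (\<lambda>_. 1) \<omega>" by (rule transfer_cmult)
  also have "\<dots> \<le> ennreal (C ^ m) * ennreal C"
    using Suc.prems by (intro mult_left_mono transfer_one_le) auto
  also have "\<dots> = ennreal (C ^ Suc m)"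
    using C_ge_1 by (simp add: ennreal_mult[symmetric] mult.commute)
  finally show ?case .
qed simp

lemma Lpow_cyl_le: "\<omega> \<in> E (m + k) \<Longrightarrow> Lpow k m (indicator (cyl v)) \<omega> \<le> ennreal (C ^ m)"
  by (rule order_trans[OF Lpow_mono Lpow_one_le]) (auto simp: indicator_def)

lemma L_distortion:
  assumes "\<tau> \<in> E (Suc k)" "\<omega> \<in> E (Suc k)" "\<forall>i\<le>r. \<tau> i = \<omega> i" "A k e (\<tau> 0)"
  shows "exp (\<phi> k (case_nat e \<tau>)) \<le> exp (D (Suc r)) * exp (\<phi> k (case_nat e \<omega>))"
proof -
  have "A k e (\<omega> 0)" using assms by auto
  then have "\<phi> k (case_nat e \<tau>) \<le> \<phi> k (case_nat e \<omega>) + D (Suc r)"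
    using assms by (intro distortion case_nat_in_Einf) (auto split: nat.splits)
  then show ?thesis by (simp add: exp_add[symmetric] add.commute)
qed

text \<open>Each operator prepends the same letter to both points, so their agreement grows from r +
  1 to r + 1 + m letters and the m steps cost D (r + 1), ..., D (r + m). The condition on
  \<open>length v\<close> says that the final agreement covers all letters read by the
  cylinder.\<close>

lemma Lpow_cyl_distortion:
  assumes "length v \<le> Suc r + m" "\<tau> \<in> E (m + k)" "\<omega> \<in> E (m + k)" "\<forall>i\<le>r. \<tau> i = \<omega> i"
  shows "Lpow k m (indicator (cyl v)) \<tau> \<le> ennreal (exp (\<Sum>i=Suc r..<Suc (r + m). D i)) * Lpow k m (indicator (cyl v)) \<omega>"
  using assms
proof (induction m arbitrary: r \<tau> \<omega>)
  case 0
  then have "\<tau> \<in> cyl v \<longleftrightarrow> \<omega> \<in> cyl v" by (auto simp: cyl_def)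
  then show ?case by (auto simp: indicator_def)
next
  case (Suc m)
  let ?u = "Lpow k m (indicator (cyl v))"
  let ?s = "exp (\<Sum>i=Suc (Suc r)..<Suc (Suc r + m). D i)"
  have split: "(\<Sum>i=Suc r..<Suc (r + Suc m). D i) = D (Suc r) + (\<Sum>i=Suc (Suc r)..<Suc (Suc r + m). D i)"
    by (subst sum.atLeast_Suc_lessThan) auto
  have *: "(if A (m + k) e (\<tau> 0) then ?u (case_nat e \<tau>) * ennreal (exp (\<phi> (m + k) (case_nat e \<tau>))) else 0)
     \<le> ennreal (exp (\<Sum>i=Suc r..<Suc (r + Suc m). D i)) *
        (if A (m + k) e (\<omega> 0) then ?u (case_nat e \<omega>) * ennreal (exp (\<phi> (m + k) (case_nat e \<omega>))) else 0)" for e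
  proof (cases "A (m + k) e (\<tau> 0)")
    case True
    have E': "\<tau> \<in> E (Suc (m + k))" "\<omega> \<in> E (Suc (m + k))" using Suc.prems by auto
    have A': "A (m + k) e (\<omega> 0)" using True Suc.prems by auto
    have "?u (case_nat e \<tau>) \<le> ennreal ?s * ?u (case_nat e \<omega>)"
      using Suc.prems True A' E' by (intro Suc.IH case_nat_in_Einf) (auto split: nat.splits)
    moreover have "ennreal (exp (\<phi> (m + k) (case_nat e \<tau>)))
        \<le> ennreal (exp (D (Suc r))) * ennreal (exp (\<phi> (m + k) (case_nat e \<omega>)))"
      unfolding ennreal_mult[OF exp_ge_zero exp_ge_zero, symmetric]
      by (rule ennreal_leI[OF L_distortion]) (use E' True Suc.prems in auto)
    ultimately have "?u (case_nat e \<tau>) * ennreal (exp (\<phi> (m + k) (case_nat e \<tau>)))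
       \<le> (ennreal ?s * ?u (case_nat e \<omega>)) * (ennreal (exp (D (Suc r))) * ennreal (exp (\<phi> (m + k) (case_nat e \<omega>))))"
      by (rule mult_mono) auto
    also have "\<dots> = (ennreal (exp (D (Suc r))) * ennreal ?s) * (?u (case_nat e \<omega>) * ennreal (exp (\<phi> (m + k) (case_nat e \<omega>))))"
      by (simp add: ac_simps)
    also have "ennreal (exp (D (Suc r))) * ennreal ?s = ennreal (exp (\<Sum>i=Suc r..<Suc (r + Suc m). D i))"
      unfolding split exp_add by (simp add: ennreal_mult)
    finally show ?thesis using True A' by simp
  qed auto
  show ?case
    unfolding Lpow_Suc transfer_eq_nn_integral
    by (subst nn_integral_cmult[symmetric], simp, rule nn_integral_mono, rule *)
qed

text \<open>As soon as m \<ge> length v, agreement in one letter suffices, and the distortion is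
  bounded by the whole series independently of m.\<close>

lemma Lpow_cyl_regular:
  assumes "length v \<le> m" "\<tau> \<in> E (m + k)" "\<omega> \<in> E (m + k)" "\<tau> 0 = \<omega> 0"
  shows "Lpow k m (indicator (cyl v)) \<tau> \<le> ennreal dist_const * Lpow k m (indicator (cyl v)) \<omega>"
proof -
  have "(\<Sum>i=Suc 0..<Suc (0 + m). D i) \<le> (\<Sum>i. D i)"
    using D_summable D_nonneg by (intro sum_le_suminf) auto
  then have "ennreal (exp (\<Sum>i=Suc 0..<Suc (0 + m). D i)) \<le> ennreal dist_const" by (simp add: dist_const_def)
  then show ?thesis
    using assms by (intro order_trans[OF Lpow_cyl_distortion[of v 0] mult_right_mono]) auto
qed

text \<open>The two end points are unrelated, and \<open>\<omega>\<close> need not start in F. If it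
  does, \<open>access\<close> and bounded distortion give the comparison; what stays outside F loses
  a factor 1/4 per step and leaves the geometric error term.\<close>

lemma harnack:
  assumes "length v \<le> m" and \<omega>: "\<omega> \<in> E (m + k)" and \<omega>': "\<omega>' \<in> E (m + N + k)" "\<omega>' 0 \<in> F"
  shows "Lpow k m (indicator (cyl v)) \<omega> \<le>
    ennreal ((1/4) ^ (m - length v) * C ^ length v) + ennreal harnack_const * Lpow k (m + N) (indicator (cyl v)) \<omega>'"
proof -
  define q where "q = length v"
  define u where "u i = Lpow k i (indicator (cyl v))" for i
  define y where "y = u (m + N) \<omega>'"
  \<comment> \<open>Start in F: the m + N - i \<ge> N remaining steps join \<open>\<omega>'\<close>
    to the first letter of \<open>\<omega>\<close> with weight at least w, and all points with this
    first letter have comparable values up to \<open>dist_const\<close>.\<close>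
  have a: "u i \<omega> \<le> ennreal (dist_const / w) * y" if "q \<le> i" "i \<le> m" "\<omega> \<in> E (i + k)" "\<omega> 0 \<in> F" for i \<omega>
  proof -
    have "ennreal w * u i \<omega> \<le> u i \<omega> * Lpow (i + k) (m + N - i) (indicator {\<tau>. \<tau> 0 = \<omega> 0}) \<omega>'"
      unfolding mult.commute[of "ennreal w"] using \<omega>' that by (intro mult_left_mono access) (auto simp: add.assoc)
    also have "\<dots> = Lpow (i + k) (m + N - i) (\<lambda>\<tau>. u i \<omega> * indicator {\<tau>. \<tau> 0 = \<omega> 0} \<tau>) \<omega>'"
      by (simp add: tpow_cmult)
    also have "\<dots> \<le> Lpow (i + k) (m + N - i) (\<lambda>\<tau>. ennreal dist_const * u i \<tau>) \<omega>'"
    proof (rule Lpow_mono)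
      show "\<omega>' \<in> E (m + N - i + (i + k))" using \<omega>' that by (simp add: algebra_simps)
      fix \<tau> assume "\<tau> \<in> E (i + k)"
      then show "u i \<omega> * indicator {\<tau>. \<tau> 0 = \<omega> 0} \<tau> \<le> ennreal dist_const * u i \<tau>"
        using that by (auto simp: indicator_def u_def q_def intro: Lpow_cyl_regular)
    qed
    also have "\<dots> = ennreal dist_const * y"
      using Lpow_add[of k i "m + N - i" "indicator (cyl v)"] that by (simp add: tpow_cmult y_def u_def)
    finally have "ennreal (1 / w) * (ennreal w * u i \<omega>) \<le> ennreal (1 / w) * (ennreal dist_const * y)"
      by (rule mult_left_mono) auto
    then show ?thesis
      using w_pos dist_const_pos by (simp add: mult.assoc[symmetric] ennreal_mult[symmetric])
  qed
  \<comment> \<open>Arbitrary start: at i = length v only the crude bound C ^ length v is available.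
    Each further operator splits its argument by the first letter and uses the previous estimate in
    F, the induction hypothesis outside.\<close>
  have b: "u i \<omega> \<le> ennreal ((1/4) ^ (i - q) * C ^ q) + ennreal harnack_const * y" if "q \<le> i" "i \<le> m" "\<omega> \<in> E (i + k)" for i \<omega>
    using that
  proof (induction i arbitrary: \<omega> rule: dec_induct)
    case base
    then show ?case using Lpow_cyl_le[of \<omega> q k v] by (simp add: u_def add_increasing2)
  next
    case (step i)
    let ?X = "(1/4) ^ (i - q) * C ^ q"
    have X: "0 \<le> ?X" using C_ge_1 by simp
    have "u (Suc i) \<omega> = L (i + k) (u i) \<omega>" unfolding u_def Lpow_Suc ..
    also have "\<dots> \<le> L (i + k) (\<lambda>\<tau>. (ennreal (dist_const / w) * y) * 1 + (ennreal ?X + ennreal harnack_const * y) * indicator {\<tau>. \<tau> 0 \<notin> F} \<tau>) \<omega>"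
    proof (rule transfer_mono_Einf[where \<theta>=Suc])
      show "\<omega> \<in> E (Suc (i + k))" using step by simp
      fix \<tau> assume "\<tau> \<in> E (i + k)"
      then show "u i \<tau> \<le> (ennreal (dist_const / w) * y) * 1 + (ennreal ?X + ennreal harnack_const * y) * indicator {\<tau>. \<tau> 0 \<notin> F} \<tau>"
        using a[of i \<tau>] step by (cases "\<tau> 0 \<in> F") (auto intro: add_increasing)
    qed
    also have "\<dots> = (ennreal (dist_const / w) * y) * L (i + k) (\<lambda>_. 1) \<omega>
        + (ennreal ?X + ennreal harnack_const * y) * L (i + k) (indicator {\<tau>. \<tau> 0 \<notin> F}) \<omega>"
      by (simp only: transfer_add transfer_cmult)
    also have "\<dots> \<le> (ennreal (dist_const / w) * y) * ennreal C + (ennreal ?X + ennreal harnack_const * y) * ennreal (1/4)"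
      using step.prems by (intro add_mono mult_left_mono transfer_one_le transfer_outside_le) auto
    also have "\<dots> = ennreal (1/4 * ?X) + (ennreal (dist_const / w * C) + ennreal (harnack_const / 4)) * y"
    proof -
      have "ennreal (1/4 * ?X) = ennreal ?X * ennreal (1/4)"
        by (simp only: mult.commute[of "1/4"] ennreal_mult[OF X])
      moreover have "ennreal (dist_const / w * C) = ennreal (dist_const / w) * ennreal C"
        using dist_const_pos w_pos C_ge_1 by (intro ennreal_mult) auto
      moreover have "ennreal (harnack_const / 4) = ennreal harnack_const * ennreal (1/4)"
        using harnack_const_pos by (subst ennreal_mult[symmetric]) auto
      ultimately show ?thesis by (simp add: algebra_simps)
    qed
    also have "ennreal (dist_const / w * C) + ennreal (harnack_const / 4) = ennreal harnack_const"
      using dist_const_pos w_pos C_ge_1 harnack_const_pos by (subst ennreal_plus[symmetric]) (auto simp: harnack_const_def field_simps)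
    also have "1/4 * ?X = (1/4) ^ (Suc i - q) * C ^ q"
      using step by (simp add: Suc_diff_le)
    finally show ?case .
  qed
  show ?thesis using b[of m \<omega>] assms by (simp add: q_def u_def y_def)
qed

end

section \<open>Uniqueness of normalized solutions\<close>

context weighted_shift begin

definition solution :: "(nat \<Rightarrow> (nat \<Rightarrow> nat) measure) \<Rightarrow> bool" where
  "solution \<mu> \<longleftrightarrow> (\<forall>k. sets (\<mu> k) = sets borel \<and> finite_measure (\<mu> k) \<and> (AE \<omega> in \<mu> k. \<omega> \<in> E k) \<and>
     (\<forall>B\<in>sets borel. emeasure (\<mu> k) B = (\<integral>\<^sup>+ \<omega>. L k (indicator B) \<omega> \<partial>\<mu> (Suc k))))"

lemma solutionD:
  assumes "solution \<mu>"
  shows "sets (\<mu> k) = sets borel" "finite_measure (\<mu> k)" "AE \<omega> in \<mu> k. \<omega> \<in> E k"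
    "B \<in> sets borel \<Longrightarrow> emeasure (\<mu> k) B = (\<integral>\<^sup>+ \<omega>. L k (indicator B) \<omega> \<partial>\<mu> (Suc k))"
    "space (\<mu> k) = UNIV"
  using assms sets_eq_imp_space_eq[of "\<mu> k" borel] by (auto simp: solution_def)

lemma solution_measurable: "solution \<mu> \<Longrightarrow> u \<in> borel_measurable borel \<Longrightarrow> u \<in> borel_measurable (\<mu> k)"
  using solutionD(1) by (simp cong: measurable_cong_sets)

lemma L_measurable: "u \<in> borel_measurable borel \<Longrightarrow> L k u \<in> borel_measurable borel"
  by (rule transfer_measurable) auto

lemma solution_nn_integral:
  assumes s: "solution \<mu>" and u: "u \<in> borel_measurable borel"
  shows "(\<integral>\<^sup>+ \<omega>. u \<omega> \<partial>\<mu> k) = (\<integral>\<^sup>+ \<omega>. L k u \<omega> \<partial>\<mu> (Suc k))"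
  using u
proof (induction rule: borel_measurable_induct)
  case (cong f g)
  then have "f = g" by auto
  with cong show ?case by simp
next
  case (set B)
  then show ?case using solutionD[OF s] by simp
next
  case (mult u c)
  have "u \<in> borel_measurable (\<mu> k)" "L k u \<in> borel_measurable (\<mu> (Suc k))"
    by (intro solution_measurable[OF s] L_measurable mult(2))+
  then show ?case using mult by (simp add: transfer_cmult nn_integral_cmult)
next
  case (add u v)
  have "u \<in> borel_measurable (\<mu> k)" "L k u \<in> borel_measurable (\<mu> (Suc k))"
    "v \<in> borel_measurable (\<mu> k)" "L k v \<in> borel_measurable (\<mu> (Suc k))"
    by (intro solution_measurable[OF s] L_measurable add(1) add(3))+
  then show ?case using add by (simp add: transfer_add nn_integral_add)
next
  case (seq U)
  have inc: "incseq (\<lambda>i. L k (U i))"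
    using seq(3) by (auto simp: incseq_def le_fun_def intro!: transfer_mono)
  have "(\<integral>\<^sup>+ \<omega>. (SUP i. U i) \<omega> \<partial>\<mu> k) = (SUP i. \<integral>\<^sup>+ \<omega>. U i \<omega> \<partial>\<mu> k)"
    unfolding SUP_apply by (rule nn_integral_monotone_convergence_SUP) (use seq in \<open>auto intro!: solution_measurable[OF s]\<close>)
  also have "\<dots> = (SUP i. \<integral>\<^sup>+ \<omega>. L k (U i) \<omega> \<partial>\<mu> (Suc k))" using seq by simp
  also have "\<dots> = (\<integral>\<^sup>+ \<omega>. (SUP i. L k (U i) \<omega>) \<partial>\<mu> (Suc k))"
    by (rule nn_integral_monotone_convergence_SUP[symmetric])
      (use inc in \<open>auto intro!: solution_measurable[OF s] transfer_measurable seq(1)\<close>)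
  also have "\<dots> = (\<integral>\<^sup>+ \<omega>. L k (SUP i. U i) \<omega> \<partial>\<mu> (Suc k))"
    using transfer_SUP[OF seq(3), of A \<phi> k] by (simp add: SUP_apply[abs_def])
  finally show ?case .
qed

lemma solution_nn_integral_pow:
  assumes s: "solution \<mu>" and u: "u \<in> borel_measurable borel"
  shows "(\<integral>\<^sup>+ \<omega>. u \<omega> \<partial>\<mu> k) = (\<integral>\<^sup>+ \<omega>. Lpow k m u \<omega> \<partial>\<mu> (m + k))"
proof (induction m)
  case (Suc m)
  then show ?case
    unfolding Lpow_Suc using solution_nn_integral[OF s tpow_measurable[OF u phi_measurable], of "m + k"] by simp
qed simp

lemma solution_emeasure_pow:
  assumes s: "solution \<mu>" and [measurable]: "B \<in> sets borel"
  shows "emeasure (\<mu> k) B = (\<integral>\<^sup>+ \<omega>. Lpow k m (indicator B) \<omega> \<partial>\<mu> (m + k))"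
  using solution_nn_integral_pow[OF s, of "indicator B" k m] solutionD(1)[OF s] by simp

text \<open>Pointwise estimates of the iterated operator on admissible points integrate to estimates
  of masses, since \<mu> k is the m-fold dual image of \<mu> (m + k).\<close>

lemma solution_le:
  assumes s: "solution \<mu>" and B: "B \<in> sets borel" "B' \<in> sets borel" "0 \<le> c"
    and le: "\<And>\<omega>. \<omega> \<in> E (m + k) \<Longrightarrow> Lpow k m (indicator B) \<omega> \<le> ennreal c * indicator B' \<omega>"
  shows "measure (\<mu> k) B \<le> c * measure (\<mu> (m + k)) B'"
proof -
  interpret a: finite_measure "\<mu> k" by (rule solutionD[OF s])
  interpret b: finite_measure "\<mu> (m + k)" by (rule solutionD[OF s])
  have "emeasure (\<mu> k) B \<le> (\<integral>\<^sup>+ \<omega>. ennreal c * indicator B' \<omega> \<partial>\<mu> (m + k))"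
    unfolding solution_emeasure_pow[OF s B(1), of k m]
    using solutionD(3)[OF s, of "m + k"] by (intro nn_integral_mono_AE) (auto elim!: eventually_mono intro: le)
  also have "\<dots> = ennreal c * emeasure (\<mu> (m + k)) B'"
    using B solutionD(1)[OF s] by (simp add: nn_integral_cmult_indicator)
  finally show ?thesis
    using B(3) by (simp add: a.emeasure_eq_measure b.emeasure_eq_measure ennreal_mult[symmetric])
qed

lemma solution_ge:
  assumes s: "solution \<mu>" and B: "B \<in> sets borel" "B' \<in> sets borel" "0 \<le> c"
    and le: "\<And>\<omega>. \<omega> \<in> E (m + k) \<Longrightarrow> ennreal c * indicator B' \<omega> \<le> Lpow k m (indicator B) \<omega>"
  shows "c * measure (\<mu> (m + k)) B' \<le> measure (\<mu> k) B"
proof -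
  interpret a: finite_measure "\<mu> k" by (rule solutionD[OF s])
  interpret b: finite_measure "\<mu> (m + k)" by (rule solutionD[OF s])
  have "ennreal c * emeasure (\<mu> (m + k)) B' = (\<integral>\<^sup>+ \<omega>. ennreal c * indicator B' \<omega> \<partial>\<mu> (m + k))"
    using B solutionD(1)[OF s] by (simp add: nn_integral_cmult_indicator)
  also have "\<dots> \<le> emeasure (\<mu> k) B"
    unfolding solution_emeasure_pow[OF s B(1), of k m]
    using solutionD(3)[OF s, of "m + k"] by (intro nn_integral_mono_AE) (auto elim!: eventually_mono intro: le)
  finally show ?thesis
    using B(3) by (simp add: a.emeasure_eq_measure b.emeasure_eq_measure ennreal_mult[symmetric])
qed

lemma first_letter_sets [measurable]: "{\<tau> :: nat \<Rightarrow> nat. \<tau> 0 \<in> S} \<in> sets borel"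
  using measurable_sets[OF measurable_coord[of 0], of S] by (simp add: vimage_def)

lemma solution_mass_le_pow: "solution \<mu> \<Longrightarrow> measure (\<mu> k) UNIV \<le> C ^ m * measure (\<mu> (m + k)) UNIV"
  using C_ge_1 by (intro solution_le) (auto intro!: order_trans[OF _ Lpow_one_le] simp: indicator_def)

text \<open>Any letter of F may serve as the target of \<open>access\<close>; \<open>p 0 0\<close>
  is one that is at hand.\<close>

lemma solution_inF_ge:
  assumes s: "solution \<mu>" and m: "N \<le> m"
  shows "w * measure (\<mu> (m + k)) inF \<le> measure (\<mu> k) inF"
proof -
  have "w * measure (\<mu> (m + k)) inF \<le> measure (\<mu> k) {\<tau>. \<tau> 0 \<in> {p 0 0}}"
  proof (rule solution_ge[OF s])
    fix \<omega> assume "\<omega> \<in> E (m + k)"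
    then show "ennreal w * indicator inF \<omega> \<le> Lpow k m (indicator {\<tau>. \<tau> 0 \<in> {p 0 0}}) \<omega>"
      using access[OF m base(2)[of 0], of \<omega> k] by (cases "\<omega> 0 \<in> F") auto
  qed (use w_pos in auto)
  also have "\<dots> \<le> measure (\<mu> k) inF"
    using base(2)[of 0] solutionD(1)[OF s]
    by (intro finite_measure.finite_measure_mono solutionD(2)[OF s]) auto
  finally show ?thesis .
qed

lemma solution_mass_le:
  assumes s: "solution \<mu>"
  shows "measure (\<mu> k) UNIV \<le> measure (\<mu> k) inF + 1 / 4 * measure (\<mu> (Suc k)) UNIV"
proof -
  interpret a: finite_measure "\<mu> k" by (rule solutionD[OF s])
  have "measure (\<mu> k) UNIV = measure (\<mu> k) inF + measure (\<mu> k) {\<tau>. \<tau> 0 \<in> - F}"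
    by (subst a.finite_measure_Union[symmetric]) (auto simp: solutionD[OF s] intro!: arg_cong[where f="measure (\<mu> k)"])
  moreover have "measure (\<mu> k) {\<tau>. \<tau> 0 \<in> - F} \<le> 1 / 4 * measure (\<mu> (1 + k)) UNIV"
    using transfer_outside_le[of _ k] by (intro solution_le[OF s]) auto
  ultimately show ?thesis by simp
qed

text \<open>Integrating \<open>harnack\<close> in \<open>\<omega>\<close> against \<mu> (m + k) and
  in \<open>\<omega>'\<close> over F against \<nu> (m + N + k) compares two solutions that have
  nothing else in common. In the applications one divides by the mass that \<nu> gives to F, which
  must therefore be controlled from below.\<close>

lemma harnack_integrated:
  assumes s: "solution \<mu>" and t: "solution \<nu>" and v: "length v \<le> m"
  shows "measure (\<mu> k) (cyl v) * measure (\<nu> (m + N + k)) inF \<le>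
    measure (\<mu> (m + k)) UNIV * ((1/4) ^ (m - length v) * C ^ length v * measure (\<nu> (m + N + k)) inF
      + harnack_const * measure (\<nu> k) (cyl v))"
proof -
  interpret a: finite_measure "\<mu> k" by (rule solutionD[OF s])
  interpret a': finite_measure "\<mu> (m + k)" by (rule solutionD[OF s])
  interpret b: finite_measure "\<nu> (m + N + k)" by (rule solutionD[OF t])
  interpret b': finite_measure "\<nu> k" by (rule solutionD[OF t])
  let ?X = "(1/4) ^ (m - length v) * C ^ length v"
  let ?Z = "emeasure (\<mu> (m + k)) UNIV"
  let ?y = "Lpow k (m + N) (indicator (cyl v))"
  have X: "0 \<le> ?X" using C_ge_1 by simp
  have ym: "?y \<in> borel_measurable borel" by (intro tpow_measurable) auto
  have le: "emeasure (\<mu> k) (cyl v) \<le> (ennreal ?X + ennreal harnack_const * ?y \<omega>') * ?Z"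
    if "\<omega>' \<in> E (m + N + k)" "\<omega>' 0 \<in> F" for \<omega>'
  proof -
    have "emeasure (\<mu> k) (cyl v) \<le> (\<integral>\<^sup>+ \<omega>. ennreal ?X + ennreal harnack_const * ?y \<omega>' \<partial>\<mu> (m + k))"
      unfolding solution_emeasure_pow[OF s cyl_sets, of k v m]
      using solutionD(3)[OF s, of "m + k"]
      by (intro nn_integral_mono_AE) (auto elim!: eventually_mono intro: harnack v that)
    then show ?thesis by (simp add: solutionD(5)[OF s])
  qed
  have "emeasure (\<mu> k) (cyl v) * emeasure (\<nu> (m + N + k)) inF
      = (\<integral>\<^sup>+ \<omega>'. emeasure (\<mu> k) (cyl v) * indicator inF \<omega>' \<partial>\<nu> (m + N + k))"
    by (subst nn_integral_cmult_indicator) (auto simp: solutionD[OF t])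
  also have "\<dots> \<le> (\<integral>\<^sup>+ \<omega>'. ?Z * (ennreal ?X * indicator inF \<omega>' + ennreal harnack_const * ?y \<omega>') \<partial>\<nu> (m + N + k))"
    using solutionD(3)[OF t, of "m + N + k"]
  proof (intro nn_integral_mono_AE, elim eventually_mono)
    fix \<omega>' assume "\<omega>' \<in> E (m + N + k)"
    then show "emeasure (\<mu> k) (cyl v) * indicator inF \<omega>' \<le> ?Z * (ennreal ?X * indicator inF \<omega>' + ennreal harnack_const * ?y \<omega>')"
      using le[of \<omega>'] by (cases "\<omega>' 0 \<in> F") (auto simp: mult.commute)
  qed
  also have "\<dots> = ?Z * (ennreal ?X * emeasure (\<nu> (m + N + k)) inF + ennreal harnack_const * (\<integral>\<^sup>+ \<omega>'. ?y \<omega>' \<partial>\<nu> (m + N + k)))"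
  proof -
    note m = solution_measurable[OF t ym, of "m + N + k"]
    have i: "(\<lambda>\<omega>. ennreal ?X * indicator inF \<omega> :: ennreal) \<in> borel_measurable (\<nu> (m + N + k))"
      by (rule solution_measurable[OF t]) measurable
    show ?thesis
      using m i by (simp add: nn_integral_cmult nn_integral_add nn_integral_cmult_indicator solutionD(1)[OF t])
  qed
  also have "(\<integral>\<^sup>+ \<omega>'. ?y \<omega>' \<partial>\<nu> (m + N + k)) = emeasure (\<nu> k) (cyl v)"
    using solution_emeasure_pow[OF t cyl_sets, of k v "m + N"] by simp
  finally show ?thesis
    using X harnack_const_pos
    by (simp add: a.emeasure_eq_measure a'.emeasure_eq_measure b.emeasure_eq_measure b'.emeasure_eq_measure
        ennreal_mult'[symmetric] ennreal_plus[symmetric] del: ennreal_plus)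
qed

section \<open>Normalized solutions and their comparison\<close>

definition "F_frac = 3 * w / (4 * C ^ N)"
text \<open>\<open>F_frac\<close> is the share of F that the approximations retain
  (\<open>approx_dl_le\<close>). With it the mass at index N + k is at most 1 / (w *
  \<open>F_frac\<close>), and going N steps back costs C ^ N.\<close>

definition "mass_bound = C ^ N / (w * F_frac)"

lemma F_frac_pos: "0 < F_frac" and mass_bound_pos: "0 < mass_bound"
  using C_ge_1 w_pos by (auto simp: F_frac_def mass_bound_def)

definition normalized :: "(nat \<Rightarrow> (nat \<Rightarrow> nat) measure) \<Rightarrow> bool" where
  "normalized \<mu> \<longleftrightarrow> solution \<mu> \<and> measure (\<mu> 0) UNIV = 1 \<and> (\<forall>k. F_frac * measure (\<mu> k) UNIV \<le> measure (\<mu> k) inF)"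

lemma normalized_mass_le:
  assumes g: "normalized \<mu>"
  shows "measure (\<mu> k) UNIV \<le> mass_bound"
proof -
  have s: "solution \<mu>" and one: "measure (\<mu> 0) UNIV = 1"
    and d: "\<And>k. F_frac * measure (\<mu> k) UNIV \<le> measure (\<mu> k) inF" using g by (auto simp: normalized_def)
  interpret a: finite_measure "\<mu> 0" by (rule solutionD[OF s])
  have "w * (F_frac * measure (\<mu> (N + k)) UNIV) \<le> w * measure (\<mu> (N + k)) inF"
    using d w_pos by simp
  also have "\<dots> \<le> measure (\<mu> 0) inF" using solution_inF_ge[OF s, of "N + k" 0] by simp
  also have "\<dots> \<le> 1" using a.bounded_measure[of inF] one by (simp add: solutionD(5)[OF s])
  finally have "measure (\<mu> (N + k)) UNIV \<le> 1 / (w * F_frac)"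
    using w_pos F_frac_pos by (simp add: field_simps)
  then have "C ^ N * measure (\<mu> (N + k)) UNIV \<le> C ^ N * (1 / (w * F_frac))"
    using C_ge_1 by (intro mult_left_mono) auto
  with solution_mass_le_pow[OF s, of k N] show ?thesis by (simp add: mass_bound_def)
qed

text \<open>If F held less than half of the mass from some index on, \<open>solution_mass_le\<close>
  would give z n \<le> z n / 2 + z (n + 1) / 4, so the masses would at least double in each step,
  against the bound K.\<close>

lemma recurrent:
  assumes s: "solution \<nu>" and b: "\<And>k. measure (\<nu> k) UNIV \<le> K" and pos: "0 < measure (\<nu> k0) UNIV"
  shows "\<exists>n\<ge>n0. 0 < measure (\<nu> n) UNIV \<and> measure (\<nu> n) UNIV / 2 \<le> measure (\<nu> n) inF"
proof (rule ccontr)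
  assume c: "\<not> ?thesis"
  define z where "z n = measure (\<nu> n) UNIV" for n
  have zpos: "0 < z (j + k0)" for j
  proof -
    have "0 < C ^ j * z (j + k0)" using pos solution_mass_le_pow[OF s, of k0 j] by (simp add: z_def)
    then show ?thesis using C_ge_1 by (simp add: zero_less_mult_iff)
  qed
  have step: "2 * z n \<le> z (Suc n)" if "k0 \<le> n" "n0 \<le> n" for n
  proof -
    have "0 < z n" using zpos[of "n - k0"] that by simp
    then have "measure (\<nu> n) inF < z n / 2" using c that by (auto simp: z_def not_le)
    then show ?thesis using solution_mass_le[OF s, of n] by (simp add: z_def)
  qed
  have pw: "2 ^ j * z (n0 + k0) \<le> z (j + (n0 + k0))" for j
  proof (induction j)
    case (Suc j)
    then show ?case using step[of "j + (n0 + k0)"] by simp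
  qed simp
  obtain j where "K / z (n0 + k0) < 2 ^ j" using real_arch_pow[of 2] by auto
  then have "K < 2 ^ j * z (n0 + k0)" using zpos[of n0] by (simp add: field_simps)
  also have "\<dots> \<le> K" using pw[of j] b[of "j + (n0 + k0)"] by (simp add: z_def)
  finally show False by simp
qed


text \<open>The differences of the cylinder weights are nonnegative, so
  \<open>cylinder_extension\<close> turns them into measures. The identity spreads from cylinders to
  Borel sets by a Dynkin argument, and duality follows by cancelling the finite term t * \<mu> k
  B.\<close>

lemma solution_diff:
  assumes s: "solution \<mu>" and s': "solution \<mu>'" and t: "0 \<le> t"
    and le: "\<And>k v. t * measure (\<mu> k) (cyl v) \<le> measure (\<mu>' k) (cyl v)"
  obtains \<nu> where "solution \<nu>"
    "\<And>k B. B \<in> sets borel \<Longrightarrow> measure (\<mu>' k) B = measure (\<nu> k) B + t * measure (\<mu> k) B"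
proof -
  have sums: "(\<lambda>e. measure (\<rho> k) (cyl (v @ [e]))) sums measure (\<rho> k) (cyl v)" if "solution \<rho>" for \<rho> k v
  proof -
    interpret finite_measure "\<rho> k" by (rule solutionD[OF that])
    have "cyl v = (\<Union>e. cyl (v @ [e]))" by (auto simp: cyl_snoc)
    moreover have "(\<lambda>e. measure (\<rho> k) (cyl (v @ [e]))) sums measure (\<rho> k) (\<Union>e. cyl (v @ [e]))"
      by (rule finite_measure_UNION) (auto simp: solutionD(1)[OF that] disjoint_family_on_def cyl_snoc)
    ultimately show ?thesis by simp
  qed
  have "\<exists>\<nu>. sets \<nu> = sets borel \<and>
      (\<forall>v. emeasure \<nu> (cyl v) = ennreal (measure (\<mu>' k) (cyl v) - t * measure (\<mu> k) (cyl v)))" for k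
    by (rule cylinder_extension[of "\<lambda>v. measure (\<mu>' k) (cyl v) - t * measure (\<mu> k) (cyl v)"])
      (use le in \<open>auto intro!: sums_diff sums_mult sums[OF s] sums[OF s']\<close>)
  then obtain \<nu> where \<nu>: "\<And>k. sets (\<nu> k) = sets borel"
    "\<And>k v. emeasure (\<nu> k) (cyl v) = ennreal (measure (\<mu>' k) (cyl v) - t * measure (\<mu> k) (cyl v))"
    by metis
  have sp: "space (\<nu> k) = UNIV" for k using sets_eq_imp_space_eq[OF \<nu>(1)] by simp
  have fin: "finite_measure (\<nu> k)" for k
    using \<nu>(2)[of k "[]"] by (intro finite_measureI) (auto simp: sp)
  have eq: "measure (\<mu>' k) B = measure (\<nu> k) B + t * measure (\<mu> k) B" if "B \<in> sets borel" for k B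
  proof -
    interpret a: finite_measure "\<mu> k" by (rule solutionD[OF s])
    interpret b: finite_measure "\<mu>' k" by (rule solutionD[OF s'])
    interpret c: finite_measure "\<nu> k" by (rule fin)
    have S: "sets (\<mu> k) = sets borel" "sets (\<mu>' k) = sets borel" "sets (\<nu> k) = sets borel"
      "space (\<mu> k) = UNIV" "space (\<mu>' k) = UNIV" "space (\<nu> k) = UNIV"
      using solutionD[OF s] solutionD[OF s'] \<nu> sp by auto
    have cyl: "measure (\<mu>' k) (cyl v) = measure (\<nu> k) (cyl v) + t * measure (\<mu> k) (cyl v)" for v
      using \<nu>(2)[of k v] le[of k v] by (simp add: measure_def[of "\<nu> k"])
    have B: "B \<in> sigma_sets UNIV (insert {} (range cyl))" using that by (simp add: sigma_cyl_insert)
    have P: "insert {} (range cyl) \<subseteq> Pow UNIV" by simp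
    show ?thesis using Int_stable_cyl P B
    proof (induction rule: sigma_sets_induct_disjoint)
      case (basic X)
      then show ?case using cyl by auto
    next
      case (compl X)
      then have "X \<in> sets borel" by (simp add: sigma_cyl_insert)
      then show ?case
        using a.finite_measure_compl[of X] b.finite_measure_compl[of X] c.finite_measure_compl[of X] compl cyl[of "[]"]
        by (simp add: S right_diff_distrib)
    next
      case (union X)
      then have X: "range X \<subseteq> sets borel" by (simp add: sigma_cyl_insert)
      have "(\<lambda>i. measure (\<mu>' k) (X i)) sums measure (\<mu>' k) (\<Union>i. X i)"
        by (rule b.finite_measure_UNION) (use X union in \<open>auto simp: S\<close>)
      moreover have "(\<lambda>i. measure (\<nu> k) (X i) + t * measure (\<mu> k) (X i)) sums
          (measure (\<nu> k) (\<Union>i. X i) + t * measure (\<mu> k) (\<Union>i. X i))"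
        by (intro sums_add sums_mult a.finite_measure_UNION c.finite_measure_UNION) (use X union in \<open>auto simp: S\<close>)
      ultimately show ?case using union by (simp add: sums_iff)
    qed simp
  qed
  have eeq: "emeasure (\<mu>' k) B = emeasure (\<nu> k) B + ennreal t * emeasure (\<mu> k) B" if "B \<in> sets borel" for k B
    using eq[OF that, of k] t
    by (simp add: finite_measure.emeasure_eq_measure[OF solutionD(2)[OF s]] finite_measure.emeasure_eq_measure[OF solutionD(2)[OF s']]
        finite_measure.emeasure_eq_measure[OF fin] ennreal_mult[symmetric] ennreal_plus[symmetric] del: ennreal_plus)
  have "solution \<nu>"
    unfolding solution_def
  proof (intro allI conjI ballI \<nu>(1) fin)
    fix k
    have "AE \<omega> in \<mu>' k. \<omega> \<in> E k" by (rule solutionD[OF s'])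
    then have "emeasure (\<mu>' k) (- E k) = 0"
      using AE_iff_measurable[of "- E k" "\<mu>' k" "\<lambda>\<omega>. \<omega> \<in> E k"] solutionD(1,5)[OF s', of k] by auto
    then have "emeasure (\<nu> k) (- E k) = 0" using eeq[where B="- E k" and k=k] by auto
    then show "AE \<omega> in \<nu> k. \<omega> \<in> E k"
      using \<nu>(1)[of k] sp[of k] by (subst AE_iff_measurable[of "- E k"]) auto
  next
    fix k and B :: "(nat \<Rightarrow> nat) set" assume B: "B \<in> sets borel"
    have Lm: "L k (indicator B) \<in> borel_measurable borel" using B by (intro L_measurable) auto
    have "emeasure (\<nu> k) B + ennreal t * emeasure (\<mu> k) B = emeasure (\<mu>' k) B" using eeq[OF B] by simp
    also have "\<dots> = (\<integral>\<^sup>+ \<omega>. L k (indicator B) \<omega> \<partial>\<mu>' (Suc k))" by (rule solutionD(4)[OF s' B])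
    also have "\<dots> = (\<integral>\<^sup>+ \<omega>. L k (indicator B) \<omega> \<partial>\<nu> (Suc k)) + ennreal t * (\<integral>\<^sup>+ \<omega>. L k (indicator B) \<omega> \<partial>\<mu> (Suc k))"
      by (rule nn_integral_lincomb_measure)
        (use \<nu>(1) solutionD(1)[OF s] solutionD(1)[OF s'] eeq solution_measurable[OF s' Lm] in auto)
    also have "(\<integral>\<^sup>+ \<omega>. L k (indicator B) \<omega> \<partial>\<mu> (Suc k)) = emeasure (\<mu> k) B" by (rule solutionD(4)[OF s B, symmetric])
    finally show "emeasure (\<nu> k) B = (\<integral>\<^sup>+ \<omega>. L k (indicator B) \<omega> \<partial>\<nu> (Suc k))"
      using finite_measure.emeasure_finite[OF solutionD(2)[OF s, of k], of B] ennreal_add_left_cancel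
      by (simp add: add.commute[of _ "ennreal t * _"] ennreal_mult_eq_top_iff)
  qed
  then show thesis using that eq by blast
qed

text \<open>In the application \<nu> is a difference of solutions and has no lower bound for its
  share of F. So \<open>harnack_integrated\<close> is used twice with exchanged roles: with \<nu>
  first and the empty word it bounds the masses of \<nu> from below by those of \<mu>; with \<mu>
  first, at indices supplied by \<open>recurrent\<close>, it compares the cylinders.\<close>

lemma domination:
  assumes g: "normalized \<mu>" and g': "normalized \<mu>'" and s: "solution \<nu>"
    and le: "\<And>k. measure (\<nu> k) UNIV \<le> measure (\<mu>' k) UNIV" and pos: "0 < measure (\<nu> 0) UNIV"
  obtains S where "0 < S" "\<And>k v. measure (\<mu> k) (cyl v) \<le> S * measure (\<nu> k) (cyl v)"
proof -
  have sm: "solution \<mu>" and one: "measure (\<mu> 0) UNIV = 1"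
    and d: "\<And>k. F_frac * measure (\<mu> k) UNIV \<le> measure (\<mu> k) inF" using g by (auto simp: normalized_def)
  define z where "z k = measure (\<mu> k) UNIV" for k
  define y where "y k = measure (\<nu> k) UNIV" for k
  define f where "f k = measure (\<mu> k) inF" for k
  define h where "h k = measure (\<nu> k) inF" for k
  define \<tau> where "\<tau> = y 0"
  have \<tau>: "0 < \<tau>" using pos by (simp add: \<tau>_def y_def)
  have nn: "0 \<le> z k" "0 \<le> y k" "0 \<le> f k" "0 \<le> h k" for k by (auto simp: z_def y_def f_def h_def)
  have yK: "y k \<le> mass_bound" for k using le[of k] normalized_mass_le[OF g', of k] by (simp add: y_def)
  have zK: "z k \<le> mass_bound" for k using normalized_mass_le[OF g, of k] by (simp add: z_def)
  have CN: "0 < C ^ N" using C_ge_1 by simp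
  define s1 where "s1 = \<tau> * F_frac / (2 * harnack_const * C ^ N)"
  have s1: "0 < s1" using \<tau> F_frac_pos harnack_const_pos CN by (simp add: s1_def)
  \<comment> \<open>From \<open>m0\<close> on the error term (1/4)^m * y m is at most half of
    \<open>\<tau>\<close>, and the other half remains on the left side.\<close>
  have "\<exists>m0. (1/4::real) ^ m0 < \<tau> / (2 * mass_bound)" using \<tau> mass_bound_pos by (intro real_arch_pow_inv) auto
  then obtain m0 where m0: "(1/4::real) ^ m0 < \<tau> / (2 * mass_bound)" by blast
  have low: "s1 * z m \<le> y m" if "m0 \<le> m" for m
  proof -
    have "\<tau> * f (m + N) \<le> y m * ((1/4) ^ m * f (m + N) + harnack_const)"
      using harnack_integrated[OF s sm, of "[]" m 0] one by (simp add: \<tau>_def y_def f_def)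
    also have "\<dots> = (1/4) ^ m * y m * f (m + N) + harnack_const * y m" by (simp add: algebra_simps)
    also have "\<dots> \<le> \<tau> / 2 * f (m + N) + harnack_const * y m"
    proof -
      have "(1/4::real) ^ m \<le> (1/4) ^ m0" using that by (intro power_decreasing) auto
      with m0 have "(1/4::real) ^ m \<le> \<tau> / (2 * mass_bound)" by linarith
      then have "(1/4) ^ m * y m \<le> \<tau> / (2 * mass_bound) * mass_bound"
        using yK nn \<tau> mass_bound_pos by (intro mult_mono) auto
      then have "(1/4) ^ m * y m \<le> \<tau> / 2" using mass_bound_pos by simp
      then show ?thesis using nn by (intro add_right_mono mult_right_mono) auto
    qed
    finally have 1: "\<tau> / 2 * f (m + N) \<le> harnack_const * y m" by simp
    have "F_frac * z m \<le> F_frac * (C ^ N * z (N + m))"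
      using solution_mass_le_pow[OF sm, of m N] F_frac_pos by (simp add: z_def)
    also have "\<dots> = C ^ N * (F_frac * z (m + N))" by (simp add: add.commute)
    also have "\<dots> \<le> C ^ N * f (m + N)" using d[of "m + N"] CN by (simp add: z_def f_def)
    finally have "\<tau> / 2 * (F_frac * z m) \<le> \<tau> / 2 * (C ^ N * f (m + N))" using \<tau> by simp
    also have "\<dots> = C ^ N * (\<tau> / 2 * f (m + N))" by simp
    also have "\<dots> \<le> C ^ N * (harnack_const * y m)" using 1 CN by simp
    finally show ?thesis using harnack_const_pos CN by (simp add: s1_def field_simps)
  qed
  \<comment> \<open>The factor 2 comes from the half of the mass found in F, C ^ N from the N steps
    that \<open>harnack\<close> leaves between its end points, and \<open>s1\<close> from the
    comparison of total masses.\<close>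
  define S where "S = 2 * C ^ N * harnack_const / s1"
  have S: "0 < S" using CN harnack_const_pos s1 by (simp add: S_def)
  have "measure (\<mu> k) (cyl v) \<le> S * measure (\<nu> k) (cyl v)" for k v
  proof (rule field_le_epsilon)
    fix \<epsilon> :: real assume \<epsilon>: "0 < \<epsilon>"
    define q where "q = length v"
    have Cq: "0 < C ^ q" using C_ge_1 by simp
    have "\<exists>j. (1/4::real) ^ j < \<epsilon> / (mass_bound * C ^ q)" using \<epsilon> mass_bound_pos Cq by (intro real_arch_pow_inv) auto
    then obtain j where j: "(1/4::real) ^ j < \<epsilon> / (mass_bound * C ^ q)" by blast
    \<comment> \<open>An index that is far out and recurrent at once: j makes the error term smaller
      than \<epsilon>, q, N and k leave room for the word and the gap, and m0 makes
      \<open>low\<close> available. The constant S does not depend on n.\<close>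
    obtain n where n: "n \<ge> j + q + N + k + m0" "0 < y n" "y n / 2 \<le> h n"
      using recurrent[OF s, of mass_bound 0 "j + q + N + k + m0"] yK pos by (auto simp: y_def h_def)
    define m where "m = n - N - k"
    have mn: "m + N + k = n" "N + (m + k) = n" "q + j \<le> m" "m0 \<le> n" using n by (auto simp: m_def)
    have hpos: "0 < h n" using n by linarith
    have zz: "z (m + k) \<le> 2 * C ^ N / s1 * h n"
    proof -
      have "z (m + k) \<le> C ^ N * z n" using solution_mass_le_pow[OF sm, of "m + k" N] mn by (simp add: z_def)
      also have "z n \<le> y n / s1" using low[OF mn(4)] s1 by (simp add: field_simps)
      also have "y n / s1 \<le> 2 * h n / s1" using n s1 by (intro divide_right_mono) auto
      finally show ?thesis using CN by (simp add: mult_ac)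
    qed
    have "measure (\<mu> k) (cyl v) * h n \<le> z (m + k) * ((1/4) ^ (m - q) * C ^ q * h n + harnack_const * measure (\<nu> k) (cyl v))"
      using harnack_integrated[OF sm s, of v m k] mn unfolding h_def z_def q_def by simp
    also have "\<dots> = z (m + k) * ((1/4) ^ (m - q) * C ^ q) * h n + z (m + k) * (harnack_const * measure (\<nu> k) (cyl v))"
      by (simp add: algebra_simps)
    also have "\<dots> \<le> \<epsilon> * h n + 2 * C ^ N / s1 * h n * (harnack_const * measure (\<nu> k) (cyl v))"
    proof (intro add_mono mult_right_mono)
      have "(1/4::real) ^ (m - q) \<le> (1/4) ^ j" using mn by (intro power_decreasing) auto
      with j have "(1/4::real) ^ (m - q) \<le> \<epsilon> / (mass_bound * C ^ q)" by linarith
      then have "z (m + k) * ((1/4) ^ (m - q) * C ^ q) \<le> mass_bound * (\<epsilon> / (mass_bound * C ^ q) * C ^ q)"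
        using zK nn Cq mass_bound_pos \<epsilon> by (intro mult_mono) auto
      then show "z (m + k) * ((1/4) ^ (m - q) * C ^ q) \<le> \<epsilon>" using mass_bound_pos C_ge_1 by auto
    qed (use zz nn harnack_const_pos in auto)
    also have "\<dots> = (S * measure (\<nu> k) (cyl v) + \<epsilon>) * h n" by (simp add: S_def algebra_simps)
    finally show "measure (\<mu> k) (cyl v) \<le> S * measure (\<nu> k) (cyl v) + \<epsilon>" using hpos by simp
  qed
  with S that show thesis by blast
qed

theorem normalized_unique:
  assumes g: "normalized \<mu>" and g': "normalized \<mu>'"
  shows "\<mu> k = \<mu>' k"
proof -
  have s: "solution \<mu>" and one: "measure (\<mu> 0) UNIV = 1" using g by (auto simp: normalized_def)
  have s': "solution \<mu>'" and one': "measure (\<mu>' 0) UNIV = 1" using g' by (auto simp: normalized_def)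
  define T where "T = {t. 0 \<le> t \<and> (\<forall>k v. t * measure (\<mu> k) (cyl v) \<le> measure (\<mu>' k) (cyl v))}"
  have T0: "0 \<in> T" by (simp add: T_def)
  have T1: "t \<le> 1" if "t \<in> T" for t
    using that one one' unfolding T_def by (auto dest!: spec[of _ 0] spec[of _ "[]"])
  have bdd: "bdd_above T" using T1 by (rule bdd_aboveI)
  define t where "t = Sup T"
  have t0: "0 \<le> t" unfolding t_def using T0 bdd by (rule cSup_upper)
  \<comment> \<open>Each condition on t is closed, so the supremum satisfies it as well.\<close>
  have t: "t * measure (\<mu> k) (cyl v) \<le> measure (\<mu>' k) (cyl v)" for k v
  proof (cases "measure (\<mu> k) (cyl v) = 0")
    case False
    then have p: "0 < measure (\<mu> k) (cyl v)" by (simp add: less_le)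
    have "t \<le> measure (\<mu>' k) (cyl v) / measure (\<mu> k) (cyl v)"
      unfolding t_def using T0 p by (intro cSup_least) (auto simp: T_def field_simps)
    then show ?thesis using p by (simp add: field_simps)
  qed simp
  obtain \<nu> where \<nu>: "solution \<nu>"
    "\<And>k B. B \<in> sets borel \<Longrightarrow> measure (\<mu>' k) B = measure (\<nu> k) B + t * measure (\<mu> k) B"
    using solution_diff[OF s s' t0 t] by blast
  have le: "measure (\<nu> k) UNIV \<le> measure (\<mu>' k) UNIV" for k
    using \<nu>(2)[of UNIV k] t0 by simp
  have z0: "measure (\<nu> 0) UNIV = 0"
  proof (rule ccontr)
    assume "measure (\<nu> 0) UNIV \<noteq> 0"
    then have "0 < measure (\<nu> 0) UNIV" by (simp add: less_le)
    from domination[OF g g' \<nu>(1) le this] obtain S where S: "0 < S"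
      "\<And>k v. measure (\<mu> k) (cyl v) \<le> S * measure (\<nu> k) (cyl v)" by blast
    \<comment> \<open>Since \<nu> dominates \<mu> / S, the factor t can be increased by 1 / S,
      against its maximality.\<close>
    have "t + 1 / S \<in> T"
      unfolding T_def
    proof (intro CollectI conjI allI)
      fix k v
      have "1 / S * measure (\<mu> k) (cyl v) \<le> measure (\<nu> k) (cyl v)"
        using S by (simp add: field_simps)
      then show "(t + 1 / S) * measure (\<mu> k) (cyl v) \<le> measure (\<mu>' k) (cyl v)"
        using \<nu>(2)[of "cyl v" k] by (simp add: algebra_simps)
    qed (use t0 S in auto)
    then have "t + 1 / S \<le> t" unfolding t_def using bdd by (rule cSup_upper)
    then show False using S by simp
  qed
  then have t1: "t = 1" using \<nu>(2)[of UNIV 0] one one' by simp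
  \<comment> \<open>Later measures determine earlier ones, not conversely, so vanishing at index 0
    has to be carried forward. If a later mass were positive, F would be charged at some index n
    \<ge> N, and \<open>solution_inF_ge\<close> would bring this mass back to index 0.\<close>
  have zk: "measure (\<nu> k) UNIV = 0" for k
  proof (rule ccontr)
    assume "measure (\<nu> k) UNIV \<noteq> 0"
    then have "0 < measure (\<nu> k) UNIV" by (simp add: less_le)
    moreover have "measure (\<nu> j) UNIV \<le> mass_bound" for j
      using le[of j] normalized_mass_le[OF g', of j] by simp
    ultimately obtain n where n: "N \<le> n" "0 < measure (\<nu> n) UNIV" "measure (\<nu> n) UNIV / 2 \<le> measure (\<nu> n) inF"
      using recurrent[OF \<nu>(1), of mass_bound k N] by auto
    then have "0 < w * measure (\<nu> n) inF" using w_pos by simp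
    also have "\<dots> \<le> measure (\<nu> 0) inF" using solution_inF_ge[OF \<nu>(1) n(1), of 0] by simp
    also have "\<dots> \<le> measure (\<nu> 0) UNIV"
      using finite_measure.bounded_measure[OF solutionD(2)[OF \<nu>(1), of 0], of inF] by (simp add: solutionD(5)[OF \<nu>(1)])
    finally show False using z0 by simp
  qed
  show ?thesis
  proof (rule measure_eqI_cyl)
    fix v
    have "measure (\<nu> k) (cyl v) = 0"
      using finite_measure.bounded_measure[OF solutionD(2)[OF \<nu>(1), of k], of "cyl v"] zk[of k] measure_nonneg[of "\<nu> k" "cyl v"]
      by (simp add: solutionD(5)[OF \<nu>(1)])
    then have "measure (\<mu>' k) (cyl v) = measure (\<mu> k) (cyl v)" using \<nu>(2)[of "cyl v" k] t1 by simp
    then show "emeasure (\<mu> k) (cyl v) = emeasure (\<mu>' k) (cyl v)"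
      by (simp add: finite_measure.emeasure_eq_measure[OF solutionD(2)[OF s]] finite_measure.emeasure_eq_measure[OF solutionD(2)[OF s']])
  next
    show "emeasure (\<mu> k) UNIV \<noteq> \<infinity>" using finite_measure.emeasure_finite[OF solutionD(2)[OF s]] by simp
  qed (use solutionD[OF s] solutionD[OF s'] in auto)
qed

end

section \<open>Existence by compactness\<close>

text \<open>A countable product of compact intervals is sequentially compact; this takes the place
  of a diagonal argument.\<close>

lemma bounded_pointwise_subseq:
  fixes X :: "nat \<Rightarrow> 'b :: countable \<Rightarrow> real"
  assumes "\<And>i z. X i z \<in> {a..b}"
  obtains s l where "strict_mono s" "\<And>z. (\<lambda>i. X (s i) z) \<longlonglongrightarrow> l z"
proof -
  have "compactin (product_topology (\<lambda>_. euclidean) UNIV) (PiE UNIV (\<lambda>_::'b. {a..b}))"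
    by (simp add: compactin_PiE)
  then have "compact (PiE UNIV (\<lambda>_::'b. {a..b}))"
    by (simp add: euclidean_product_topology)
  then have "seq_compact (PiE UNIV (\<lambda>_::'b. {a..b}))"
    by (rule compact_imp_seq_compact)
  then obtain l s where "strict_mono s" "(X \<circ> s) \<longlonglongrightarrow> l"
    unfolding seq_compact_def using assms by (metis PiE_UNIV_domain Pi_I)
  moreover from this(2) have "(\<lambda>i. X (s i) z) \<longlonglongrightarrow> l z" for z
    using continuous_on_tendsto_compose[OF continuous_on_product_coordinates[of z], of "X \<circ> s" l sequentially]
    by simp
  ultimately show thesis using that by blast
qed

text \<open>A cylinder is the disjoint union of its one-letter refinements, so an inequality at word
  length R descends to all shorter words.\<close>

lemma emeasure_cyl_le_upwards:
  assumes "sets M1 = sets borel" "sets M2 = sets borel"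
    and le: "\<And>u. length u = R \<Longrightarrow> emeasure M1 (cyl u) \<le> c * emeasure M2 (cyl u)"
    and v: "length v \<le> R"
  shows "emeasure M1 (cyl v) \<le> c * emeasure M2 (cyl v)"
  using v
proof (induction "R - length v" arbitrary: v)
  case 0
  then show ?case using le by simp
next
  case (Suc d)
  have "emeasure M1 (cyl (v @ [e])) \<le> c * emeasure M2 (cyl (v @ [e]))" for e
    using Suc by auto
  then have "(\<Sum>e. emeasure M1 (cyl (v @ [e]))) \<le> (\<Sum>e. c * emeasure M2 (cyl (v @ [e])))"
    by (intro suminf_le) auto
  then show ?case
    unfolding emeasure_cyl_snoc[OF assms(1), of v] emeasure_cyl_snoc[OF assms(2), of v] by simp
qed

text \<open>The name \<open>harnack_const\<close> is here a free natural number, the index from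
  which the bound holds, and is unrelated to the constant of \<open>weighted_shift\<close>. For
  finite y the bound at that index makes x finite too, and letting R grow removes the
  factor.\<close>

lemma ennreal_le_of_exp_le:
  fixes x y :: ennreal
  assumes "d \<longlonglongrightarrow> 0" "\<And>R. harnack_const \<le> R \<Longrightarrow> x \<le> ennreal (exp (d R)) * y"
  shows "x \<le> y"
proof (cases y)
  case (real b)
  have "x \<le> ennreal (exp (d harnack_const)) * ennreal b" using assms(2)[of harnack_const] real by simp
  also have "\<dots> < top" by (simp add: ennreal_mult[symmetric] real(1))
  finally obtain a where a: "x = ennreal a" "0 \<le> a" by (cases x) auto
  have "(\<lambda>R. exp (d R) * b) \<longlonglongrightarrow> exp 0 * b" by (intro tendsto_intros assms(1))
  moreover have "\<forall>\<^sub>F R in sequentially. a \<le> exp (d R) * b"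
    unfolding eventually_sequentially
    using assms(2) a real by (intro exI[of _ harnack_const]) (auto simp: ennreal_mult[symmetric] ennreal_le_iff)
  ultimately have "a \<le> exp 0 * b" by (intro tendsto_lowerbound) auto
  then show ?thesis using a real by (simp add: ennreal_leI)
qed auto

context weighted_shift begin

text \<open>The family generated backwards from the point mass at \<open>p n\<close> on level n, before normalization.\<close>

definition "Phi n k u = Lpow k (n - k) u (p n)"
definition "approx n k B = enn2real (Phi n k (indicator B))"

lemma Phi_jump: "m + k \<le> n \<Longrightarrow> Phi n k u = Phi n (m + k) (Lpow k m u)"
  using Lpow_add[of k m "n - (m + k)" u] by (simp add: Phi_def)

lemma Phi_mono: "k \<le> n \<Longrightarrow> (\<And>\<tau>. \<tau> \<in> E k \<Longrightarrow> g \<tau> \<le> h \<tau>) \<Longrightarrow> Phi n k g \<le> Phi n k h"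
  unfolding Phi_def by (rule Lpow_mono) (simp_all add: base)

text \<open>Finiteness comes from the crude bound C ^ (n - k). It is not uniform in n, but it allows
  real arithmetic from here on.\<close>

lemma Phi_indicator: "k \<le> n \<Longrightarrow> Phi n k (indicator B) = ennreal (approx n k B)"
proof -
  assume k: "k \<le> n"
  have "Phi n k (indicator B) \<le> Phi n k (\<lambda>_. 1)"
    using k by (rule Phi_mono) (auto simp: indicator_def)
  also have "\<dots> \<le> ennreal (C ^ (n - k))"
    using Lpow_one_le[of "p n" "n - k" k] k base(1)[of n] by (simp add: Phi_def)
  finally have "Phi n k (indicator B) < top" using ennreal_less_top le_less_trans by blast
  then show ?thesis by (simp add: approx_def)
qed

lemma approx_nonneg [simp]: "0 \<le> approx n k B"
  by (simp add: approx_def)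

lemma approx_mono: "k \<le> n \<Longrightarrow> B \<inter> E k \<subseteq> B' \<Longrightarrow> approx n k B \<le> approx n k B'"
  using Phi_mono[of k n "indicator B" "indicator B'"] Phi_indicator[of k n]
  by (auto simp: indicator_def subset_eq)

lemma approx_empty [simp]: "approx n k {} = 0"
  using tpow_cmult[of Suc A \<phi> k "n - k" 0 "\<lambda>_. 0"] by (simp add: approx_def Phi_def indicator_def[abs_def])

lemma approx_Un:
  assumes "k \<le> n" "B \<inter> B' = {}"
  shows "approx n k (B \<union> B') = approx n k B + approx n k B'"
proof -
  have "(indicator (B \<union> B') :: _ \<Rightarrow> ennreal) = (\<lambda>\<tau>. indicator B \<tau> + indicator B' \<tau>)"
    using assms by (auto simp: indicator_def fun_eq_iff)
  then have "Phi n k (indicator (B \<union> B')) = Phi n k (indicator B) + Phi n k (indicator B')"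
    by (simp add: Phi_def tpow_plus)
  then show ?thesis using Phi_indicator[OF assms(1)] by (simp flip: ennreal_plus)
qed

text \<open>The finite-level counterpart of \<open>solution_le\<close>, available as long as the
  indices do not exceed n.\<close>

lemma approx_le:
  assumes "m + k \<le> n" "0 \<le> c"
    and le: "\<And>\<omega>. \<omega> \<in> E (m + k) \<Longrightarrow> Lpow k m (indicator B) \<omega> \<le> ennreal c * indicator B' \<omega>"
  shows "approx n k B \<le> c * approx n (m + k) B'"
proof -
  have "Phi n k (indicator B) \<le> Phi n (m + k) (\<lambda>\<tau>. ennreal c * indicator B' \<tau>)"
    unfolding Phi_jump[OF assms(1)] using assms by (intro Phi_mono) auto
  also have "\<dots> = ennreal c * Phi n (m + k) (indicator B')" by (simp add: Phi_def tpow_cmult)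
  finally show ?thesis
    using Phi_indicator[of k n] Phi_indicator[of "m + k" n] assms by (simp flip: ennreal_mult)
qed

lemma approx_ge:
  assumes "m + k \<le> n" "0 \<le> c"
    and le: "\<And>\<omega>. \<omega> \<in> E (m + k) \<Longrightarrow> ennreal c * indicator B' \<omega> \<le> Lpow k m (indicator B) \<omega>"
  shows "c * approx n (m + k) B' \<le> approx n k B"
proof -
  have "ennreal c * Phi n (m + k) (indicator B') = Phi n (m + k) (\<lambda>\<tau>. ennreal c * indicator B' \<tau>)"
    by (simp add: Phi_def tpow_cmult)
  also have "\<dots> \<le> Phi n k (indicator B)"
    unfolding Phi_jump[OF assms(1)] using assms by (intro Phi_mono) auto
  finally show ?thesis
    using Phi_indicator[of k n] Phi_indicator[of "m + k" n] assms by (simp flip: ennreal_mult)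
qed

text \<open>At index n sits the point mass at \<open>p n\<close>, and \<open>p n\<close> starts in
  F; backward inductions begin here.\<close>

lemma approx_top [simp]: "approx n n UNIV = 1" "approx n n inF = 1"
  using base(2)[of n] by (auto simp: approx_def Phi_def)

lemma approx_mass_le_pow: "m + k \<le> n \<Longrightarrow> approx n k UNIV \<le> C ^ m * approx n (m + k) UNIV"
  using C_ge_1 by (intro approx_le) (auto intro!: order_trans[OF _ Lpow_one_le] simp: indicator_def)

lemma approx_inF_ge:
  assumes m: "N \<le> m" "m + k \<le> n"
  shows "w * approx n (m + k) inF \<le> approx n k inF"
proof -
  have "w * approx n (m + k) inF \<le> approx n k {\<tau>. \<tau> 0 = p 0 0}"
  proof (rule approx_ge[OF m(2)])
    fix \<omega> assume "\<omega> \<in> E (m + k)"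
    then show "ennreal w * indicator inF \<omega> \<le> Lpow k m (indicator {\<tau>. \<tau> 0 = p 0 0}) \<omega>"
      using access[OF m(1) base(2)[of 0], of \<omega> k] by (cases "\<omega> 0 \<in> F") auto
  qed (use w_pos in auto)
  also have "\<dots> \<le> approx n k inF" using base(2)[of 0] m by (intro approx_mono) auto
  finally show ?thesis .
qed

lemma approx_mass_le:
  assumes "Suc k \<le> n"
  shows "approx n k UNIV \<le> approx n k inF + 1 / 4 * approx n (Suc k) UNIV"
proof -
  have "inF \<union> {\<tau>. \<tau> 0 \<notin> F} = UNIV" by auto
  then have "approx n k UNIV = approx n k inF + approx n k {\<tau>. \<tau> 0 \<notin> F}"
    using approx_Un[of k n inF "{\<tau>. \<tau> 0 \<notin> F}"] assms by auto
  moreover have "approx n k {\<tau>. \<tau> 0 \<notin> F} \<le> 1 / 4 * approx n (1 + k) UNIV"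
    using transfer_outside_le[of _ k] assms by (intro approx_le) auto
  ultimately show ?thesis by simp
qed

text \<open>Backward induction from j = n. After multiplication by w the part in F is at most
  \<open>approx n k inF\<close>, and the part outside is at most a quarter of the bound for the next
  index; 4/3 reproduces itself as 1 + 1/4 * 4/3.\<close>

lemma approx_mass_le_inF:
  assumes "N + k \<le> j" "j \<le> n"
  shows "w * approx n j UNIV \<le> 4 / 3 * approx n k inF"
  using assms(2,1)
proof (induction j rule: inc_induct)
  case base
  then have "N \<le> n - k" "n - k + k = n" by auto
  then have "w \<le> approx n k inF" using approx_inF_ge[of "n - k" k n] by simp
  moreover have "approx n k inF \<le> 4 / 3 * approx n k inF" by simp
  ultimately show ?case unfolding approx_top(1) by linarith
next
  case (step j)
  have "w * approx n j inF \<le> approx n k inF" using approx_inF_ge[of "j - k" k n] step by simp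
  moreover have "w * approx n j UNIV \<le> w * approx n j inF + 1 / 4 * (w * approx n (Suc j) UNIV)"
    using mult_left_mono[OF approx_mass_le[of j n], of w] step w_pos by (simp add: algebra_simps)
  moreover have "w * approx n (Suc j) UNIV \<le> 4 / 3 * approx n k inF" using step by simp
  ultimately show ?case by linarith
qed

definition "approx_bound = 4 * C ^ N / (3 * w)"

lemma approx_bound_pos: "0 < approx_bound" using C_ge_1 w_pos by (simp add: approx_bound_def)

text \<open>The lower bound on F that will pass to the limit. The room of N steps below n is
  required because \<open>access\<close> works only over N or more steps.\<close>

lemma approx_dl_le:
  assumes "N + k \<le> n"
  shows "F_frac * approx n k UNIV \<le> approx n k inF"
proof -
  have "w * approx n k UNIV \<le> w * (C ^ N * approx n (N + k) UNIV)"
    using approx_mass_le_pow[OF assms] w_pos by simp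
  also have "\<dots> = C ^ N * (w * approx n (N + k) UNIV)" by simp
  also have "\<dots> \<le> C ^ N * (4 / 3 * approx n k inF)"
    using approx_mass_le_inF[OF order_refl assms] C_ge_1 by (intro mult_left_mono) auto
  finally show ?thesis using C_ge_1 by (simp add: F_frac_def field_simps)
qed

text \<open>Uniformity in n is the point: after division by the mass at index 0 the weights stay in
  a fixed interval, so that limits along subsequences exist.\<close>

lemma approx_Kr_le:
  assumes "N + k \<le> n"
  shows "approx n k B \<le> approx_bound * approx n 0 UNIV"
proof -
  have "w * approx n k B \<le> w * approx n k UNIV" using assms w_pos by (intro mult_left_mono approx_mono) auto
  also have "\<dots> \<le> w * (C ^ N * approx n (N + k) UNIV)"
    using approx_mass_le_pow[OF assms] w_pos by simp
  also have "\<dots> = C ^ N * (w * approx n (N + k) UNIV)" by simp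
  also have "\<dots> \<le> C ^ N * (4 / 3 * approx n 0 inF)"
    using approx_mass_le_inF[of 0 "N + k" n] assms C_ge_1 by (intro mult_left_mono) auto
  also have "\<dots> \<le> C ^ N * (4 / 3 * approx n 0 UNIV)"
    using C_ge_1 by (intro mult_left_mono approx_mono) auto
  finally show ?thesis using w_pos by (simp add: approx_bound_def field_simps)
qed

lemma approx_0_pos: "N \<le> n \<Longrightarrow> 0 < approx n 0 UNIV"
  using approx_mass_le_inF[of 0 n n] w_pos approx_mono[of 0 n inF UNIV] by simp

definition "approx_cyl n k v = approx n k (cyl v) / approx n 0 UNIV"

lemma approx_cyl_range: "N + k \<le> n \<Longrightarrow> approx_cyl n k v \<in> {0..approx_bound}"
  using approx_Kr_le[of k n "cyl v"] approx_0_pos[of n] by (auto simp: approx_cyl_def field_simps)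

lemma approx_cyl_split:
  assumes "k \<le> n"
  shows "approx n k (cyl v) = (\<Sum>e<l. approx n k (cyl (v @ [e]))) + approx n k {\<omega> \<in> cyl v. l \<le> \<omega> (length v)}"
proof (induction l)
  case (Suc l)
  have "approx n k {\<omega> \<in> cyl v. l \<le> \<omega> (length v)} = approx n k (cyl (v @ [l]) \<union> {\<omega> \<in> cyl v. Suc l \<le> \<omega> (length v)})"
    by (rule arg_cong[where f="approx n k"]) (auto simp: cyl_snoc)
  also have "\<dots> = approx n k (cyl (v @ [l])) + approx n k {\<omega> \<in> cyl v. Suc l \<le> \<omega> (length v)}"
    by (rule approx_Un[OF assms]) (auto simp: cyl_snoc)
  finally show ?case using Suc by simp
qed simp

text \<open>Tightness, uniform in n, which keeps the limit weights additive. For the first letter it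
  comes from the tail of the potential; for a later letter finite range leaves only finitely many
  successors of \<open>last v\<close>, so the tail vanishes for large l.\<close>

lemma approx_tail:
  obtains \<tau> where "\<tau> \<longlonglongrightarrow> 0"
    "\<And>l n. N + Suc k \<le> n \<Longrightarrow> approx n k {\<omega> \<in> cyl v. Suc l \<le> \<omega> (length v)} / approx n 0 UNIV \<le> \<tau> l"
proof (cases "v = []")
  case True
  have "(\<lambda>l. \<eta> l * approx_bound) \<longlonglongrightarrow> 0 * approx_bound" by (intro tendsto_intros eta_tendsto)
  then have 1: "(\<lambda>l. \<eta> l * approx_bound) \<longlonglongrightarrow> 0" by simp
  have "approx n k {\<omega> \<in> cyl v. Suc l \<le> \<omega> (length v)} / approx n 0 UNIV \<le> \<eta> l * approx_bound" if n: "N + Suc k \<le> n" for l n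
  proof -
    have "approx n k {\<omega>. l < \<omega> 0} \<le> \<eta> l * approx n (1 + k) UNIV"
      using transfer_tail_le[of _ k l] n eta_nonneg by (intro approx_le) auto
    also have "\<dots> \<le> \<eta> l * (approx_bound * approx n 0 UNIV)"
      using approx_Kr_le[OF n] eta_nonneg by (intro mult_left_mono) auto
    finally show ?thesis using approx_0_pos[of n] n True by (simp add: field_simps Suc_le_eq)
  qed
  with 1 that show thesis by blast
next
  case False
  obtain S where S: "finite S" "\<And>j. A (length v - 1 + k) (last v) j \<Longrightarrow> j \<in> S"
    using finite_range[of "length v - 1 + k" "last v"] by blast
  define \<tau> where "\<tau> l = (if S \<subseteq> {..l} then 0 else approx_bound)" for l
  obtain b where "S \<subseteq> {..b}" using S(1) finite_nat_iff_bounded_le by blast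
  then have "\<forall>\<^sub>F l in sequentially. \<tau> l = 0"
    unfolding eventually_sequentially \<tau>_def by (intro exI[of _ b]) auto
  then have 1: "\<tau> \<longlonglongrightarrow> 0" by (rule tendsto_eventually)
  have "approx n k {\<omega> \<in> cyl v. Suc l \<le> \<omega> (length v)} / approx n 0 UNIV \<le> \<tau> l" if n: "N + Suc k \<le> n" for l n
  proof (cases "S \<subseteq> {..l}")
    case True
    have "{\<omega> \<in> cyl v. Suc l \<le> \<omega> (length v)} \<inter> E k \<subseteq> {}"
    proof
      fix \<omega> assume w: "\<omega> \<in> {\<omega> \<in> cyl v. Suc l \<le> \<omega> (length v)} \<inter> E k"
      then have "A (length v - 1 + k) (\<omega> (length v - 1)) (\<omega> (Suc (length v - 1)))"
        by (auto simp: mem_Einf_iff Suc_funpow)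
      moreover have "\<omega> (length v - 1) = last v" using w False by (auto simp: cyl_def last_conv_nth)
      ultimately have "\<omega> (length v) \<in> S" using S(2) False by simp
      then show "\<omega> \<in> {}" using True w by auto
    qed
    from approx_mono[OF _ this, of n] n have "approx n k {\<omega> \<in> cyl v. Suc l \<le> \<omega> (length v)} = 0"
      using approx_nonneg[of n k "{\<omega> \<in> cyl v. Suc l \<le> \<omega> (length v)}"] by simp
    then show ?thesis using True by (simp add: \<tau>_def)
  next
    case False
    then show ?thesis
      using approx_Kr_le[of k n "{\<omega> \<in> cyl v. Suc l \<le> \<omega> (length v)}"] approx_0_pos[of n] n
      by (simp add: \<tau>_def field_simps)
  qed
  with 1 that show thesis by blast
qed


text \<open>Convergence will be known on cylinders only, whereas a transferred indicator carries the
  weight exp \<phi>. Up to exp (D (length v)) in either direction this weight is constant on the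
  cylinder. A nonempty v makes the transition after e a part of the word, so it is admissible
  wherever it has to be.\<close>

lemma transfer_cyl_bounds:
  assumes \<tau>: "\<tau> \<in> cyl (e # v)" "\<tau> \<in> E k" and v: "v \<noteq> []" and \<omega>: "\<omega> \<in> E (Suc k)"
  shows "L k (indicator (cyl (e # v))) \<omega> \<le> ennreal (exp (\<phi> k \<tau> + D (length v))) * indicator (cyl v) \<omega>"
    and "ennreal (exp (\<phi> k \<tau> - D (length v))) * indicator (cyl v) \<omega> \<le> L k (indicator (cyl (e # v))) \<omega>"
proof -
  have *: "A k e (\<omega> 0) \<and> \<phi> k (case_nat e \<omega>) \<le> \<phi> k \<tau> + D (length v) \<and> \<phi> k \<tau> \<le> \<phi> k (case_nat e \<omega>) + D (length v)"
    if "\<omega> \<in> cyl v"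
  proof -
    have t: "\<tau> 0 = e" "\<And>i. i < length v \<Longrightarrow> \<tau> (Suc i) = v ! i" using \<tau>(1) by (auto simp: cyl_Cons cyl_def)
    have o: "\<And>i. i < length v \<Longrightarrow> \<omega> i = v ! i" using that by (auto simp: cyl_def)
    have "A k (\<tau> 0) (\<tau> (Suc 0))" using \<tau>(2)[unfolded mem_Einf_iff] by (auto dest: spec[of _ 0])
    then have a: "A k e (\<omega> 0)" using t o v by simp
    have c: "case_nat e \<omega> \<in> E k" by (rule case_nat_in_Einf[OF \<omega> a])
    have eq: "case_nat e \<omega> i = \<tau> i" if "i \<le> length v" for i using that t o by (cases i) auto
    show ?thesis using a distortion[OF c \<tau>(2), of "length v"] distortion[OF \<tau>(2) c, of "length v"] eq by auto
  qed
  show "L k (indicator (cyl (e # v))) \<omega> \<le> ennreal (exp (\<phi> k \<tau> + D (length v))) * indicator (cyl v) \<omega>"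
    unfolding transfer_indicator_cyl_Cons using * by (cases "\<omega> \<in> cyl v") (auto intro!: ennreal_leI)
  show "ennreal (exp (\<phi> k \<tau> - D (length v))) * indicator (cyl v) \<omega> \<le> L k (indicator (cyl (e # v))) \<omega>"
    unfolding transfer_indicator_cyl_Cons using * by (cases "\<omega> \<in> cyl v") (auto intro!: ennreal_leI)
qed

text \<open>A subsequence of an arbitrary sequence of levels is extracted, so that uniqueness can
  afterwards upgrade the result to convergence of the whole sequence.\<close>

theorem normalized_limit_exists:
  assumes r: "strict_mono (r :: nat \<Rightarrow> nat)"
  obtains s \<mu> where "strict_mono s" "normalized \<mu>" "\<And>k v. (\<lambda>i. approx_cyl (r (s i)) k v) \<longlonglongrightarrow> measure (\<mu> k) (cyl v)"
proof -
  \<comment> \<open>Pairs of an index and a word are countable. The bound on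
    \<open>approx_cyl\<close> holds from level N + k on; the value 0 below that level only keeps the
    sequence in the interval and does not affect the limit.\<close>
  obtain s l where s: "strict_mono s" and l: "\<And>z. (\<lambda>i. case z of (k, v) \<Rightarrow> if N + k \<le> r (s i) then approx_cyl (r (s i)) k v else 0) \<longlonglongrightarrow> l z"
    by (rule bounded_pointwise_subseq[of "\<lambda>i (k, v). if N + k \<le> r i then approx_cyl (r i) k v else 0" 0 approx_bound])
      (use approx_cyl_range approx_bound_pos in auto)
  define q where "q i = r (s i)" for i
  have q: "strict_mono q" using strict_mono_o[OF r s] by (simp add: q_def[abs_def] o_def)
  have evq: "\<forall>\<^sub>F i in sequentially. c \<le> q i" for c
    unfolding eventually_sequentially using seq_suble[OF q] by (intro exI[of _ c]) (auto intro: order_trans)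
  define mm where "mm k v = l (k, v)" for k v
  have lim: "(\<lambda>i. approx_cyl (q i) k v) \<longlonglongrightarrow> mm k v" for k v
    using l[of "(k, v)"] unfolding mm_def
    by (rule Lim_transform_eventually) (use evq[of "N + k"] in \<open>auto elim!: eventually_mono simp: q_def\<close>)
  have nn: "0 \<le> mm k v" for k v
    by (rule tendsto_lowerbound[OF lim]) (use evq[of "N + k"] approx_cyl_range in \<open>auto elim!: eventually_mono\<close>)
  \<comment> \<open>Before the limit the weights split exactly into finitely many next letters and a
    tail. The tail is at most \<tau> l uniformly in n, so no mass escapes.\<close>
  have sums: "(\<lambda>e. mm k (v @ [e])) sums mm k v" for k v
  proof -
    obtain \<tau> where \<tau>: "\<tau> \<longlonglongrightarrow> 0"
      "\<And>l n. N + Suc k \<le> n \<Longrightarrow> approx n k {\<omega> \<in> cyl v. Suc l \<le> \<omega> (length v)} / approx n 0 UNIV \<le> \<tau> l"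
      using approx_tail by blast
    have split: "approx_cyl n k v = (\<Sum>e<Suc l. approx_cyl n k (v @ [e])) + approx n k {\<omega> \<in> cyl v. Suc l \<le> \<omega> (length v)} / approx n 0 UNIV"
      if "N + Suc k \<le> n" for n l
      using approx_cyl_split[of k n v "Suc l"] that
      by (simp only: approx_cyl_def) (simp add: sum_divide_distrib add_divide_distrib)
    have lims: "(\<lambda>i. approx_cyl (q i) k v - (\<Sum>e<Suc l. approx_cyl (q i) k (v @ [e]))) \<longlonglongrightarrow> mm k v - (\<Sum>e<Suc l. mm k (v @ [e]))" for l
      by (intro tendsto_intros lim)
    have "0 \<le> mm k v - (\<Sum>e<Suc l. mm k (v @ [e]))" for l
      by (rule tendsto_lowerbound[OF lims])
        (use evq[of "N + Suc k"] split[of _ l] approx_nonneg in \<open>auto elim!: eventually_mono simp del: sum.lessThan_Suc\<close>)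
    moreover have "mm k v - (\<Sum>e<Suc l. mm k (v @ [e])) \<le> \<tau> l" for l
      by (rule tendsto_upperbound[OF lims])
        (use evq[of "N + Suc k"] split[of _ l] \<tau>(2)[of _ l] in \<open>auto elim!: eventually_mono simp del: sum.lessThan_Suc\<close>)
    ultimately have "(\<lambda>l. mm k v - (\<Sum>e<Suc l. mm k (v @ [e]))) \<longlonglongrightarrow> 0"
      by (intro tendsto_sandwich[OF _ _ tendsto_const \<tau>(1)]) (auto simp del: sum.lessThan_Suc)
    then have "(\<lambda>l. mm k v - (mm k v - (\<Sum>e<Suc l. mm k (v @ [e])))) \<longlonglongrightarrow> mm k v - 0"
      by (intro tendsto_intros)
    then have "(\<lambda>l. \<Sum>e<Suc l. mm k (v @ [e])) \<longlonglongrightarrow> mm k v" by simp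
    then show ?thesis
      unfolding sums_def by (rule filterlim_sequentially_Suc[of "\<lambda>l. \<Sum>e<l. mm k (v @ [e])", THEN iffD1])
  qed
  have "\<exists>\<mu>. sets \<mu> = sets borel \<and> (\<forall>v. emeasure \<mu> (cyl v) = ennreal (mm k v))" for k
    by (rule cylinder_extension[of "mm k"]) (use nn sums in auto)
  then obtain \<mu> where \<mu>: "\<And>k. sets (\<mu> k) = sets borel" "\<And>k v. emeasure (\<mu> k) (cyl v) = ennreal (mm k v)"
    by metis
  have sp: "space (\<mu> k) = UNIV" for k using sets_eq_imp_space_eq[OF \<mu>(1)] by simp
  have fin: "finite_measure (\<mu> k)" for k
    using \<mu>(2)[of k "[]"] by (intro finite_measureI) (auto simp: sp)
  have mv: "measure (\<mu> k) (cyl v) = mm k v" for k v using \<mu>(2)[of k v] nn by (simp add: measure_def)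
  have mm0: "mm k v = 0" if "cyl v \<inter> E k = {}" for k v
  proof -
    have "\<forall>\<^sub>F i in sequentially. approx_cyl (q i) k v = 0"
      using evq[of k]
    proof (rule eventually_mono)
      fix i assume "k \<le> q i"
      then have "approx (q i) k (cyl v) \<le> approx (q i) k {}" by (rule approx_mono) (simp add: that)
      then show "approx_cyl (q i) k v = 0" using approx_nonneg[of "q i" k "cyl v"] by (simp add: approx_cyl_def)
    qed
    then have "(\<lambda>i. approx_cyl (q i) k v) \<longlonglongrightarrow> 0" by (rule tendsto_eventually)
    then show ?thesis using lim LIMSEQ_unique by blast
  qed
  have AEE: "AE \<omega> in \<mu> k. \<omega> \<in> E k" for k
  proof -
    have "(\<Union>v\<in>{v. cyl v \<inter> E k = {}}. cyl v) \<in> null_sets (\<mu> k)"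
      by (intro null_sets_UN') (auto simp: null_sets_def \<mu> mm0)
    then have "- E k \<in> null_sets (\<mu> k)" by (simp add: compl_Einf_eq_cyl)
    then show ?thesis by (rule AE_I') (auto simp: sp)
  qed
  have eq: "emeasure (\<mu> k) B = (\<integral>\<^sup>+ \<omega>. L k (indicator B) \<omega> \<partial>\<mu> (Suc k))" if B: "B \<in> sets borel" for k B
  proof -
    have Lm: "L k (indicator X) \<in> borel_measurable (\<mu> (Suc k))" if "X \<in> sets borel" for X
      using L_measurable[of "indicator X" k] that \<mu>(1) by (simp cong: measurable_cong_sets)
    \<comment> \<open>The dual image of \<mu> (Suc k). On long words both \<kappa> and \<mu> k lie
      between the same two multiples of the mass of \<open>cyl v\<close> at index
      \<open>Suc k\<close>, where v is the word without its first letter.\<close>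
    define \<kappa> where "\<kappa> = measure_of UNIV (sets borel) (\<lambda>B. \<integral>\<^sup>+ \<omega>. L k (indicator B) \<omega> \<partial>\<mu> (Suc k))"
    have \<kappa>s: "sets \<kappa> = sets borel" unfolding \<kappa>_def using sets.sigma_sets_eq[of "borel :: (nat \<Rightarrow> nat) measure"] by simp
    have \<kappa>: "emeasure \<kappa> X = (\<integral>\<^sup>+ \<omega>. L k (indicator X) \<omega> \<partial>\<mu> (Suc k))" if X: "X \<in> sets borel" for X
      unfolding \<kappa>_def
    proof (rule emeasure_measure_of_sigma)
      show "sigma_algebra UNIV (sets (borel :: (nat \<Rightarrow> nat) measure))"
        using sets.sigma_algebra_axioms[of "borel :: (nat \<Rightarrow> nat) measure"] by simp
      have "L k (\<lambda>_. 0) = (\<lambda>_. 0)" using transfer_cmult[of A \<phi> k 0 "\<lambda>_. 0"] by (simp add: fun_eq_iff)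
      then show "positive (sets borel) (\<lambda>B. \<integral>\<^sup>+ \<omega>. L k (indicator B) \<omega> \<partial>\<mu> (Suc k))"
        by (simp add: positive_def indicator_def[abs_def])
      show "countably_additive (sets borel) (\<lambda>B. \<integral>\<^sup>+ \<omega>. L k (indicator B) \<omega> \<partial>\<mu> (Suc k))"
      proof (rule countably_additiveI)
        fix Y :: "nat \<Rightarrow> (nat \<Rightarrow> nat) set" assume Y: "range Y \<subseteq> sets borel" "disjoint_family Y"
        have "(indicator (\<Union>i. Y i) :: _ \<Rightarrow> ennreal) = (\<lambda>\<tau>. \<Sum>i. indicator (Y i) \<tau>)"
          using suminf_indicator[OF Y(2)] by (auto simp: fun_eq_iff)
        then have "(\<integral>\<^sup>+ \<omega>. L k (indicator (\<Union>i. Y i)) \<omega> \<partial>\<mu> (Suc k)) = (\<integral>\<^sup>+ \<omega>. (\<Sum>i. L k (indicator (Y i)) \<omega>) \<partial>\<mu> (Suc k))"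
          by (simp add: transfer_suminf)
        also have "\<dots> = (\<Sum>i. \<integral>\<^sup>+ \<omega>. L k (indicator (Y i)) \<omega> \<partial>\<mu> (Suc k))"
          by (rule nn_integral_suminf) (use Y Lm in auto)
        finally show "(\<Sum>i. \<integral>\<^sup>+ \<omega>. L k (indicator (Y i)) \<omega> \<partial>\<mu> (Suc k)) = (\<integral>\<^sup>+ \<omega>. L k (indicator (\<Union>i. Y i)) \<omega> \<partial>\<mu> (Suc k))"
          by simp
      qed
    qed (use X in simp)
    have bounds: "emeasure (\<mu> k) (cyl u) \<le> ennreal (exp (2 * D (length u - 1))) * emeasure \<kappa> (cyl u) \<and>
        emeasure \<kappa> (cyl u) \<le> ennreal (exp (2 * D (length u - 1))) * emeasure (\<mu> k) (cyl u)" if u: "2 \<le> length u" for u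
    proof -
      obtain e v where ev: "u = e # v" "v \<noteq> []" using u by (cases u; cases "tl u") auto
      show ?thesis
      proof (cases "cyl u \<inter> E k = {}")
        case True
        have "emeasure \<kappa> (cyl u) = (\<integral>\<^sup>+ \<omega>. 0 \<partial>\<mu> (Suc k))"
          unfolding \<kappa>[OF cyl_sets]
        proof (rule nn_integral_cong_AE, use AEE[of "Suc k"] in \<open>elim eventually_mono\<close>)
          fix \<omega> assume "\<omega> \<in> E (Suc k)"
          then have "\<not> (A k e (\<omega> 0) \<and> \<omega> \<in> cyl v)"
            using True case_nat_in_Einf[of \<omega> Suc A k e]
            by (auto simp: ev cyl_Cons disjoint_iff dest!: spec[of _ "case_nat e \<omega>"])
          then show "L k (indicator (cyl u)) \<omega> = 0" by (auto simp: ev transfer_indicator_cyl_Cons indicator_def)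
        qed
        then show ?thesis using mm0[OF True] \<mu>(2)[of k u] by simp
      next
        case False
        then obtain \<tau> where \<tau>: "\<tau> \<in> cyl (e # v)" "\<tau> \<in> E k" by (auto simp: ev)
        define a where "a = exp (\<phi> k \<tau> - D (length v))"
        define b where "b = exp (\<phi> k \<tau> + D (length v))"
        define c where "c = exp (2 * D (length v))"
        have abc: "0 \<le> a" "0 \<le> b" "b = c * a" "0 \<le> c" by (auto simp: a_def b_def c_def exp_add[symmetric])
        have ub: "mm k (e # v) \<le> b * mm (Suc k) v"
        proof (rule tendsto_le[OF _ tendsto_mult_left[OF lim] lim], simp)
          show "\<forall>\<^sub>F i in sequentially. approx_cyl (q i) k (e # v) \<le> b * approx_cyl (q i) (Suc k) v"
            using evq[of "N + Suc k"]
          proof (rule eventually_mono)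
            fix i assume i: "N + Suc k \<le> q i"
            have "approx (q i) k (cyl (e # v)) \<le> b * approx (q i) (1 + k) (cyl v)"
              by (rule approx_le) (use i abc transfer_cyl_bounds(1)[OF \<tau> ev(2)] in \<open>auto simp: b_def\<close>)
            then show "approx_cyl (q i) k (e # v) \<le> b * approx_cyl (q i) (Suc k) v"
              using approx_0_pos[of "q i"] i by (simp add: approx_cyl_def field_simps)
          qed
        qed
        have lb: "a * mm (Suc k) v \<le> mm k (e # v)"
        proof (rule tendsto_le[OF _ lim tendsto_mult_left[OF lim]], simp)
          show "\<forall>\<^sub>F i in sequentially. a * approx_cyl (q i) (Suc k) v \<le> approx_cyl (q i) k (e # v)"
            using evq[of "N + Suc k"]
          proof (rule eventually_mono)
            fix i assume i: "N + Suc k \<le> q i"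
            have "a * approx (q i) (1 + k) (cyl v) \<le> approx (q i) k (cyl (e # v))"
              by (rule approx_ge) (use i abc transfer_cyl_bounds(2)[OF \<tau> ev(2)] in \<open>auto simp: a_def\<close>)
            then show "a * approx_cyl (q i) (Suc k) v \<le> approx_cyl (q i) k (e # v)"
              using approx_0_pos[of "q i"] i by (simp add: approx_cyl_def field_simps)
          qed
        qed
        have "emeasure \<kappa> (cyl u) \<le> (\<integral>\<^sup>+ \<omega>. ennreal b * indicator (cyl v) \<omega> \<partial>\<mu> (Suc k))"
          unfolding \<kappa>[OF cyl_sets] ev b_def
          by (rule nn_integral_mono_AE, use AEE[of "Suc k"] in \<open>elim eventually_mono\<close>) (rule transfer_cyl_bounds(1)[OF \<tau> ev(2)])
        also have "\<dots> = ennreal (b * mm (Suc k) v)"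
          using \<mu> abc nn by (simp add: nn_integral_cmult_indicator ennreal_mult)
        finally have ub2: "emeasure \<kappa> (cyl u) \<le> ennreal (b * mm (Suc k) v)" .
        have "ennreal (a * mm (Suc k) v) = (\<integral>\<^sup>+ \<omega>. ennreal a * indicator (cyl v) \<omega> \<partial>\<mu> (Suc k))"
          using \<mu> abc nn by (simp add: nn_integral_cmult_indicator ennreal_mult)
        also have "\<dots> \<le> emeasure \<kappa> (cyl u)"
          unfolding \<kappa>[OF cyl_sets] ev a_def
          by (rule nn_integral_mono_AE, use AEE[of "Suc k"] in \<open>elim eventually_mono\<close>) (rule transfer_cyl_bounds(2)[OF \<tau> ev(2)])
        finally have lb2: "ennreal (a * mm (Suc k) v) \<le> emeasure \<kappa> (cyl u)" .
        have bc: "ennreal (b * mm (Suc k) v) = ennreal c * ennreal (a * mm (Suc k) v)"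
          using abc nn by (simp add: ennreal_mult[symmetric] mult.assoc)
        have "emeasure (\<mu> k) (cyl u) \<le> ennreal c * ennreal (a * mm (Suc k) v)"
          using ub unfolding bc[symmetric] by (simp add: \<mu> ev ennreal_leI)
        also have "\<dots> \<le> ennreal c * emeasure \<kappa> (cyl u)" by (rule mult_left_mono[OF lb2]) simp
        finally have 1: "emeasure (\<mu> k) (cyl u) \<le> ennreal c * emeasure \<kappa> (cyl u)" .
        have "emeasure \<kappa> (cyl u) \<le> ennreal c * ennreal (a * mm (Suc k) v)"
          using ub2 unfolding bc .
        also have "\<dots> \<le> ennreal c * emeasure (\<mu> k) (cyl u)"
          using lb by (intro mult_left_mono) (auto simp: \<mu> ev ennreal_leI)
        finally show ?thesis using 1 by (simp add: c_def ev)
      qed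
    qed
    have D0: "(\<lambda>R. 2 * D (R - 1)) \<longlonglongrightarrow> 0"
    proof -
      have "D \<longlonglongrightarrow> 0" by (rule summable_LIMSEQ_zero[OF D_summable])
      then have "(\<lambda>R. 2 * D (Suc R - 1)) \<longlonglongrightarrow> 2 * 0" by (intro tendsto_intros) simp
      then show ?thesis using filterlim_sequentially_Suc[of "\<lambda>R. 2 * D (R - 1)" "nhds 0"] by simp
    qed
    \<comment> \<open>Splitting the cylinder into words of length R improves the distortion factor
      to exp (2 * D (R - 1)), which tends to 1.\<close>
    have "emeasure (\<mu> k) (cyl v) = emeasure \<kappa> (cyl v)" for v
    proof (rule antisym)
      show "emeasure (\<mu> k) (cyl v) \<le> emeasure \<kappa> (cyl v)"
      proof (rule ennreal_le_of_exp_le[OF D0])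
        fix R assume R: "length v + 2 \<le> R"
        show "emeasure (\<mu> k) (cyl v) \<le> ennreal (exp (2 * D (R - 1))) * emeasure \<kappa> (cyl v)"
          by (rule emeasure_cyl_le_upwards[OF \<mu>(1) \<kappa>s, where R=R]) (use bounds R in auto)
      qed
      show "emeasure \<kappa> (cyl v) \<le> emeasure (\<mu> k) (cyl v)"
      proof (rule ennreal_le_of_exp_le[OF D0])
        fix R assume R: "length v + 2 \<le> R"
        show "emeasure \<kappa> (cyl v) \<le> ennreal (exp (2 * D (R - 1))) * emeasure (\<mu> k) (cyl v)"
          by (rule emeasure_cyl_le_upwards[OF \<kappa>s \<mu>(1), where R=R]) (use bounds R in auto)
      qed
    qed
    then have "\<mu> k = \<kappa>"
      by (intro measure_eqI_cyl \<mu>(1) \<kappa>s) (use \<mu>(2)[of k "[]"] in auto)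
    then show ?thesis using \<kappa>[OF B] by simp
  qed
  have solution: "solution \<mu>" unfolding solution_def using \<mu>(1) fin AEE eq by blast
  \<comment> \<open>Only cylinder weights are known to converge; as F is finite, \<open>inF\<close>
    is a finite union of cylinders.\<close>
  have inF: "F_frac * measure (\<mu> k) UNIV \<le> measure (\<mu> k) inF" for k
  proof -
    interpret finite_measure "\<mu> k" by (rule fin)
    have U: "inF = (\<Union>f\<in>F. cyl [f])" by (auto simp: cyl_def)
    have "measure (\<mu> k) inF = (\<Sum>f\<in>F. mm k [f])"
      unfolding U mv[symmetric]
      by (rule finite_measure_finite_Union[OF F_finite]) (auto simp: \<mu> disjoint_family_on_def cyl_Cons)
    moreover have "approx n k inF = (\<Sum>f\<in>F. approx n k (cyl [f]))" if "k \<le> n" for n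
      unfolding U using F_finite
    proof (induction F rule: finite_induct)
      case (insert f S)
      have "approx n k (cyl [f] \<union> (\<Union>f\<in>S. cyl [f])) = approx n k (cyl [f]) + approx n k (\<Union>f\<in>S. cyl [f])"
        using insert by (intro approx_Un[OF that]) (auto simp: cyl_def)
      then show ?case using insert by simp
    qed simp
    moreover have "F_frac * mm k [] \<le> (\<Sum>f\<in>F. mm k [f])"
    proof (rule tendsto_le[OF _ tendsto_sum tendsto_mult_left[OF lim]], simp, rule lim)
      show "\<forall>\<^sub>F i in sequentially. F_frac * approx_cyl (q i) k [] \<le> (\<Sum>f\<in>F. approx_cyl (q i) k [f])"
        using evq[of "N + k"]
      proof (rule eventually_mono)
        fix i assume i: "N + k \<le> q i"
        have "F_frac * approx (q i) k UNIV \<le> (\<Sum>f\<in>F. approx (q i) k (cyl [f]))"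
          using approx_dl_le[OF i] calculation(2)[of "q i"] i by simp
        then show "F_frac * approx_cyl (q i) k [] \<le> (\<Sum>f\<in>F. approx_cyl (q i) k [f])"
          using approx_0_pos[of "q i"] i by (simp add: approx_cyl_def sum_divide_distrib[symmetric] divide_right_mono)
      qed
    qed
    ultimately show ?thesis using mv[of k "[]"] by simp
  qed
  have "(\<lambda>i. approx_cyl (q i) 0 []) \<longlonglongrightarrow> 1"
    by (rule tendsto_eventually) (use evq[of N] approx_0_pos in \<open>auto elim!: eventually_mono simp: approx_cyl_def, fastforce\<close>)
  then have "mm 0 [] = 1" using lim LIMSEQ_unique by blast
  then have "normalized \<mu>" unfolding normalized_def using solution inF mv[of 0 "[]"] by simp
  then show thesis using that[OF s] lim by (simp add: mv q_def)
qed

text \<open>A subsequence staying away from the limit would contain a further one converging to the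
  values of a normalized solution, and by \<open>normalized_unique\<close> these are the values it
  stays away from.\<close>

theorem normalized_limit:
  obtains \<mu> where "normalized \<mu>" "\<And>k v. (\<lambda>n. approx_cyl n k v) \<longlonglongrightarrow> measure (\<mu> k) (cyl v)"
proof -
  obtain s0 \<mu> where g: "normalized \<mu>" using normalized_limit_exists[of "\<lambda>i. i"] strict_mono_id by (metis id_def strict_mono_def)
  have "(\<lambda>n. approx_cyl n k v) \<longlonglongrightarrow> measure (\<mu> k) (cyl v)" for k v
  proof (rule ccontr)
    assume "\<not> ?thesis"
    then obtain \<epsilon> where \<epsilon>: "0 < \<epsilon>" "\<And>n0. \<exists>n\<ge>n0. \<epsilon> \<le> dist (approx_cyl n k v) (measure (\<mu> k) (cyl v))"
      unfolding lim_sequentially by (auto simp: not_less)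
    then have "infinite {n. \<epsilon> \<le> dist (approx_cyl n k v) (measure (\<mu> k) (cyl v))}"
      unfolding infinite_nat_iff_unbounded_le by blast
    then obtain r where r: "strict_mono r" "\<And>i::nat. \<epsilon> \<le> dist (approx_cyl (r i) k v) (measure (\<mu> k) (cyl v))"
      using infinite_enumerate by blast
    obtain s \<mu>' where s: "normalized \<mu>'" "(\<lambda>i. approx_cyl (r (s i)) k v) \<longlonglongrightarrow> measure (\<mu>' k) (cyl v)"
      using normalized_limit_exists[OF r(1)] by metis
    then have "(\<lambda>i. approx_cyl (r (s i)) k v) \<longlonglongrightarrow> measure (\<mu> k) (cyl v)" using normalized_unique[OF g s(1), of k] by simp
    then obtain i where "dist (approx_cyl (r (s i)) k v) (measure (\<mu> k) (cyl v)) < \<epsilon>"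
      using \<epsilon>(1) unfolding lim_sequentially by blast
    then show False using r(2)[of "s i"] by simp
  qed
  with g that show thesis by blast
qed

end

section \<open>Lower bounds along paths\<close>

text \<open>The constants of the almost sure hypotheses are fixed once for all points: successor
  sets \<open>Sr\<close>, bounds \<open>cl\<close> and \<open>cu\<close> for exp \<phi> by first
  letter, the Hoelder bound V and the tails H. The conditions themselves hold only almost surely and
  are collected in \<open>regular_pt\<close>.\<close>

locale random_shift =
  fixes M :: "'a measure" and \<theta> :: "'a \<Rightarrow> 'a" and A :: "'a \<Rightarrow> nat \<Rightarrow> nat \<Rightarrow> bool"
    and \<phi> :: "'a \<Rightarrow> (nat \<Rightarrow> nat) \<Rightarrow> real"
    and Sr :: "nat \<Rightarrow> nat set" and cl cu :: "nat \<Rightarrow> real" and V \<alpha> :: real and H :: "nat \<Rightarrow> ennreal"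
  assumes theta_measurable [measurable]: "\<theta> \<in> M \<rightarrow>\<^sub>M M"
    and A_measurable [measurable]: "\<And>i j. (\<lambda>x. A x i j) \<in> M \<rightarrow>\<^sub>M count_space UNIV"
    and mixing: "\<And>a b. \<exists>n0. \<forall>n\<ge>n0. \<forall>x\<in>space M. \<exists>u. u 0 = a \<and> u n = b \<and>
        (\<forall>i<n. A ((\<theta> ^^ i) x) (u i) (u (Suc i)))"
    and phi_joint: "(\<lambda>q. \<phi> (fst q) (snd q)) \<in> borel_measurable (OmegaM M \<theta> A)"
    and Sr_finite: "\<And>e. finite (Sr e)" and cl_pos: "\<And>e. 0 < cl e"
    and V_nonneg: "0 \<le> V" and alpha_pos: "0 < \<alpha>" and H_tendsto: "H \<longlonglongrightarrow> 0"
begin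

definition regular_pt :: "'a \<Rightarrow> bool" where
  "regular_pt x \<longleftrightarrow> (\<forall>e j. A x e j \<longrightarrow> j \<in> Sr e) \<and> holder_var \<theta> A \<alpha> x (\<phi> x) \<le> ereal V \<and>
     (\<forall>\<omega>\<in>Einf \<theta> A x. cl (\<omega> 0) \<le> exp (\<phi> x \<omega>) \<and> exp (\<phi> x \<omega>) \<le> cu (\<omega> 0)) \<and>
     (\<forall>l. \<forall>\<omega>\<in>Einf \<theta> A (\<theta> x). transfer A \<phi> x (indicator (Einf \<theta> A x - {\<tau>. \<tau> 0 \<le> l})) \<omega> \<le> H l)"

text \<open>Regularity is demanded along the whole forward orbit, so that \<theta> maps good points
  to good points and the construction applies at \<theta> x as well.\<close>

definition good_pt :: "'a \<Rightarrow> bool" where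
  "good_pt x \<longleftrightarrow> x \<in> space M \<and> (\<forall>k. regular_pt ((\<theta> ^^ k) x))"

lemma funpow_measurable [measurable]: "(\<theta> ^^ k) \<in> M \<rightarrow>\<^sub>M M"
  by (induction k) (auto simp: o_def)

lemma good_pt_funpow: "good_pt x \<Longrightarrow> good_pt ((\<theta> ^^ k) x)"
  unfolding good_pt_def
  using measurable_space[OF funpow_measurable] by (metis funpow_add comp_apply)

lemma good_pt_regular: "good_pt x \<Longrightarrow> regular_pt x"
  unfolding good_pt_def by (auto dest: spec[of _ 0])

section \<open>Letters and weights along paths from a fixed letter\<close>

primrec reach :: "nat \<Rightarrow> nat \<Rightarrow> nat set" where
  "reach a 0 = {a}"
| "reach a (Suc i) = (\<Union>e\<in>reach a i. Sr e)"

text \<open>These sets do not depend on the point x, so weights minimized over them are bounds for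
  all good orbits at once.\<close>

lemma reach_finite: "finite (reach a i)"
  by (induction i) (auto simp: Sr_finite)

text \<open>Adjoining 1 keeps the minimum defined and at most 1, so products of these weights stay
  in (0, 1].\<close>

definition weight_min :: "nat \<Rightarrow> nat \<Rightarrow> real" where
  "weight_min a i = Min (insert 1 (cl ` reach a i))"

lemma weight_min: "0 < weight_min a i" "weight_min a i \<le> 1" "e \<in> reach a i \<Longrightarrow> weight_min a i \<le> cl e"
  unfolding weight_min_def using reach_finite[of a i] cl_pos by (auto simp: Min_gr_iff)

definition path_weight :: "nat \<Rightarrow> nat \<Rightarrow> real" where
  "path_weight a n = (\<Prod>i<n. weight_min a i)"

lemma path_weight: "0 < path_weight a n" "path_weight a n \<le> 1"
  unfolding path_weight_def using weight_min less_imp_le[OF weight_min(1)] by (auto intro!: prod_pos prod_le_1)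

text \<open>A single path contributes one term to the sum that makes up the iterate. Its i-th letter
  lies in \<open>reach a i\<close>, whence the factor \<open>weight_min a i\<close>.\<close>

lemma path_lower_bound:
  assumes x: "good_pt x" and u: "u 0 = a" "\<And>i. i < n \<Longrightarrow> A ((\<theta> ^^ i) x) (u i) (u (Suc i))"
    and \<omega>: "\<omega> \<in> Einf \<theta> A ((\<theta> ^^ n) x)" "\<omega> 0 = u n"
  shows "ennreal (path_weight a n) \<le> tpow \<theta> A \<phi> x n (indicator {\<tau>. \<tau> 0 = a}) \<omega>"
proof -
  have r: "u i \<in> reach a i" if "i \<le> n" for i
    using that
  proof (induction i)
    case (Suc i)
    have "regular_pt ((\<theta> ^^ i) x)" using x by (simp add: good_pt_def)
    then have "u (Suc i) \<in> Sr (u i)" using u(2)[of i] Suc.prems by (auto simp: regular_pt_def)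
    then show ?case using Suc by auto
  qed (use u in auto)
  have "ennreal (path_weight a m) \<le> tpow \<theta> A \<phi> x m (indicator {\<tau>. \<tau> 0 = a}) \<omega>"
    if "m \<le> n" "\<omega> \<in> Einf \<theta> A ((\<theta> ^^ m) x)" "\<omega> 0 = u m" for m \<omega>
    using that
  proof (induction m arbitrary: \<omega>)
    case 0
    then show ?case using u by (simp add: path_weight_def)
  next
    case (Suc m)
    let ?t = "tpow \<theta> A \<phi> x m (indicator {\<tau>. \<tau> 0 = a})" and ?x = "(\<theta> ^^ m) x"
    let ?g = "\<lambda>e. if A ?x e (\<omega> 0) then ?t (case_nat e \<omega>) * ennreal (exp (\<phi> ?x (case_nat e \<omega>))) else 0"
    have a: "A ?x (u m) (\<omega> 0)" using u(2)[of m] Suc.prems by simp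
    have c: "case_nat (u m) \<omega> \<in> Einf \<theta> A ?x" using Suc.prems a by (intro case_nat_in_Einf) auto
    have reg: "regular_pt ?x" using x by (simp add: good_pt_def)
    have "ennreal (path_weight a (Suc m)) = ennreal (path_weight a m) * ennreal (weight_min a m)"
      using path_weight[of a m] weight_min[of a m] by (simp add: path_weight_def ennreal_mult prod_nonneg less_imp_le)
    also have "\<dots> \<le> ?t (case_nat (u m) \<omega>) * ennreal (exp (\<phi> ?x (case_nat (u m) \<omega>)))"
    proof (rule mult_mono)
      show "ennreal (path_weight a m) \<le> ?t (case_nat (u m) \<omega>)" using Suc c by simp
      have "weight_min a m \<le> cl (u m)" using r[of m] Suc.prems by (intro weight_min) auto
      also have "\<dots> \<le> exp (\<phi> ?x (case_nat (u m) \<omega>))" using reg c by (force simp: regular_pt_def)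
      finally show "ennreal (weight_min a m) \<le> ennreal (exp (\<phi> ?x (case_nat (u m) \<omega>)))" by (rule ennreal_leI)
    qed auto
    also have "\<dots> = ?g (u m)" using a by simp
    also have "\<dots> \<le> (\<Sum>e. ?g e)" using sum_le_suminf[of ?g "{u m}"] by simp
    also have "\<dots> = tpow \<theta> A \<phi> x (Suc m) (indicator {\<tau>. \<tau> 0 = a}) \<omega>" by (simp add: transfer_def)
    finally show ?case .
  qed
  then show ?thesis using \<omega> by simp
qed

lemma access_bound:
  obtains n0 where "\<And>n x \<omega>. \<lbrakk>n0 \<le> n; good_pt x; \<omega> \<in> Einf \<theta> A ((\<theta> ^^ n) x); \<omega> 0 = b\<rbrakk>
     \<Longrightarrow> ennreal (path_weight a n) \<le> tpow \<theta> A \<phi> x n (indicator {\<tau>. \<tau> 0 = a}) \<omega>"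
proof -
  obtain n0 where n0: "\<And>n x. n0 \<le> n \<Longrightarrow> x \<in> space M \<Longrightarrow> \<exists>u. u 0 = a \<and> u n = b \<and>
        (\<forall>i<n. A ((\<theta> ^^ i) x) (u i) (u (Suc i)))" using mixing[of a b] by blast
  show thesis
  proof (rule that[of n0])
    fix n x \<omega> assume *: "n0 \<le> n" "good_pt x" "\<omega> \<in> Einf \<theta> A ((\<theta> ^^ n) x)" "\<omega> 0 = b"
    then obtain u where u: "u 0 = a" "u n = b" "\<forall>i<n. A ((\<theta> ^^ i) x) (u i) (u (Suc i))"
      using n0[of n x] by (auto simp: good_pt_def)
    show "ennreal (path_weight a n) \<le> tpow \<theta> A \<phi> x n (indicator {\<tau>. \<tau> 0 = a}) \<omega>"
      by (rule path_lower_bound[of x u]) (use * u in auto)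
  qed
qed

text \<open>Paths are concatenated at the letter b, and their weights multiply: r belongs to the
  first piece, s to the second.\<close>

lemma tpow_compose_bound:
  assumes "\<And>\<tau>. \<tau> \<in> Einf \<theta> A ((\<theta> ^^ m) x) \<Longrightarrow> \<tau> 0 = b \<Longrightarrow> ennreal r \<le> tpow \<theta> A \<phi> x m u \<tau>"
    and "\<omega> \<in> Einf \<theta> A ((\<theta> ^^ (m + n)) x)"
    and "ennreal s \<le> tpow \<theta> A \<phi> ((\<theta> ^^ m) x) n (indicator {\<tau>. \<tau> 0 = b}) \<omega>" and rs: "0 \<le> r" "0 \<le> s"
  shows "ennreal (r * s) \<le> tpow \<theta> A \<phi> x (m + n) u \<omega>"
proof -
  have "ennreal (r * s) \<le> ennreal r * tpow \<theta> A \<phi> ((\<theta> ^^ m) x) n (indicator {\<tau>. \<tau> 0 = b}) \<omega>"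
    unfolding ennreal_mult[OF rs] by (rule mult_left_mono[OF assms(3)]) simp
  also have "\<dots> = tpow \<theta> A \<phi> ((\<theta> ^^ m) x) n (\<lambda>\<tau>. ennreal r * indicator {\<tau>. \<tau> 0 = b} \<tau>) \<omega>"
    by (simp add: tpow_cmult)
  also have "\<dots> \<le> tpow \<theta> A \<phi> ((\<theta> ^^ m) x) n (tpow \<theta> A \<phi> x m u) \<omega>"
  proof (rule tpow_mono_Einf)
    show "\<omega> \<in> Einf \<theta> A ((\<theta> ^^ n) ((\<theta> ^^ m) x))"
      using assms(2) by (simp add: add.commute[of m] funpow_add)
  qed (use assms(1) in \<open>auto simp: indicator_def\<close>)
  finally show ?thesis by (simp add: tpow_add)
qed

text \<open>The growth rate c comes from loops at the letter 0, so it does not depend on l. This is what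
  allows one to choose l afterwards with an arbitrarily small tail H l.\<close>

lemma uniform_access:
  obtains c where "0 < c" "c \<le> 1"
    "\<And>l. \<exists>w>0. \<exists>N. \<forall>m\<ge>N. \<forall>a\<le>l. \<forall>x \<omega>. good_pt x \<longrightarrow> \<omega> \<in> Einf \<theta> A ((\<theta> ^^ m) x) \<longrightarrow> \<omega> 0 \<le> l \<longrightarrow>
       ennreal (w * c ^ m) \<le> tpow \<theta> A \<phi> x m (indicator {\<tau>. \<tau> 0 = a}) \<omega>"
proof -
  define T where "T a n x = tpow \<theta> A \<phi> x n (indicator {\<tau>. \<tau> 0 = a})" for a n x
  have "\<forall>a b. \<exists>n0. \<forall>n\<ge>n0. \<forall>x \<omega>. good_pt x \<longrightarrow> \<omega> \<in> Einf \<theta> A ((\<theta> ^^ n) x) \<longrightarrow> \<omega> 0 = b \<longrightarrow> ennreal (path_weight a n) \<le> T a n x \<omega>"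
    unfolding T_def by (metis access_bound)
  then obtain n0 where n0: "\<And>a b n x \<omega>. \<lbrakk>n0 a b \<le> n; good_pt x; \<omega> \<in> Einf \<theta> A ((\<theta> ^^ n) x); \<omega> 0 = b\<rbrakk>
     \<Longrightarrow> ennreal (path_weight a n) \<le> T a n x \<omega>" by metis
  \<comment> \<open>The length of a loop at 0: long enough for \<open>access_bound\<close>, and
    positive so that the root and the division by p below make sense.\<close>
  define p where "p = Suc (n0 0 0)"
  define q where "q = path_weight 0 p"
  have q: "0 < q" "q \<le> 1" using path_weight by (auto simp: q_def)
  \<comment> \<open>A loop of p steps has weight at least q, so c is the weight guaranteed per
    step.\<close>
  define c where "c = root p q"
  have c: "0 < c" "c \<le> 1" "c ^ p = q" using q by (auto simp: c_def p_def real_root_pow_pos simp del: power_Suc)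
  have loop: "ennreal (q ^ s) \<le> T 0 (s * p) x \<omega>"
    if "good_pt x" "\<omega> \<in> Einf \<theta> A ((\<theta> ^^ (s * p)) x)" "\<omega> 0 = 0" for s x \<omega>
    using that
  proof (induction s arbitrary: \<omega>)
    case 0
    then show ?case by (simp add: T_def)
  next
    case (Suc s)
    have "ennreal (q ^ s * q) \<le> T 0 (s * p + p) x \<omega>"
      unfolding T_def
    proof (rule tpow_compose_bound[where b=0])
      have "ennreal (path_weight 0 p) \<le> T 0 p ((\<theta> ^^ (s * p)) x) \<omega>"
      proof (rule n0[of 0 0])
        show "\<omega> \<in> Einf \<theta> A ((\<theta> ^^ p) ((\<theta> ^^ (s * p)) x))" using Suc.prems by (simp add: funpow_add)
      qed (use Suc.prems good_pt_funpow in \<open>auto simp: p_def\<close>)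
      then show "ennreal q \<le> tpow \<theta> A \<phi> ((\<theta> ^^ (s * p)) x) p (indicator {\<tau>. \<tau> 0 = 0}) \<omega>"
        by (simp add: q_def T_def)
    qed (use Suc q in \<open>auto simp: T_def[symmetric] add.commute\<close>)
    then show ?case by (simp add: mult.commute add.commute)
  qed
  have "\<exists>w>0. \<exists>N. \<forall>m\<ge>N. \<forall>a\<le>l. \<forall>x \<omega>. good_pt x \<longrightarrow> \<omega> \<in> Einf \<theta> A ((\<theta> ^^ m) x) \<longrightarrow> \<omega> 0 \<le> l \<longrightarrow>
       ennreal (w * c ^ m) \<le> T a m x \<omega>" for l
  proof -
    \<comment> \<open>A time large enough for passing from any letter up to l to 0 and from 0 to any
      such letter; the sum is a convenient upper bound.\<close>
    define K where "K = (\<Sum>a\<le>l. n0 a 0 + n0 0 a)"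
    have K: "n0 a 0 \<le> K" "n0 0 a \<le> K" if "a \<le> l" for a
      using member_le_sum[of a "{..l}" "\<lambda>a. n0 a 0 + n0 0 a"] that by (auto simp: K_def)
    define W where "W = (\<lambda>(a, r). path_weight a K * path_weight 0 (K + r)) ` ({..l} \<times> {..<p})"
    define w where "w = Min W"
    have W: "finite W" "W \<noteq> {}" by (auto simp: W_def p_def)
    have w: "0 < w" using W path_weight(1) by (auto simp: w_def Min_gr_iff) (auto simp: W_def)
    have "ennreal (w * c ^ m) \<le> T a m x \<omega>"
      if m: "2 * K \<le> m" "a \<le> l" and x: "good_pt x" "\<omega> \<in> Einf \<theta> A ((\<theta> ^^ m) x)" "\<omega> 0 \<le> l" for m a x \<omega>
    proof -
      define s where "s = (m - 2 * K) div p"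
      define r where "r = (m - 2 * K) mod p"
      have r: "r < p" by (simp add: r_def p_def)
      \<comment> \<open>The path takes K steps from a to 0, then s loops, then K + r steps to the
        first letter of \<open>\<omega>\<close>. The last piece absorbs the remainder r < p, so
        \<open>W\<close> contains only finitely many weights.\<close>
      have meq: "m = (K + s * p) + (K + r)" using m by (simp add: s_def r_def)
      have "ennreal (path_weight a K * q ^ s * path_weight 0 (K + r)) \<le> T a ((K + s * p) + (K + r)) x \<omega>"
        unfolding T_def
      proof (rule tpow_compose_bound[where b=0])
        fix \<tau> assume \<tau>: "\<tau> \<in> Einf \<theta> A ((\<theta> ^^ (K + s * p)) x)" "\<tau> 0 = 0"
        show "ennreal (path_weight a K * q ^ s) \<le> tpow \<theta> A \<phi> x (K + s * p) (indicator {\<tau>. \<tau> 0 = a}) \<tau>"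
        proof (rule tpow_compose_bound[where b=0])
          fix \<tau>' assume "\<tau>' \<in> Einf \<theta> A ((\<theta> ^^ K) x)" "\<tau>' 0 = 0"
          then show "ennreal (path_weight a K) \<le> tpow \<theta> A \<phi> x K (indicator {\<tau>. \<tau> 0 = a}) \<tau>'"
            using n0[of a 0 K x \<tau>'] K m x by (simp add: T_def)
        next
          show "ennreal (q ^ s) \<le> tpow \<theta> A \<phi> ((\<theta> ^^ K) x) (s * p) (indicator {\<tau>. \<tau> 0 = 0}) \<tau>"
            using loop[of "(\<theta> ^^ K) x" \<tau> s] \<tau> good_pt_funpow[OF x(1)]
            by (simp add: T_def funpow_add add.commute[of K])
        qed (use \<tau> q path_weight in \<open>auto simp: less_imp_le\<close>)
      next
        show "ennreal (path_weight 0 (K + r)) \<le> tpow \<theta> A \<phi> ((\<theta> ^^ (K + s * p)) x) (K + r) (indicator {\<tau>. \<tau> 0 = 0}) \<omega>"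
          unfolding T_def[symmetric]
        proof (rule n0[of 0 "\<omega> 0"])
          show "\<omega> \<in> Einf \<theta> A ((\<theta> ^^ (K + r)) ((\<theta> ^^ (K + s * p)) x))"
            using x(2) unfolding meq by (metis add.commute comp_apply funpow_add)
        qed (use K[of "\<omega> 0"] x good_pt_funpow in auto)
        show "\<omega> \<in> Einf \<theta> A ((\<theta> ^^ (K + s * p + (K + r))) x)" using x(2) meq by simp
      qed (use q path_weight in \<open>auto simp: less_imp_le\<close>)
      moreover have "w * c ^ m \<le> path_weight a K * q ^ s * path_weight 0 (K + r)"
      proof -
        have "w \<le> path_weight a K * path_weight 0 (K + r)"
          unfolding w_def by (rule Min_le[OF W(1)]) (use m r in \<open>auto simp: W_def\<close>)
        moreover have "c ^ m \<le> c ^ (p * s)" using c meq by (intro power_decreasing) (auto simp: mult.commute)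
        moreover have "c ^ (p * s) = q ^ s" using c by (simp add: power_mult)
        ultimately have "w * c ^ m \<le> (path_weight a K * path_weight 0 (K + r)) * q ^ s"
          using w c path_weight by (intro mult_mono) (auto simp: less_imp_le)
        then show ?thesis by (simp add: mult_ac)
      qed
      ultimately show ?thesis using meq ennreal_leI order_trans by metis
    qed
    then show ?thesis using w by blast
  qed
  then show thesis using that c by (simp add: T_def)
qed

end

section \<open>Reduction of the random shift to its orbits\<close>

context random_shift begin

text \<open>Outside \<open>Omega\<close> the potential need not be measurable, hence the indicator; subtracting \<open>ln c\<close>
  normalizes the growth rate.\<close>

definition phi0 :: "real \<Rightarrow> 'a \<Rightarrow> (nat \<Rightarrow> nat) \<Rightarrow> real" where
  "phi0 c x \<omega> = indicator (Einf \<theta> A x) \<omega> * \<phi> x \<omega> - ln c"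

lemma transfer_phi0:
  assumes c: "0 < c" and \<omega>: "\<omega> \<in> Einf \<theta> A (\<theta> x)"
  shows "transfer A (phi0 c) x u \<omega> = ennreal (1 / c) * transfer A \<phi> x u \<omega>"
proof -
  have "u (case_nat e \<omega>) * ennreal (exp (phi0 c x (case_nat e \<omega>)))
      = ennreal (1 / c) * u (case_nat e \<omega>) * ennreal (exp (\<phi> x (case_nat e \<omega>)))" if "A x e (\<omega> 0)" for e
  proof -
    have "exp (phi0 c x (case_nat e \<omega>)) = 1 / c * exp (\<phi> x (case_nat e \<omega>))"
      using case_nat_in_Einf[OF \<omega> that] c by (simp add: phi0_def exp_diff)
    then have "ennreal (exp (phi0 c x (case_nat e \<omega>))) = ennreal (1 / c) * ennreal (exp (\<phi> x (case_nat e \<omega>)))"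
      using c by (subst ennreal_mult[symmetric]) auto
    then show ?thesis by (simp add: ac_simps)
  qed
  then have "transfer A (phi0 c) x u \<omega> = transfer A \<phi> x (\<lambda>\<tau>. ennreal (1 / c) * u \<tau>) \<omega>"
    unfolding transfer_def by (intro arg_cong[where f=suminf]) (auto simp: fun_eq_iff)
  then show ?thesis by (simp add: transfer_cmult)
qed

lemma tpow_phi0:
  assumes c: "0 < c" and \<omega>: "\<omega> \<in> Einf \<theta> A ((\<theta> ^^ n) x)"
  shows "tpow \<theta> A (phi0 c) x n u \<omega> = ennreal ((1 / c) ^ n) * tpow \<theta> A \<phi> x n u \<omega>"
  using \<omega>
proof (induction n arbitrary: \<omega>)
  case (Suc n)
  have \<omega>: "\<omega> \<in> Einf \<theta> A (\<theta> ((\<theta> ^^ n) x))" using Suc.prems by simp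
  have "tpow \<theta> A (phi0 c) x (Suc n) u \<omega> = ennreal (1 / c) * transfer A \<phi> ((\<theta> ^^ n) x) (tpow \<theta> A (phi0 c) x n u) \<omega>"
    using transfer_phi0[OF c \<omega>] by simp
  also have "transfer A \<phi> ((\<theta> ^^ n) x) (tpow \<theta> A (phi0 c) x n u) \<omega>
      = transfer A \<phi> ((\<theta> ^^ n) x) (\<lambda>\<tau>. ennreal ((1 / c) ^ n) * tpow \<theta> A \<phi> x n u \<tau>) \<omega>"
    by (intro antisym transfer_mono_Einf[OF \<omega>]) (simp_all add: Suc.IH)
  finally show ?case
    using c by (simp add: transfer_cmult mult.assoc[symmetric] ennreal_mult[symmetric])
qed simp

text \<open>This and the next two lemmas are a dictionary: \<open>Suc\<close> acting on the indices
  of the sequence k \<mapsto> \<theta>^k x corresponds to \<theta> acting on the points.\<close>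

lemma Einf_seq: "Einf Suc (\<lambda>k. A ((\<theta> ^^ k) x)) k = Einf \<theta> A ((\<theta> ^^ k) x)"
  by (simp add: Einf_def Suc_funpow funpow_add)

lemma transfer_seq: "transfer (\<lambda>k. A ((\<theta> ^^ k) x)) (\<lambda>k. f ((\<theta> ^^ k) x)) k = transfer A f ((\<theta> ^^ k) x)"
  by (simp add: transfer_def fun_eq_iff)

lemma tpow_seq:
  "tpow Suc (\<lambda>k. A ((\<theta> ^^ k) x)) (\<lambda>k. f ((\<theta> ^^ k) x)) k m u = tpow \<theta> A f ((\<theta> ^^ k) x) m u"
  by (induction m) (simp_all add: transfer_seq Suc_funpow funpow_add)

text \<open>Taking the least admissible letter is a canonical choice, hence measurable in x. The
  start in 0 puts the sequence into every set F of the form \<open>{..l}\<close>.\<close>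

primrec base_point :: "'a \<Rightarrow> nat \<Rightarrow> nat" where
  "base_point x 0 = 0"
| "base_point x (Suc i) = (LEAST j. A ((\<theta> ^^ i) x) (base_point x i) j)"

text \<open>By mixing every letter is joined to 0 by some path at every point of the space, so it
  has a successor there.\<close>

lemma base_point_in_Einf: "x \<in> space M \<Longrightarrow> base_point x \<in> Einf \<theta> A x"
  unfolding mem_Einf_iff
proof
  fix i assume x: "x \<in> space M"
  obtain n0 where n0: "\<And>n y. n0 \<le> n \<Longrightarrow> y \<in> space M \<Longrightarrow> \<exists>u. u 0 = base_point x i \<and> u n = 0 \<and>
      (\<forall>i<n. A ((\<theta> ^^ i) y) (u i) (u (Suc i)))" using mixing[of "base_point x i" 0] by blast
  have "(\<theta> ^^ i) x \<in> space M" using x measurable_space[OF funpow_measurable] by blast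
  then obtain u where "u 0 = base_point x i" "A ((\<theta> ^^ 0) ((\<theta> ^^ i) x)) (u 0) (u (Suc 0))"
    using n0[of "Suc n0" "(\<theta> ^^ i) x"] by auto
  then have "A ((\<theta> ^^ i) x) (base_point x i) (u (Suc 0))" by simp
  then show "A ((\<theta> ^^ i) x) (base_point x i) (base_point x (Suc i))" by (simp add: LeastI[of "A ((\<theta> ^^ i) x) (base_point x i)"])
qed

lemma Omega_sets [measurable]: "Omega \<theta> A \<inter> space (M \<Otimes>\<^sub>M borel) \<in> sets (M \<Otimes>\<^sub>M borel)"
proof -
  have [measurable]: "Measurable.pred (M \<Otimes>\<^sub>M (borel :: (nat \<Rightarrow> nat) measure)) (\<lambda>q. A ((\<theta> ^^ i) (fst q)) (snd q i) (snd q j))" for i j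
  proof -
    have a: "Measurable.pred (M \<Otimes>\<^sub>M (borel :: (nat \<Rightarrow> nat) measure)) (\<lambda>q. A ((\<theta> ^^ i) (fst q)) a b)" for a b
    proof -
      have "(\<lambda>q. (\<theta> ^^ i) (fst q)) \<in> M \<Otimes>\<^sub>M (borel :: (nat \<Rightarrow> nat) measure) \<rightarrow>\<^sub>M M" by measurable
      from measurable_compose[OF this A_measurable] show ?thesis by simp
    qed
    have s: "(\<lambda>q. snd q k) \<in> M \<Otimes>\<^sub>M (borel :: (nat \<Rightarrow> nat) measure) \<rightarrow>\<^sub>M count_space UNIV" for k
      by measurable
    have b: "Measurable.pred (M \<Otimes>\<^sub>M (borel :: (nat \<Rightarrow> nat) measure)) (\<lambda>q. A ((\<theta> ^^ i) (fst q)) a (snd q j))" for a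
      by (rule measurable_compose_countable[OF a s])
    show ?thesis by (rule measurable_compose_countable[OF b s])
  qed
  have "{q \<in> space (M \<Otimes>\<^sub>M (borel :: (nat \<Rightarrow> nat) measure)). \<forall>i. A ((\<theta> ^^ i) (fst q)) (snd q i) (snd q (Suc i))} \<in> sets (M \<Otimes>\<^sub>M borel)"
    by measurable
  also have "{q \<in> space (M \<Otimes>\<^sub>M (borel :: (nat \<Rightarrow> nat) measure)). \<forall>i. A ((\<theta> ^^ i) (fst q)) (snd q i) (snd q (Suc i))}
     = Omega \<theta> A \<inter> space (M \<Otimes>\<^sub>M borel)" by (auto simp: Omega_def Einf_def)
  finally show ?thesis .
qed

lemma phi0_joint: "(\<lambda>q. phi0 c (fst q) (snd q)) \<in> borel_measurable (M \<Otimes>\<^sub>M borel)"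
proof -
  have "(\<lambda>q. indicator (Omega \<theta> A) q *\<^sub>R \<phi> (fst q) (snd q)) \<in> borel_measurable (M \<Otimes>\<^sub>M borel)"
    using phi_joint Omega_sets unfolding OmegaM_def by (subst borel_measurable_restrict_space_iff[symmetric]) auto
  moreover have "indicator (Omega \<theta> A) q = (indicator (Einf \<theta> A (fst q)) (snd q) :: real)" for q
    by (cases q) (auto simp: Omega_def indicator_def)
  ultimately show ?thesis unfolding phi0_def by simp
qed

lemma phi0_measurable: "x \<in> space M \<Longrightarrow> phi0 c x \<in> borel_measurable borel"
  using measurable_compose[OF measurable_Pair1'[where x=x and ?M1.0=M and ?M2.0=borel] phi0_joint[of c]] by simp

text \<open>Agreement in the letters 0, ..., r means distance at most exp (-(r + 1)), and the
  Hoelder bound applies. The resulting geometric sequence is used as D.\<close>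

lemma regular_distortion:
  assumes "regular_pt x" "\<tau> \<in> Einf \<theta> A x" "\<omega> \<in> Einf \<theta> A x" "\<forall>i\<le>r. \<tau> i = \<omega> i"
  shows "\<phi> x \<tau> \<le> \<phi> x \<omega> + V * exp (- \<alpha>) ^ Suc r"
proof (cases "\<tau> = \<omega>")
  case True
  then show ?thesis using V_nonneg by simp
next
  case False
  define n where "n = (LEAST n. \<tau> n \<noteq> \<omega> n)"
  have "\<exists>n. \<tau> n \<noteq> \<omega> n" using False by auto
  then have "\<tau> n \<noteq> \<omega> n" unfolding n_def by (rule LeastI_ex)
  then have n: "Suc r \<le> n" using assms(4) by (metis not_less_eq_eq)
  have "ereal (\<bar>\<phi> x \<tau> - \<phi> x \<omega>\<bar> / (seq_dist \<tau> \<omega> powr \<alpha>)) \<le> holder_var \<theta> A \<alpha> x (\<phi> x)"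
    unfolding holder_var_def using assms False by (intro SUP_upper2[of "(\<tau>, \<omega>)"]) auto
  also have "\<dots> \<le> ereal V" using assms(1) by (simp add: regular_pt_def)
  finally have "\<bar>\<phi> x \<tau> - \<phi> x \<omega>\<bar> / (seq_dist \<tau> \<omega> powr \<alpha>) \<le> V" by simp
  moreover have "seq_dist \<tau> \<omega> powr \<alpha> = exp (- \<alpha>) ^ n"
    using False by (simp add: seq_dist_def n_def[symmetric] powr_def exp_of_nat_mult[symmetric] mult.commute)
  ultimately have "\<bar>\<phi> x \<tau> - \<phi> x \<omega>\<bar> \<le> V * exp (- \<alpha>) ^ n" by (simp add: divide_simps)
  also have "\<dots> \<le> V * exp (- \<alpha>) ^ Suc r"
    using n alpha_pos V_nonneg by (intro mult_left_mono power_decreasing) auto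
  finally show ?thesis by simp
qed

lemma good_pt_transfer_tail:
  assumes "good_pt x" "\<omega> \<in> Einf \<theta> A (\<theta> x)"
  shows "transfer A \<phi> x (indicator {\<tau>. l < \<tau> 0}) \<omega> \<le> H l"
proof -
  have "transfer A \<phi> x (indicator {\<tau>. l < \<tau> 0}) \<omega> \<le> transfer A \<phi> x (indicator (Einf \<theta> A x - {\<tau>. \<tau> 0 \<le> l})) \<omega>"
    by (rule transfer_mono_Einf[OF assms(2)]) (auto simp: indicator_def)
  also have "\<dots> \<le> H l" using good_pt_regular[OF assms(1)] assms(2) by (simp add: regular_pt_def)
  finally show ?thesis .
qed

text \<open>Letters up to l contribute finitely many bounded terms, all others together the tail H
  l.\<close>

lemma good_pt_transfer_one:
  assumes "good_pt x" "\<omega> \<in> Einf \<theta> A (\<theta> x)"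
  shows "transfer A \<phi> x (\<lambda>_. 1) \<omega> \<le> (\<Sum>e\<le>l. ennreal (cu e)) + H l"
proof -
  have "transfer A \<phi> x (\<lambda>_. 1) \<omega> = transfer A \<phi> x (\<lambda>\<tau>. indicator {\<tau>. \<tau> 0 \<le> l} \<tau> + indicator {\<tau>. l < \<tau> 0} \<tau>) \<omega>"
    by (rule arg_cong[where f="\<lambda>u. transfer A \<phi> x u \<omega>"]) (auto simp: indicator_def fun_eq_iff)
  also have "\<dots> = transfer A \<phi> x (indicator {\<tau>. \<tau> 0 \<le> l}) \<omega> + transfer A \<phi> x (indicator {\<tau>. l < \<tau> 0}) \<omega>"
    by (rule transfer_add)
  also have "\<dots> \<le> (\<Sum>e\<le>l. ennreal (cu e)) + H l"
  proof (rule add_mono)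
    have "transfer A \<phi> x (indicator {\<tau>. \<tau> 0 \<le> l}) \<omega> =
      (\<Sum>e\<le>l. if A x e (\<omega> 0) then indicator {\<tau>. \<tau> 0 \<le> l} (case_nat e \<omega>) * ennreal (exp (\<phi> x (case_nat e \<omega>))) else 0)"
      unfolding transfer_def by (rule suminf_finite) auto
    also have "\<dots> \<le> (\<Sum>e\<le>l. ennreal (cu e))"
    proof (rule sum_mono)
      fix e assume "e \<in> {..l}"
      have "exp (\<phi> x (case_nat e \<omega>)) \<le> cu e" if "A x e (\<omega> 0)"
        using good_pt_regular[OF assms(1)] case_nat_in_Einf[OF assms(2) that] by (force simp: regular_pt_def)
      then show "(if A x e (\<omega> 0) then indicator {\<tau>. \<tau> 0 \<le> l} (case_nat e \<omega>) * ennreal (exp (\<phi> x (case_nat e \<omega>))) else 0)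
          \<le> ennreal (cu e)" by (auto simp: indicator_def intro: ennreal_leI)
    qed
    finally show "transfer A \<phi> x (indicator {\<tau>. \<tau> 0 \<le> l}) \<omega> \<le> (\<Sum>e\<le>l. ennreal (cu e))" .
  qed (rule good_pt_transfer_tail[OF assms])
  finally show ?thesis .
qed

text \<open>All constants are independent of x, so that bounds obtained on one orbit hold for every
  good point; w and N are chosen only after l, on which they depend.\<close>

lemma weighted_shift_params:
  obtains c C w \<eta> N l where "0 < c"
    "\<And>x. good_pt x \<Longrightarrow> weighted_shift (\<lambda>k. A ((\<theta> ^^ k) x)) (\<lambda>k. phi0 c ((\<theta> ^^ k) x))
       (\<lambda>r. V * exp (- \<alpha>) ^ Suc r) \<eta> C w N {..l} (\<lambda>k. base_point ((\<theta> ^^ k) x))"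
proof -
  obtain c where c: "0 < c" "c \<le> 1" and acc: "\<And>l. \<exists>w>0. \<exists>N. \<forall>m\<ge>N. \<forall>a\<le>l. \<forall>x \<omega>. good_pt x \<longrightarrow> \<omega> \<in> Einf \<theta> A ((\<theta> ^^ m) x) \<longrightarrow> \<omega> 0 \<le> l \<longrightarrow>
       ennreal (w * c ^ m) \<le> tpow \<theta> A \<phi> x m (indicator {\<tau>. \<tau> 0 = a}) \<omega>"
    using uniform_access by blast
  have "\<forall>\<^sub>F l in sequentially. H l < ennreal (c / 4)"
    using H_tendsto c by (intro order_tendstoD(2)) auto
  then obtain l where l: "H l < ennreal (c / 4)" by (auto simp: eventually_sequentially)
  obtain w N where w: "0 < w" and N: "\<And>m a x \<omega>. \<lbrakk>N \<le> m; a \<le> l; good_pt x; \<omega> \<in> Einf \<theta> A ((\<theta> ^^ m) x); \<omega> 0 \<le> l\<rbrakk> \<Longrightarrow>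
       ennreal (w * c ^ m) \<le> tpow \<theta> A \<phi> x m (indicator {\<tau>. \<tau> 0 = a}) \<omega>"
    using acc[of l] by blast
  define C where "C = max 1 (1 / c * enn2real ((\<Sum>e\<le>l. ennreal (cu e)) + H l))"
  have fin: "(\<Sum>e\<le>l. ennreal (cu e)) + H l < top"
    using order.strict_trans[OF l ennreal_less_top] by simp
  have C: "1 \<le> C" "ennreal (1 / c) * ((\<Sum>e\<le>l. ennreal (cu e)) + H l) \<le> ennreal C"
  proof -
    have "ennreal (1 / c) * ((\<Sum>e\<le>l. ennreal (cu e)) + H l) = ennreal (1 / c * enn2real ((\<Sum>e\<le>l. ennreal (cu e)) + H l))"
      using c by (subst ennreal_mult) (auto simp: ennreal_enn2real[OF fin])
    then show "ennreal (1 / c) * ((\<Sum>e\<le>l. ennreal (cu e)) + H l) \<le> ennreal C"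
      by (simp add: C_def ennreal_leI)
  qed (simp add: C_def)
  \<comment> \<open>For small i the tail H i may be infinite. The bound C is valid for every i, and
    the minimum with it makes \<eta> real.\<close>
  define \<eta> where "\<eta> i = enn2real (min (ennreal (1 / c) * H i) (ennreal C))" for i
  have \<eta>: "ennreal (\<eta> i) = min (ennreal (1 / c) * H i) (ennreal C)" for i
    unfolding \<eta>_def by (rule ennreal_enn2real) (simp add: min_less_iff_disj)
  have "(\<lambda>i. min (ennreal (1 / c) * H i) (ennreal C)) \<longlonglongrightarrow> min (ennreal (1 / c) * 0) (ennreal C)"
    by (intro tendsto_min tendsto_const ennreal_tendsto_cmult H_tendsto) simp
  then have "(\<lambda>i. min (ennreal (1 / c) * H i) (ennreal C)) \<longlonglongrightarrow> ennreal 0" by simp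
  then have \<eta>0: "\<eta> \<longlonglongrightarrow> 0" unfolding \<eta>_def by (rule tendsto_enn2real) simp
  have geo: "summable (\<lambda>r. V * exp (- \<alpha>) ^ Suc r)"
    using alpha_pos summable_geometric[of "exp (- \<alpha>)"] by (intro summable_mult summable_Suc_iff[THEN iffD2]) simp
  have "weighted_shift (\<lambda>k. A ((\<theta> ^^ k) x)) (\<lambda>k. phi0 c ((\<theta> ^^ k) x))
       (\<lambda>r. V * exp (- \<alpha>) ^ Suc r) \<eta> C w N {..l} (\<lambda>k. base_point ((\<theta> ^^ k) x))" if x: "good_pt x" for x
  proof -
    have g: "good_pt ((\<theta> ^^ k) x)" for k by (rule good_pt_funpow[OF x])
    have sp: "(\<theta> ^^ k) x \<in> space M" for k using g by (simp add: good_pt_def)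
    have one: "transfer A (phi0 c) ((\<theta> ^^ k) x) (\<lambda>_. 1) \<omega> \<le> ennreal C" if "\<omega> \<in> Einf \<theta> A (\<theta> ((\<theta> ^^ k) x))" for k \<omega>
      unfolding transfer_phi0[OF c(1) that]
      by (rule order_trans[OF mult_left_mono[OF good_pt_transfer_one[OF g that]] C(2)]) simp
    have tail: "transfer A (phi0 c) ((\<theta> ^^ k) x) (indicator {\<tau>. i < \<tau> 0}) \<omega> \<le> ennreal (1 / c) * H i"
      if "\<omega> \<in> Einf \<theta> A (\<theta> ((\<theta> ^^ k) x))" for k \<omega> i
      unfolding transfer_phi0[OF c(1) that] by (intro mult_left_mono good_pt_transfer_tail[OF g that]) simp
    show ?thesis
      unfolding weighted_shift_def Einf_seq transfer_seq tpow_seq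
    proof (intro conjI allI impI)
      fix k e
      show "\<exists>S. finite S \<and> (\<forall>j. A ((\<theta> ^^ k) x) e j \<longrightarrow> j \<in> S)"
        using good_pt_regular[OF g, of k] Sr_finite[of e] unfolding regular_pt_def by blast
    next
      fix k r \<tau> \<omega> assume "\<tau> \<in> Einf \<theta> A ((\<theta> ^^ k) x)" "\<omega> \<in> Einf \<theta> A ((\<theta> ^^ k) x)" "\<forall>i\<le>r. \<tau> i = \<omega> i"
      then show "phi0 c ((\<theta> ^^ k) x) \<tau> \<le> phi0 c ((\<theta> ^^ k) x) \<omega> + V * exp (- \<alpha>) ^ Suc r"
        using regular_distortion[OF good_pt_regular[OF g]] by (simp add: phi0_def)
    next
      fix k \<omega> assume "\<omega> \<in> Einf \<theta> A ((\<theta> ^^ Suc k) x)"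
      then have o: "\<omega> \<in> Einf \<theta> A (\<theta> ((\<theta> ^^ k) x))" by simp
      show "transfer A (phi0 c) ((\<theta> ^^ k) x) (\<lambda>_. 1) \<omega> \<le> ennreal C" by (rule one[OF o])
      have "ennreal (1 / c) * H l \<le> ennreal (1 / c) * ennreal (c / 4)"
        using l by (intro mult_left_mono) auto
      also have "\<dots> = ennreal (1 / 4)" using c by (simp add: ennreal_mult[symmetric])
      finally show "transfer A (phi0 c) ((\<theta> ^^ k) x) (indicator {\<tau>. \<tau> 0 \<notin> {..l}}) \<omega> \<le> ennreal (1 / 4)"
        using tail[OF o, of l] by (simp add: not_le)
      fix i
      show "transfer A (phi0 c) ((\<theta> ^^ k) x) (indicator {\<tau>. i < \<tau> 0}) \<omega> \<le> ennreal (\<eta> i)"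
        unfolding \<eta>
      proof (rule min.boundedI[OF tail[OF o]])
        have "transfer A (phi0 c) ((\<theta> ^^ k) x) (indicator {\<tau>. i < \<tau> 0}) \<omega> \<le> transfer A (phi0 c) ((\<theta> ^^ k) x) (\<lambda>_. 1) \<omega>"
          by (rule transfer_mono) (auto simp: indicator_def)
        then show "transfer A (phi0 c) ((\<theta> ^^ k) x) (indicator {\<tau>. i < \<tau> 0}) \<omega> \<le> ennreal C"
          using one[OF o] by (rule order_trans)
      qed
    next
      fix k m f \<omega> assume a: "N \<le> m" "f \<in> {..l}" "\<omega> \<in> Einf \<theta> A ((\<theta> ^^ (m + k)) x)" "\<omega> 0 \<in> {..l}"
      have o: "\<omega> \<in> Einf \<theta> A ((\<theta> ^^ m) ((\<theta> ^^ k) x))" using a(3) by (simp add: funpow_add)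
      have "ennreal w = ennreal ((1 / c) ^ m) * ennreal (w * c ^ m)"
        using c w by (subst ennreal_mult[symmetric]) (auto simp: power_divide)
      also have "\<dots> \<le> tpow \<theta> A (phi0 c) ((\<theta> ^^ k) x) m (indicator {\<tau>. \<tau> 0 = f}) \<omega>"
        unfolding tpow_phi0[OF c(1) o] by (intro mult_left_mono N g o) (use a in auto)
      finally show "ennreal w \<le> tpow \<theta> A (phi0 c) ((\<theta> ^^ k) x) m (indicator {\<tau>. \<tau> 0 = f}) \<omega>" .
    qed (use sp phi0_measurable V_nonneg geo \<eta>0 base_point_in_Einf C w in \<open>auto simp: \<eta>_def\<close>)
  qed
  with c(1) that show thesis by blast
qed

end

text \<open>In a complete space a change on a null set preserves measurability; nothing has to be
  known about the set of good points.\<close>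

lemma (in complete_measure) borel_measurable_AE_cong:
  fixes f g :: "'a \<Rightarrow> 'b :: topological_space"
  assumes g: "g \<in> borel_measurable M" and ae: "AE x in M. f x = g x"
  shows "f \<in> borel_measurable M"
proof (rule measurableI)
  fix S :: "'b set" assume "S \<in> sets borel"
  then have 1: "g -` S \<inter> space M \<in> sets M" using g by (rule measurable_sets[rotated])
  have 2: "AE x in M. x \<in> g -` S \<inter> space M \<longleftrightarrow> x \<in> f -` S \<inter> space M"
    using ae by eventually_elim auto
  show "f -` S \<inter> space M \<in> sets M" by (rule in_sets_AE[OF 2 1]) simp
qed simp

context random_shift begin

section \<open>From orbit families to measures at single points\<close>

definition "base_tpow c x n v = tpow \<theta> A (phi0 c) x n (indicator (cyl v)) (base_point ((\<theta> ^^ n) x))"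
text \<open>The empty word stands for the constant function 1. These explicit quotients are
  measurable in x, and measurability of the limit measure will be read off from them.\<close>

definition "ratio c x n v = enn2real (base_tpow c x n v) / enn2real (base_tpow c x n [])"

text \<open>What is needed of a normalized solution, in terms free of the locale of one orbit; in
  detail only the indices 0 and 1 matter. The last clause identifies the normalized \<mu> 1 with the
  limit that belongs to \<theta> x.\<close>

definition good_orbit :: "real \<Rightarrow> real \<Rightarrow> real \<Rightarrow> 'a \<Rightarrow> (nat \<Rightarrow> (nat \<Rightarrow> nat) measure) \<Rightarrow> bool" where
  "good_orbit c C Z x \<mu> \<longleftrightarrow>
     (\<forall>k. sets (\<mu> k) = sets borel) \<and> (\<forall>k. finite_measure (\<mu> k)) \<and>
     (\<forall>k. AE \<omega> in \<mu> k. \<omega> \<in> Einf \<theta> A ((\<theta> ^^ k) x)) \<and> measure (\<mu> 0) UNIV = 1 \<and>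
     measure (\<mu> 1) UNIV \<le> Z \<and> 1 \<le> C * measure (\<mu> 1) UNIV \<and>
     (\<forall>B\<in>sets borel. emeasure (\<mu> 0) B = (\<integral>\<^sup>+ \<omega>. transfer A (phi0 c) x (indicator B) \<omega> \<partial>\<mu> 1)) \<and>
     (\<forall>v. (\<lambda>n. ratio c x n v) \<longlonglongrightarrow> measure (\<mu> 0) (cyl v)) \<and>
     (\<forall>v. (\<lambda>n. ratio c (\<theta> x) n v) \<longlonglongrightarrow> measure (\<mu> 1) (cyl v) / measure (\<mu> 1) UNIV)"

text \<open>The base point of level n over \<theta> x is that of level n + 1 over x. So the
  functionals of \<theta> x are those of x at index 1, up to a common factor.\<close>

lemma good_orbit_exists:
  assumes ws: "weighted_shift (\<lambda>k. A ((\<theta> ^^ k) x)) (\<lambda>k. phi0 c ((\<theta> ^^ k) x))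
       (\<lambda>r. V * exp (- \<alpha>) ^ Suc r) \<eta> C w N {..l} (\<lambda>k. base_point ((\<theta> ^^ k) x))"
  shows "\<exists>\<mu>. good_orbit c C (C ^ N / (w * (3 * w / (4 * C ^ N)))) x \<mu>"
proof -
  interpret W: weighted_shift "\<lambda>k. A ((\<theta> ^^ k) x)" "\<lambda>k. phi0 c ((\<theta> ^^ k) x)"
    "\<lambda>r. V * exp (- \<alpha>) ^ Suc r" \<eta> C w N "{..l}" "\<lambda>k. base_point ((\<theta> ^^ k) x)" by (rule ws)
  obtain \<mu> where g: "W.normalized \<mu>" and lim: "\<And>k v. (\<lambda>n. W.approx_cyl n k v) \<longlonglongrightarrow> measure (\<mu> k) (cyl v)"
    using W.normalized_limit by blast
  have s: "W.solution \<mu>" and one: "measure (\<mu> 0) UNIV = 1" using g by (auto simp: W.normalized_def)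
  have C1: "1 \<le> C * measure (\<mu> 1) UNIV" using W.solution_mass_le_pow[OF s, of 0 1] one by simp
  then have z1: "measure (\<mu> 1) UNIV \<noteq> 0" by auto
  have x0: "W.approx_cyl n 0 v = ratio c x n v" for n v
  proof -
    have "W.approx n 0 (cyl v) = enn2real (base_tpow c x n v)" for v
      unfolding W.approx_def W.Phi_def using tpow_seq[of x "phi0 c" 0 n] by (simp add: base_tpow_def)
    from this[of v] this[of "[]"] show ?thesis by (simp add: W.approx_cyl_def ratio_def)
  qed
  have x1: "W.approx_cyl (Suc n) 1 v = enn2real (base_tpow c (\<theta> x) n v) / W.approx (Suc n) 0 UNIV" for n v
  proof -
    have "W.approx (Suc n) 1 (cyl v) = enn2real (base_tpow c (\<theta> x) n v)"
      unfolding W.approx_def W.Phi_def using tpow_seq[of x "phi0 c" 1 n] by (simp add: base_tpow_def funpow_swap1)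
    then show ?thesis by (simp add: W.approx_cyl_def)
  qed
  \<comment> \<open>The mass at index 0 cancels in the quotient. It is known to be positive only
    from level N on, hence the restriction to large n.\<close>
  have ev: "\<forall>\<^sub>F n in sequentially. W.approx_cyl (Suc n) 1 v / W.approx_cyl (Suc n) 1 [] = ratio c (\<theta> x) n v" for v
    unfolding eventually_sequentially
  proof (intro exI[of _ N] allI impI)
    fix n assume "N \<le> n"
    then have "0 < W.approx (Suc n) 0 UNIV" by (intro W.approx_0_pos) auto
    then show "W.approx_cyl (Suc n) 1 v / W.approx_cyl (Suc n) 1 [] = ratio c (\<theta> x) n v"
      unfolding x1 ratio_def by simp
  qed
  have "(\<lambda>n. W.approx_cyl (Suc n) 1 v / W.approx_cyl (Suc n) 1 []) \<longlonglongrightarrow> measure (\<mu> 1) (cyl v) / measure (\<mu> 1) (cyl [])" for v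
    by (intro tendsto_divide LIMSEQ_Suc lim) (use z1 in simp)
  then have lim1: "(\<lambda>n. ratio c (\<theta> x) n v) \<longlonglongrightarrow> measure (\<mu> 1) (cyl v) / measure (\<mu> 1) UNIV" for v
    using Lim_transform_eventually[OF _ ev, of v] by simp
  show ?thesis
    unfolding good_orbit_def
  proof (intro exI[of _ \<mu>] conjI allI ballI lim1 C1 one W.solutionD(1,2)[OF s])
    show "measure (\<mu> 1) UNIV \<le> C ^ N / (w * (3 * w / (4 * C ^ N)))"
      using W.normalized_mass_le[OF g, of 1] by (simp add: W.mass_bound_def W.F_frac_def)
    show "AE \<omega> in \<mu> k. \<omega> \<in> Einf \<theta> A ((\<theta> ^^ k) x)" for k
      using W.solutionD(3)[OF s, of k] by (simp add: Einf_seq)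
    show "emeasure (\<mu> 0) B = (\<integral>\<^sup>+ \<omega>. transfer A (phi0 c) x (indicator B) \<omega> \<partial>\<mu> 1)" if "B \<in> sets borel" for B
      using W.solutionD(4)[OF s that, of 0] by (simp add: transfer_seq)
    show "(\<lambda>n. ratio c x n v) \<longlonglongrightarrow> measure (\<mu> 0) (cyl v)" for v using lim[of 0 v] by (simp add: x0)
  qed
qed

text \<open>By the two limits in \<open>good_orbit\<close> the measure at \<theta> x is \<mu> 1
  divided by its mass z. Duality of the family then becomes the eigenvalue equation with factor c /
  z, where c undoes the normalization of the potential.\<close>

lemma conformal_point:
  obtains c K and NU :: "'a \<Rightarrow> (nat \<Rightarrow> nat) measure" where
    "\<And>x. good_pt x \<Longrightarrow> sets (NU x) = sets borel" "\<And>x. good_pt x \<Longrightarrow> prob_space (NU x)"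
    "\<And>x. good_pt x \<Longrightarrow> AE \<omega> in NU x. \<omega> \<in> Einf \<theta> A x"
    "\<And>x v. good_pt x \<Longrightarrow> (\<lambda>n. ratio c x n v) \<longlonglongrightarrow> measure (NU x) (cyl v)"
    "\<And>x. good_pt x \<Longrightarrow> \<exists>t>0. \<bar>ln t\<bar> \<le> K \<and>
       (\<forall>B\<in>sets borel. (\<integral>\<^sup>+ \<omega>. transfer A \<phi> x (indicator B) \<omega> \<partial>NU (\<theta> x)) = ennreal t * emeasure (NU x) B)"
proof -
  obtain c C w \<eta> N l where c: "0 < c" and ws: "\<And>x. good_pt x \<Longrightarrow> weighted_shift (\<lambda>k. A ((\<theta> ^^ k) x)) (\<lambda>k. phi0 c ((\<theta> ^^ k) x))
       (\<lambda>r. V * exp (- \<alpha>) ^ Suc r) \<eta> C w N {..l} (\<lambda>k. base_point ((\<theta> ^^ k) x))"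
    by (rule weighted_shift_params) (rule that)
  define Z where "Z = C ^ N / (w * (3 * w / (4 * C ^ N)))"
  have "\<exists>\<mu>. good_orbit c C Z x \<mu>" if "good_pt x" for x
    unfolding Z_def by (rule good_orbit_exists[OF ws[OF that]])
  then obtain mu where mu: "\<And>x. good_pt x \<Longrightarrow> good_orbit c C Z x (mu x)" by metis
  \<comment> \<open>The mass z at index 1 satisfies 1 / C \<le> z \<le> Z, so the factor lies
    between c / Z and c * C for every good point.\<close>
  define K where "K = \<bar>ln (c / Z)\<bar> + \<bar>ln (c * C)\<bar>"
  show thesis
  proof (rule that[of "\<lambda>x. mu x 0" c K])
    fix x assume x: "good_pt x"
    note o = mu[OF x, unfolded good_orbit_def]
    have s: "sets (mu x k) = sets borel" for k using o by blast
    have eq0: "\<forall>B\<in>sets borel. emeasure (mu x 0) B = (\<integral>\<^sup>+ \<omega>. transfer A (phi0 c) x (indicator B) \<omega> \<partial>mu x 1)"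
      using o by blast
    have sp: "space (mu x k) = UNIV" for k using sets_eq_imp_space_eq[OF s] by simp
    have fin: "finite_measure (mu x k)" for k using o by blast
    show "sets (mu x 0) = sets borel" by (rule s)
    show "prob_space (mu x 0)"
      using o finite_measure.emeasure_eq_measure[OF fin, of 0 UNIV] by (intro prob_spaceI) (simp add: sp)
    show "AE \<omega> in mu x 0. \<omega> \<in> Einf \<theta> A x" using o by (auto dest: spec[of _ 0])
    show "(\<lambda>n. ratio c x n v) \<longlonglongrightarrow> measure (mu x 0) (cyl v)" for v using o by blast
    have gx: "good_pt (\<theta> x)" using good_pt_funpow[OF x, of 1] by simp
    note o' = mu[OF gx, unfolded good_orbit_def]
    define z where "z = measure (mu x 1) UNIV"
    have z: "z \<le> Z" "1 \<le> C * z" "0 \<le> z" using o by (auto simp: z_def)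
    have "0 < z" using z by (metis less_le mult_zero_right not_one_le_zero)
    then have "0 < C" "0 < Z" using z by (auto simp: zero_less_mult_iff dest: less_le_trans[OF zero_less_one])
    \<comment> \<open>The families at x and at \<theta> x were chosen independently, but both
      describe the limit of the same ratios over \<theta> x.\<close>
    have cyl: "measure (mu (\<theta> x) 0) (cyl v) = measure (mu x 1) (cyl v) / z" for v
      using o o' LIMSEQ_unique z_def by blast
    have fin': "finite_measure (mu (\<theta> x) 0)" and s': "sets (mu (\<theta> x) 0) = sets borel"
      using o' by blast+
    have scale: "mu (\<theta> x) 0 = scale_measure (ennreal (1 / z)) (mu x 1)"
    proof (rule measure_eqI_cyl)
      show "emeasure (mu (\<theta> x) 0) UNIV \<noteq> \<infinity>" using finite_measure.emeasure_finite[OF fin', of UNIV] by simp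
      fix v show "emeasure (mu (\<theta> x) 0) (cyl v) = emeasure (scale_measure (ennreal (1 / z)) (mu x 1)) (cyl v)"
        using cyl[of v] finite_measure.emeasure_eq_measure[OF fin, of 1 "cyl v"] \<open>0 < z\<close>
          finite_measure.emeasure_eq_measure[OF fin', of "cyl v"]
        by (simp add: ennreal_mult[symmetric])
    qed (use s' s in simp_all)
    define t where "t = c / z"
    have t: "0 < t" using c \<open>0 < z\<close> by (simp add: t_def)
    have "c / Z \<le> t" "t \<le> c * C"
      using z c \<open>0 < z\<close> \<open>0 < Z\<close> \<open>0 < C\<close> by (auto simp: t_def field_simps)
    then have "ln (c / Z) \<le> ln t" "ln t \<le> ln (c * C)"
      using c \<open>0 < Z\<close> \<open>0 < C\<close> t by (auto simp del: ln_mult ln_div intro!: ln_mono)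
    then have "\<bar>ln t\<bar> \<le> K" unfolding K_def by linarith
    moreover have "(\<integral>\<^sup>+ \<omega>. transfer A \<phi> x (indicator B) \<omega> \<partial>mu (\<theta> x) 0) = ennreal t * emeasure (mu x 0) B"
      if B: "B \<in> sets borel" for B
    proof -
      have xs: "x \<in> space M" using x by (simp add: good_pt_def)
      have m: "transfer A (phi0 c) x (indicator B) \<in> borel_measurable borel"
        by (rule transfer_measurable) (use B phi0_measurable[OF xs] in auto)
      have "(\<integral>\<^sup>+ \<omega>. transfer A \<phi> x (indicator B) \<omega> \<partial>mu (\<theta> x) 0)
          = (\<integral>\<^sup>+ \<omega>. ennreal c * transfer A (phi0 c) x (indicator B) \<omega> \<partial>mu (\<theta> x) 0)"
      proof (rule nn_integral_cong_AE)
        have "AE \<omega> in mu (\<theta> x) 0. \<omega> \<in> Einf \<theta> A (\<theta> x)" using o' by (auto dest: spec[of _ 0])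
        then show "AE \<omega> in mu (\<theta> x) 0. transfer A \<phi> x (indicator B) \<omega> = ennreal c * transfer A (phi0 c) x (indicator B) \<omega>"
          by (rule eventually_mono) (use c in \<open>simp add: transfer_phi0 mult.assoc[symmetric] ennreal_mult[symmetric]\<close>)
      qed
      also have "\<dots> = ennreal c * (ennreal (1 / z) * (\<integral>\<^sup>+ \<omega>. transfer A (phi0 c) x (indicator B) \<omega> \<partial>mu x 1))"
      proof -
        have "transfer A (phi0 c) x (indicator B) \<in> borel_measurable (mu x 1)"
          using m s by (simp cong: measurable_cong_sets)
        then show ?thesis unfolding scale by (simp add: nn_integral_cmult nn_integral_scale_measure)
      qed
      also have "\<dots> = ennreal t * emeasure (mu x 0) B"
        using bspec[OF eq0 B] c \<open>0 < z\<close> by (simp add: t_def mult.assoc[symmetric] ennreal_mult[symmetric])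
      finally show ?thesis .
    qed
    ultimately show "\<exists>t>0. \<bar>ln t\<bar> \<le> K \<and>
       (\<forall>B\<in>sets borel. (\<integral>\<^sup>+ \<omega>. transfer A \<phi> x (indicator B) \<omega> \<partial>mu (\<theta> x) 0) = ennreal t * emeasure (mu x 0) B)"
      using t by blast
  qed
qed

section \<open>Measurability in the point of the base space\<close>

lemma base_point_measurable [measurable]: "base_point \<in> M \<rightarrow>\<^sub>M borel"
proof -
  have coord: "(\<lambda>x. base_point x i) \<in> M \<rightarrow>\<^sub>M count_space UNIV" for i
  proof (induction i)
    case (Suc i)
    have "Measurable.pred M (\<lambda>x. A ((\<theta> ^^ i) x) a j)" for a j
      using measurable_compose[OF funpow_measurable A_measurable] by simp
    then have "Measurable.pred M (\<lambda>x. A ((\<theta> ^^ i) x) (base_point x i) j)" for j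
      by (rule measurable_compose_countable[OF _ Suc])
    then show ?case by simp
  qed simp
  have "(\<lambda>x i. base_point x i) \<in> M \<rightarrow>\<^sub>M PiM UNIV (\<lambda>_. count_space (UNIV :: nat set))"
    by (rule measurable_PiM_single') (auto simp: coord)
  then show ?thesis unfolding measurable_cong_sets[OF refl sets_borel_seq] by simp
qed

text \<open>Admissibility couples the point with the first letter; as letters are countable, it may
  be checked letter by letter. The function u may depend on the point, which is what iteration
  requires.\<close>

lemma transfer_joint:
  assumes [measurable]: "(\<lambda>q. u (fst q) (snd q)) \<in> borel_measurable (M \<Otimes>\<^sub>M borel)"
  shows "(\<lambda>q. transfer A (phi0 c) ((\<theta> ^^ n) (fst q)) (u (fst q)) (snd q)) \<in> borel_measurable (M \<Otimes>\<^sub>M borel)"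
proof -
  have p: "Measurable.pred (M \<Otimes>\<^sub>M borel) (\<lambda>q. A ((\<theta> ^^ n) (fst q)) e (snd q (0 :: nat)))" for e
  proof -
    have "(\<lambda>q. (\<theta> ^^ n) (fst q)) \<in> M \<Otimes>\<^sub>M (borel :: (nat \<Rightarrow> nat) measure) \<rightarrow>\<^sub>M M" by measurable
    from measurable_compose[OF this A_measurable]
    have a: "Measurable.pred (M \<Otimes>\<^sub>M (borel :: (nat \<Rightarrow> nat) measure)) (\<lambda>q. A ((\<theta> ^^ n) (fst q)) e b)" for b by simp
    have s: "(\<lambda>q. snd q 0) \<in> M \<Otimes>\<^sub>M (borel :: (nat \<Rightarrow> nat) measure) \<rightarrow>\<^sub>M count_space UNIV"
      by measurable
    show ?thesis by (rule measurable_compose_countable[OF a s])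
  qed
  have f: "(\<lambda>q. u (fst q) (case_nat e (snd q))) \<in> borel_measurable (M \<Otimes>\<^sub>M borel)" for e
  proof -
    have "(\<lambda>q. (fst q, case_nat e (snd q))) \<in> M \<Otimes>\<^sub>M borel \<rightarrow>\<^sub>M M \<Otimes>\<^sub>M borel" by measurable
    from measurable_compose[OF this assms] show ?thesis by simp
  qed
  have g: "(\<lambda>q. phi0 c ((\<theta> ^^ n) (fst q)) (case_nat e (snd q))) \<in> borel_measurable (M \<Otimes>\<^sub>M borel)" for e
  proof -
    have "(\<lambda>q. ((\<theta> ^^ n) (fst q), case_nat e (snd q))) \<in> M \<Otimes>\<^sub>M borel \<rightarrow>\<^sub>M M \<Otimes>\<^sub>M borel" by measurable
    from measurable_compose[OF this phi0_joint[of c]] show ?thesis by simp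
  qed
  note [measurable] = p f g
  show ?thesis unfolding transfer_def by measurable
qed

lemma tpow_joint:
  assumes [measurable]: "u \<in> borel_measurable borel"
  shows "(\<lambda>q. tpow \<theta> A (phi0 c) (fst q) n u (snd q)) \<in> borel_measurable (M \<Otimes>\<^sub>M borel)"
proof (induction n)
  case (Suc n)
  then show ?case using transfer_joint[OF Suc, of c n] by simp
qed simp

lemma ratio_measurable: "(\<lambda>x. ratio c x n v) \<in> borel_measurable M"
proof -
  have "(\<lambda>x. (x, base_point ((\<theta> ^^ n) x))) \<in> M \<rightarrow>\<^sub>M M \<Otimes>\<^sub>M borel" by measurable
  from measurable_compose[OF this tpow_joint[of "indicator (cyl v)" c n for v]]
  have [measurable]: "(\<lambda>x. base_tpow c x n v) \<in> borel_measurable M" for v unfolding base_tpow_def by simp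
  show ?thesis unfolding ratio_def by measurable
qed

end

section \<open>The random conformal measure\<close>

lemma (in random_shift) conformal_measure_exists:
  assumes "prob_space M" "complete_measure M" and ae: "AE x in M. good_pt x"
  shows "\<exists>\<nu> \<nu>x lam. random_measure M \<theta> A \<nu> \<and> disintegration M \<theta> A \<nu> \<nu>x \<and>
           lam \<in> borel_measurable M \<and> (\<forall>x \<in> space M. 0 < lam x) \<and>
           conformal_eq M \<theta> A \<phi> \<nu>x lam \<and>
           esssup M (\<lambda>x. ereal \<bar>ln (lam x)\<bar>) < \<infinity>"
proof -
  interpret prob_space M by fact
  interpret complete_measure M by fact
  obtain c K and NU :: "'a \<Rightarrow> (nat \<Rightarrow> nat) measure" where
    NU: "\<And>x. good_pt x \<Longrightarrow> sets (NU x) = sets borel" "\<And>x. good_pt x \<Longrightarrow> prob_space (NU x)"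
    "\<And>x. good_pt x \<Longrightarrow> AE \<omega> in NU x. \<omega> \<in> Einf \<theta> A x"
    "\<And>x v. good_pt x \<Longrightarrow> (\<lambda>n. ratio c x n v) \<longlonglongrightarrow> measure (NU x) (cyl v)"
    "\<And>x. good_pt x \<Longrightarrow> \<exists>t>0. \<bar>ln t\<bar> \<le> K \<and>
       (\<forall>B\<in>sets borel. (\<integral>\<^sup>+ \<omega>. transfer A \<phi> x (indicator B) \<omega> \<partial>NU (\<theta> x)) = ennreal t * emeasure (NU x) B)"
    by (rule conformal_point) (rule that)
  have goodM: "x \<in> space M" "good_pt (\<theta> x)" if "good_pt x" for x
    using that good_pt_funpow[OF that, of 1] by (auto simp: good_pt_def)
  \<comment> \<open>M is complete, so the choice on the null set of bad points does not affect measurability.\<close>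
  define NK where "NK x = (if good_pt x then NU x else return borel (base_point x))" for x
  have NKs: "sets (NK x) = sets borel" for x using NU(1) by (simp add: NK_def)
  have NKsp: "space (NK x) = UNIV" for x using sets_eq_imp_space_eq[OF NKs] by simp
  have NKp: "prob_space (NK x)" for x using NU(2) by (simp add: NK_def prob_space_return)
  \<comment> \<open>A disintegration is required to live on the fibre for every x in the space. At
    bad points this holds since the base point is admissible there.\<close>
  have NKE: "AE \<omega> in NK x. \<omega> \<in> Einf \<theta> A x" if "x \<in> space M" for x
  proof (cases "good_pt x")
    case False
    then have e: "NK x = return borel (base_point x)" by (simp add: NK_def)
    show ?thesis unfolding e by (subst AE_return) (use base_point_in_Einf[OF that] in auto)
  next
    case True
    then have e: "NK x = NU x" by (simp add: NK_def)
    show ?thesis unfolding e by (rule NU(3)[OF True])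
  qed
  have NKE1: "emeasure (NK x) (Einf \<theta> A x) = 1" if "x \<in> space M" for x
    using prob_space.emeasure_eq_1_AE[OF NKp, of "Einf \<theta> A x" x] NKE[OF that] NKs by auto
  \<comment> \<open>It is enough to consider cylinders, where the values are almost surely limits of
    the measurable ratios.\<close>
  have kernel: "NK \<in> M \<rightarrow>\<^sub>M prob_algebra borel"
  proof (rule measurable_prob_algebra_generated[OF sigma_cyl_insert Int_stable_cyl])
    fix S :: "(nat \<Rightarrow> nat) set" assume "S \<in> insert {} (range cyl)"
    then consider "S = {}" | v where "S = cyl v" by auto
    then show "(\<lambda>x. emeasure (NK x) S) \<in> borel_measurable M"
    proof cases
      case (2 v)
      have "(\<lambda>x. ennreal (lim (\<lambda>n. ratio c x n v))) \<in> borel_measurable M"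
        using ratio_measurable by measurable
      moreover have "AE x in M. emeasure (NK x) (cyl v) = ennreal (lim (\<lambda>n. ratio c x n v))"
        using ae
      proof (rule eventually_mono)
        fix x assume x: "good_pt x"
        have "finite_measure (NU x)" using NU(2)[OF x] by (rule prob_space.finite_measure)
        then show "emeasure (NK x) (cyl v) = ennreal (lim (\<lambda>n. ratio c x n v))"
          using limI[OF NU(4)[OF x, of v]] x by (simp add: NK_def finite_measure.emeasure_eq_measure)
      qed
      ultimately show ?thesis unfolding 2 by (rule borel_measurable_AE_cong)
    qed simp
  qed (use NKp NKs in auto)
  have NKsub: "NK \<in> M \<rightarrow>\<^sub>M subprob_algebra borel" by (rule measurable_prob_algebraD[OF kernel])
  \<comment> \<open>Each fibre measure is pushed into the product space, so that binding over M
    yields a measure with these fibres; it is restricted to \<open>Omega\<close> afterwards.\<close>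
  define Q where "Q x = distr (NK x) (M \<Otimes>\<^sub>M borel) (Pair x)" for x
  have Q: "Q \<in> M \<rightarrow>\<^sub>M subprob_algebra (M \<Otimes>\<^sub>M borel)"
    unfolding Q_def by (rule measurable_distr2[OF _ NKsub]) simp
  have QB: "emeasure (Q x) B = emeasure (NK x) (Pair x -` B)" if "B \<in> sets (M \<Otimes>\<^sub>M borel)" "x \<in> space M" for x B
  proof -
    have "Pair x \<in> NK x \<rightarrow>\<^sub>M M \<Otimes>\<^sub>M borel"
      unfolding measurable_cong_sets[OF NKs refl] by (rule measurable_Pair1'[OF that(2)])
    then show ?thesis unfolding Q_def using that by (subst emeasure_distr) (auto simp: NKsp)
  qed
  define \<nu>0 where "\<nu>0 = M \<bind> Q"
  have \<nu>0s: "sets \<nu>0 = sets (M \<Otimes>\<^sub>M borel)"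
    unfolding \<nu>0_def by (rule sets_bind) (auto simp: Q_def not_empty)
  have \<nu>0sp: "space \<nu>0 = space (M \<Otimes>\<^sub>M borel)" by (rule sets_eq_imp_space_eq[OF \<nu>0s])
  have \<nu>0: "emeasure \<nu>0 B = (\<integral>\<^sup>+ x. emeasure (NK x) (Pair x -` B) \<partial>M)" if "B \<in> sets (M \<Otimes>\<^sub>M borel)" for B
    unfolding \<nu>0_def using emeasure_bind[OF not_empty Q that] QB[OF that] by (simp cong: nn_integral_cong)
  define \<nu> where "\<nu> = restrict_space \<nu>0 (Omega \<theta> A)"
  define \<nu>x where "\<nu>x x = restrict_space (NK x) (Einf \<theta> A x)" for x
  have Om: "Omega \<theta> A \<inter> space \<nu>0 \<in> sets \<nu>0" unfolding \<nu>0s \<nu>0sp by (rule Omega_sets)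
  have \<nu>s: "sets \<nu> = sets (OmegaM M \<theta> A)"
    unfolding \<nu>_def OmegaM_def by (rule sets_restrict_space_cong[OF \<nu>0s])
  have \<nu>B: "B \<in> sets (M \<Otimes>\<^sub>M borel) \<and> B \<subseteq> Omega \<theta> A" if "B \<in> sets \<nu>" for B
    using that sets_restrict_space_iff[OF Om, of B] by (auto simp: \<nu>_def \<nu>0s)
  have sec: "emeasure (\<nu>x x) (Pair x -` B) = emeasure (NK x) (Pair x -` B)" if "B \<in> sets \<nu>" for B x
    unfolding \<nu>x_def by (rule emeasure_restrict_space) (use \<nu>B[OF that] NKs in \<open>auto simp: Omega_def\<close>)
  have dis: "emeasure \<nu> B = (\<integral>\<^sup>+ x. emeasure (NK x) (Pair x -` B) \<partial>M)" if "B \<in> sets \<nu>" for B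
    using \<nu>0[of B] \<nu>B[OF that] emeasure_restrict_space[OF Om, of B] by (simp add: \<nu>_def)
  have \<nu>sp: "space \<nu> = Omega \<theta> A \<inter> (space M \<times> UNIV)"
    by (auto simp: \<nu>_def space_restrict_space \<nu>0sp space_pair_measure)
  have rm: "random_measure M \<theta> A \<nu>"
    unfolding random_measure_def
  proof (intro conjI \<nu>s)
    have main: "emeasure \<nu> (fst -` S \<inter> space \<nu>) = emeasure M S" if S: "S \<in> sets M" for S
    proof -
      have fm: "fst \<in> \<nu> \<rightarrow>\<^sub>M M"
        unfolding measurable_cong_sets[OF \<nu>s refl] OmegaM_def by (intro measurable_restrict_space1 measurable_fst)
      have "emeasure \<nu> (fst -` S \<inter> space \<nu>) = (\<integral>\<^sup>+ x. emeasure (NK x) (Pair x -` (fst -` S \<inter> space \<nu>)) \<partial>M)"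
        by (rule dis[OF measurable_sets[OF fm S]])
      also have "\<dots> = (\<integral>\<^sup>+ x. indicator S x \<partial>M)"
      proof (rule nn_integral_cong)
        fix x assume x: "x \<in> space M"
        have "Pair x -` (fst -` S \<inter> space \<nu>) = (if x \<in> S then Einf \<theta> A x else {})"
          using x by (auto simp: \<nu>sp Omega_def)
        then show "emeasure (NK x) (Pair x -` (fst -` S \<inter> space \<nu>)) = indicator S x"
          using NKE1[OF x] by simp
      qed
      finally show ?thesis using S by simp
    qed
    show "prob_space \<nu>"
    proof (rule prob_spaceI)
      have "fst -` space M \<inter> space \<nu> = space \<nu>" by (auto simp: \<nu>sp)
      then show "emeasure \<nu> (space \<nu>) = 1" using main[OF sets.top] emeasure_space_1 by simp
    qed
    show "distr \<nu> M fst = M"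
    proof (rule measure_eqI)
      fix S assume "S \<in> sets (distr \<nu> M fst)"
      then have S: "S \<in> sets M" by simp
      have fm: "fst \<in> \<nu> \<rightarrow>\<^sub>M M"
        unfolding measurable_cong_sets[OF \<nu>s refl] OmegaM_def by (intro measurable_restrict_space1 measurable_fst)
      show "emeasure (distr \<nu> M fst) S = emeasure M S" using main[OF S] S fm by (simp add: emeasure_distr)
    qed simp
  qed
  have di: "disintegration M \<theta> A \<nu> \<nu>x"
    unfolding disintegration_def
  proof (intro conjI ballI)
    fix x assume x: "x \<in> space M"
    show "prob_space (\<nu>x x)"
      unfolding \<nu>x_def by (rule prob_space_restrict_space) (use NKs NKE1[OF x] in auto)
    show "sets (\<nu>x x) = sets (restrict_space borel (Einf \<theta> A x))"
      unfolding \<nu>x_def by (rule sets_restrict_space_cong[OF NKs])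
  next
    fix B assume B: "B \<in> sets \<nu>"
    have "(\<lambda>x. emeasure (Q x) B) \<in> borel_measurable M"
      by (rule measurable_emeasure_kernel[OF Q]) (use \<nu>B[OF B] in simp)
    then show "(\<lambda>x. emeasure (\<nu>x x) (Pair x -` B)) \<in> borel_measurable M"
      using QB \<nu>B[OF B] sec[OF B] by (subst measurable_cong[where g="\<lambda>x. emeasure (Q x) B"]) auto
    show "emeasure \<nu> B = (\<integral>\<^sup>+ x. emeasure (\<nu>x x) (Pair x -` B) \<partial>M)"
      using dis[OF B] sec[OF B] by simp
  qed
  \<comment> \<open>The factor at a good point is recovered as the total mass of the dual image, an
    integral with measurable dependence on x. The value 1 elsewhere keeps \<open>lam\<close>
    positive on the whole space.\<close>
  define lam where "lam x = (if good_pt x then enn2real (\<integral>\<^sup>+ \<omega>. transfer A \<phi> x (\<lambda>_. 1) \<omega> \<partial>NK (\<theta> x)) else 1)" for x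
  have lam: "0 < lam x \<and> \<bar>ln (lam x)\<bar> \<le> K \<and>
      (\<forall>B\<in>sets borel. (\<integral>\<^sup>+ \<omega>. transfer A \<phi> x (indicator B) \<omega> \<partial>NU (\<theta> x)) = ennreal (lam x) * emeasure (NU x) B)"
    if x: "good_pt x" for x
  proof -
    obtain t where t: "0 < t" "\<bar>ln t\<bar> \<le> K"
      "\<forall>B\<in>sets borel. (\<integral>\<^sup>+ \<omega>. transfer A \<phi> x (indicator B) \<omega> \<partial>NU (\<theta> x)) = ennreal t * emeasure (NU x) B"
      using NU(5)[OF x] by blast
    have "emeasure (NU x) UNIV = 1"
      using prob_space.emeasure_space_1[OF NU(2)[OF x]] sets_eq_imp_space_eq[OF NU(1)[OF x]] by simp
    then have "(\<integral>\<^sup>+ \<omega>. transfer A \<phi> x (\<lambda>_. 1) \<omega> \<partial>NU (\<theta> x)) = ennreal t"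
      using bspec[OF t(3), of UNIV] by (simp add: indicator_def[abs_def])
    then have "lam x = t" using x goodM[OF x] t(1) by (simp add: lam_def NK_def)
    then show ?thesis using t by simp
  qed
  have lm: "lam \<in> borel_measurable M"
  proof -
    \<comment> \<open>As ln 1 = 0, \<open>phi0 1\<close> is just \<phi> cut off outside the
      admissible sequences. It is measurable on the whole product, whereas \<phi> is controlled only
      on \<open>Omega\<close>.\<close>
    have "(\<lambda>q. transfer A (phi0 1) ((\<theta> ^^ 0) (fst q)) (\<lambda>_. 1) (snd q)) \<in> borel_measurable (M \<Otimes>\<^sub>M borel)"
      by (rule transfer_joint) simp
    then have "(\<lambda>x. \<integral>\<^sup>+ \<omega>. transfer A (phi0 1) x (\<lambda>_. 1) \<omega> \<partial>NK (\<theta> x)) \<in> borel_measurable M"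
      using nn_integral_measurable_subprob_algebra2[OF _ measurable_compose[OF theta_measurable NKsub],
          of "\<lambda>x. transfer A (phi0 1) x (\<lambda>_. 1)"] by (simp add: split_beta')
    then have "(\<lambda>x. enn2real (\<integral>\<^sup>+ \<omega>. transfer A (phi0 1) x (\<lambda>_. 1) \<omega> \<partial>NK (\<theta> x))) \<in> borel_measurable M"
      by measurable
    moreover have "AE x in M. lam x = enn2real (\<integral>\<^sup>+ \<omega>. transfer A (phi0 1) x (\<lambda>_. 1) \<omega> \<partial>NK (\<theta> x))"
      using ae
    proof (rule eventually_mono)
      fix x assume x: "good_pt x"
      have "AE \<omega> in NK (\<theta> x). transfer A \<phi> x (\<lambda>_. 1) \<omega> = transfer A (phi0 1) x (\<lambda>_. 1) \<omega>"
        using NKE[OF goodM(1)[OF goodM(2)[OF x]]] by (rule eventually_mono) (simp add: transfer_phi0)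
      then show "lam x = enn2real (\<integral>\<^sup>+ \<omega>. transfer A (phi0 1) x (\<lambda>_. 1) \<omega> \<partial>NK (\<theta> x))"
        using x by (simp add: lam_def cong: nn_integral_cong_AE)
    qed
    ultimately show ?thesis by (rule borel_measurable_AE_cong)
  qed
  have ce: "conformal_eq M \<theta> A \<phi> \<nu>x lam"
    unfolding conformal_eq_def using ae
  proof (rule eventually_mono, intro ballI)
    fix x B assume x: "good_pt x" and "B \<in> sets (\<nu>x x)"
    then have B: "B \<in> sets borel" "B \<subseteq> Einf \<theta> A x"
      unfolding \<nu>x_def by (subst (asm) sets_restrict_space_iff; use NKs in auto)+
    have "(\<integral>\<^sup>+ \<omega>. transfer A \<phi> x (indicator B) \<omega> \<partial>\<nu>x (\<theta> x))
        = (\<integral>\<^sup>+ \<omega>. transfer A \<phi> x (indicator B) \<omega> * indicator (Einf \<theta> A (\<theta> x)) \<omega> \<partial>NK (\<theta> x))"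
      unfolding \<nu>x_def by (rule nn_integral_restrict_space) (use NKs in auto)
    also have "\<dots> = (\<integral>\<^sup>+ \<omega>. transfer A \<phi> x (indicator B) \<omega> \<partial>NK (\<theta> x))"
      by (rule nn_integral_cong_AE) (use NKE[OF goodM(1)[OF goodM(2)[OF x]]] in \<open>auto elim!: eventually_mono\<close>)
    also have "\<dots> = ennreal (lam x) * emeasure (NU x) B"
      using lam[OF x] B goodM[OF x] by (simp add: NK_def)
    also have "emeasure (NU x) B = emeasure (\<nu>x x) B"
      unfolding \<nu>x_def using x B NKs[of x] by (subst emeasure_restrict_space) (auto simp: NK_def)
    finally show "(\<integral>\<^sup>+ \<omega>. transfer A \<phi> x (indicator B) \<omega> \<partial>\<nu>x (\<theta> x)) = ennreal (lam x) * emeasure (\<nu>x x) B" .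
  qed
  have "esssup M (\<lambda>x. ereal \<bar>ln (lam x)\<bar>) \<le> ereal K"
    by (rule esssup_I) (use lm ae lam in \<open>auto elim!: eventually_mono\<close>)
  then have "esssup M (\<lambda>x. ereal \<bar>ln (lam x)\<bar>) < \<infinity>" by (rule le_less_trans) simp
  moreover have "\<forall>x\<in>space M. 0 < lam x" using lam by (auto simp: lam_def)
  ultimately show ?thesis using rm di lm ce by blast
qed

text \<open>The almost sure hypotheses amount to countably many conditions, and every iterate of
  \<theta> preserves M; hence almost every point is good along its entire forward orbit.\<close>

theorem theorem1:
  fixes M :: "'a measure" and \<theta> :: "'a \<Rightarrow> 'a" and A :: "'a \<Rightarrow> nat \<Rightarrow> nat \<Rightarrow> bool"
    and \<alpha> :: real and \<phi> :: "'a \<Rightarrow> (nat \<Rightarrow> nat) \<Rightarrow> real"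
  assumes "standing_setup M \<theta> A"
    and "0 < \<alpha>"
    and "is_fine M \<theta> A \<alpha> \<phi>"
  shows "\<exists>\<nu> \<nu>x lam. random_measure M \<theta> A \<nu> \<and> disintegration M \<theta> A \<nu> \<nu>x \<and>
           lam \<in> borel_measurable M \<and> (\<forall>x \<in> space M. 0 < lam x) \<and>
           conformal_eq M \<theta> A \<phi> \<nu>x lam \<and>
           esssup M (\<lambda>x. ereal \<bar>ln (lam x)\<bar>) < \<infinity>"
proof -
  note st = assms(1)[unfolded standing_setup_def]
  have sp: "summable_potential M \<theta> A \<alpha> \<phi>" using assms(3) by (simp add: is_fine_def)
  note su = sp[unfolded summable_potential_def]
  have th: "\<theta> \<in> M \<rightarrow>\<^sub>M M" "distr M M \<theta> = M" using st by blast+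
  have "\<forall>e. \<exists>D. finite D \<and> (AE x in M. \<forall>j. A x e j \<longrightarrow> j \<in> D)" using st by blast
  then obtain Sr where Sr: "\<And>e. finite (Sr e)" "\<And>e. AE x in M. \<forall>j. A x e j \<longrightarrow> j \<in> Sr e" by metis
  have "\<forall>e. \<exists>c C. 0 < c \<and> c < C \<and>
        (AE x in M. \<forall>\<omega> \<in> Einf \<theta> A x. \<omega> 0 = e \<longrightarrow> c \<le> exp (\<phi> x \<omega>) \<and> exp (\<phi> x \<omega>) \<le> C)" using su by blast
  from choice[OF this] obtain cl where "\<forall>e. \<exists>C. 0 < cl e \<and> cl e < C \<and>
        (AE x in M. \<forall>\<omega> \<in> Einf \<theta> A x. \<omega> 0 = e \<longrightarrow> cl e \<le> exp (\<phi> x \<omega>) \<and> exp (\<phi> x \<omega>) \<le> C)" ..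
  from choice[OF this] obtain cu where "\<forall>e. 0 < cl e \<and> cl e < cu e \<and>
        (AE x in M. \<forall>\<omega> \<in> Einf \<theta> A x. \<omega> 0 = e \<longrightarrow> cl e \<le> exp (\<phi> x \<omega>) \<and> exp (\<phi> x \<omega>) \<le> cu e)" ..
  then have cc: "\<And>e. 0 < cl e"
    "\<And>e. AE x in M. \<forall>\<omega> \<in> Einf \<theta> A x. \<omega> 0 = e \<longrightarrow> cl e \<le> exp (\<phi> x \<omega>) \<and> exp (\<phi> x \<omega>) \<le> cu e" by blast+
  define s where "s = esssup M (\<lambda>x. holder_var \<theta> A \<alpha> x (\<phi> x))"
  have "s < \<infinity>" using su by (simp add: s_def)
  \<comment> \<open>An extended real below infinity has a real upper bound; the maximum with 0 makes
    this bound nonnegative as well.\<close>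
  define V where "V = max 0 (real_of_ereal s)"
  have V: "s \<le> ereal V" "0 \<le> V" using \<open>s < \<infinity>\<close> by (cases s; auto simp: V_def)+
  define H where "H l = esssup M (\<lambda>x. SUP \<omega> \<in> Einf \<theta> A (\<theta> x).
        transfer A \<phi> x (indicator (Einf \<theta> A x - {\<tau>. \<tau> 0 \<le> l})) \<omega>)" for l
  have H: "H \<longlonglongrightarrow> 0" using su unfolding H_def by blast
  \<comment> \<open>The hypothesis counts the transitions of a connecting word as n + 2; here the
    count becomes n, at the price of raising the threshold by 2.\<close>
  have mix: "\<exists>n0. \<forall>n\<ge>n0. \<forall>x\<in>space M. \<exists>u. u 0 = a \<and> u n = b \<and>
        (\<forall>i<n. A ((\<theta> ^^ i) x) (u i) (u (Suc i)))" for a b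
  proof -
    have "\<forall>a b. \<exists>N. \<forall>n\<ge>N. \<forall>x \<in> space M. \<exists>w::nat \<Rightarrow> nat.
        w 0 = a \<and> w (n + 2) = b \<and> (\<forall>i < n + 2. A ((\<theta> ^^ i) x) (w i) (w (Suc i)))" using st by blast
    then obtain N where N: "\<forall>n\<ge>N. \<forall>x \<in> space M. \<exists>w::nat \<Rightarrow> nat.
        w 0 = a \<and> w (n + 2) = b \<and> (\<forall>i < n + 2. A ((\<theta> ^^ i) x) (w i) (w (Suc i)))" by blast
    show ?thesis
    proof (intro exI[of _ "N + 2"] allI impI ballI)
      fix n x assume n: "N + 2 \<le> n" and x: "x \<in> space M"
      have "n - 2 + 2 = n" "N \<le> n - 2" using n by auto
      then show "\<exists>u. u 0 = a \<and> u n = b \<and> (\<forall>i<n. A ((\<theta> ^^ i) x) (u i) (u (Suc i)))"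
        using N x by metis
    qed
  qed
  interpret R: random_shift M \<theta> A \<phi> Sr cl cu V \<alpha> H
  proof (rule random_shift.intro)
    show "(\<lambda>x. A x i j) \<in> M \<rightarrow>\<^sub>M count_space UNIV" for i j using st by blast
    show "(\<lambda>q. \<phi> (fst q) (snd q)) \<in> borel_measurable (OmegaM M \<theta> A)" using su by blast
  qed (use th mix Sr cc V H assms(2) in auto)
  have "AE x in M. (\<forall>e j. A x e j \<longrightarrow> j \<in> Sr e)" using Sr(2) by (simp add: AE_all_countable)
  moreover have "AE x in M. holder_var \<theta> A \<alpha> x (\<phi> x) \<le> ereal V"
    using esssup_AE[of "\<lambda>x. holder_var \<theta> A \<alpha> x (\<phi> x)" M] by (rule eventually_mono) (use V s_def in auto)
  moreover have "AE x in M. \<forall>e. \<forall>\<omega> \<in> Einf \<theta> A x. \<omega> 0 = e \<longrightarrow> cl e \<le> exp (\<phi> x \<omega>) \<and> exp (\<phi> x \<omega>) \<le> cu e"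
    using cc(2) by (simp only: AE_all_countable) blast
  moreover have "AE x in M. \<forall>l. (SUP \<omega> \<in> Einf \<theta> A (\<theta> x).
        transfer A \<phi> x (indicator (Einf \<theta> A x - {\<tau>. \<tau> 0 \<le> l})) \<omega>) \<le> H l"
    unfolding AE_all_countable H_def by (intro allI esssup_AE)
  ultimately have reg: "AE x in M. R.regular_pt x"
    by eventually_elim (auto simp: R.regular_pt_def SUP_le_iff)
  have pres: "distr M M (\<theta> ^^ k) = M" for k
  proof (induction k)
    case (Suc k)
    have "distr M M (\<theta> ^^ Suc k) = distr (distr M M (\<theta> ^^ k)) M \<theta>"
      using th(1) R.funpow_measurable[of k] by (subst distr_distr) (auto simp: o_def)
    also have "\<dots> = M" by (simp only: Suc th(2))
    finally show ?case .
  qed (simp add: id_def distr_id)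
  have "AE x in M. R.regular_pt ((\<theta> ^^ k) x)" for k
    by (rule AE_distrD[OF R.funpow_measurable[of k]]) (simp only: pres reg)
  then have "AE x in M. \<forall>k. R.regular_pt ((\<theta> ^^ k) x)" by (simp add: AE_all_countable)
  then have "AE x in M. R.good_pt x"
    using AE_space by eventually_elim (simp add: R.good_pt_def)
  then show ?thesis by (rule R.conformal_measure_exists[rotated 2]) (use st in blast)+
qed

end
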